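(* Let $\mathbf{X}_{t-n+1},\dots,\mathbf{X}_t$ be conditionally independently distributed with $\mathbf{X}_i|\boldsymbol\mu,\boldsymbol\Sigma\sim\mathcal N_k(\boldsymbol\mu,\boldsymbol\Sigma)$ for $i=t-n+1,\dots,t$, with $n>k$. Let $\mathbf{w}_t=C_t\boldsymbol\Sigma^{-1}(\boldsymbol\mu-r_{f,t+1}\mathbf 1)$ and let $\mathbf L$ be a $p\times k$-dimensional matrix of constants. (a) Under the diffuse prior, the stochastic representation of $\mathbf L\mathbf w_t$ (that is, of its posterior distribution given the data $\mathbf x_{t,n}$) is $$\begin{aligned}\mathbf L\mathbf w_t\stackrel{d}{=}{}&C_t\,\eta\,\mathbf L\mathbf S_{t,d}^*(\boldsymbol\mu)^{-1}(\boldsymbol\mu-r_{f,t+1}\mathbf 1)\\&+C_t\sqrt{\eta}\Big((\boldsymbol\mu-r_{f,t+1}\mathbf 1)^\top\mathbf S_{t,d}^*(\boldsymbol\mu)^{-1}(\boldsymbol\mu-r_{f,t+1}\mathbf 1)\cdot\mathbf L\mathbf S_{t,d}^*(\boldsymbol\mu)^{-1}\mathbf L^\top\\&-\mathbf L\mathbf S_{t,d}^*(\boldsymbol\mu)^{-1}(\boldsymbol\mu-r_{f,t+1}\mathbf 1)(\boldsymbol\mu-r_{f,t+1}\mathbf 1)^\top\mathbf S_{t,d}^*(\boldsymbol\mu)^{-1}\mathbf L^\top\Big)^{1/2}\mathbf z_0,\end{aligned}$$ where $\eta\sim\chi^2_n$, $\mathbf z_0\sim\mathcal N_p(\mathbf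 0,\mathbf I_p)$, and $\boldsymbol\mu|\mathbf x_{t,n}\sim t_k\big(n-k,\overline{\mathbf x}_{t,d},\mathbf S_{t,d}/(n(n-k))\big)$; moreover, $\eta$, $\mathbf z_0$ and $\boldsymbol\mu$ are mutually independent. (b) Under the conjugate prior, the stochastic representation of $\mathbf L\mathbf w_t$ (that is, of its posterior distribution given the data $\mathbf x_{t,n}$) is $$\begin{aligned}\mathbf L\mathbf w_t\stackrel{d}{=}{}&C_t\,\eta\,\mathbf L\mathbf S_{t,c}^*(\boldsymbol\mu)^{-1}(\boldsymbol\mu-r_{f,t+1}\mathbf 1)\\&+C_t\sqrt{\eta}\Big((\boldsymbol\mu-r_{f,t+1}\mathbf 1)^\top\mathbf S_{t,c}^*(\boldsymbol\mu)^{-1}(\boldsymbol\mu-r_{f,t+1}\mathbf 1)\cdot\mathbf L\mathbf S_{t,c}^*(\boldsymbol\mu)^{-1}\mathbf L^\top\\&-\mathbf L\mathbf S_{t,c}^*(\boldsymbol\mu)^{-1}(\boldsymbol\mu-r_{f,t+1}\mathbf 1)(\boldsymbol\mu-r_{f,t+1}\mathbf 1)^\top\mathbf S_{t,c}^*(\boldsymbol\mu)^{-1}\mathbf L^\top\Big)^{1/2}\mathbf z_0,\end{aligned}$$ where $\eta\sim\chi^2_{n+d_0-k}$, $\mathbf z_0\sim\mathcal N_p(\mathbf 0,\mathbf I_p)$, and $\boldsymbol\mu|\mathbf x_{t,n}\sim t_k\big(n+d_0-2k,\overline{\mathbf x}_{t,c},\mathbf S_{t,c}/((n+r_0)(n+d_0-2k))\big)$;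 moreover, $\eta$, $\mathbf z_0$ and $\boldsymbol\mu$ are mutually independent.
   Context: Setting. $\boldsymbol\mu\in\mathbb R^k$ and the positive definite $k\times k$ matrix $\boldsymbol\Sigma$ are unknown parameters (mean vector and covariance matrix of the returns on $k$ assets) endowed with a prior $\pi(\boldsymbol\mu,\boldsymbol\Sigma)$; the posterior given the observation matrix $\mathbf x_{t,n}=(\mathbf x_{t-n+1},\dots,\mathbf x_t)$ (realizations of $\mathbf X_{t-n+1},\dots,\mathbf X_t$) is $\pi(\boldsymbol\mu,\boldsymbol\Sigma|\mathbf x_{t,n})\propto L(\mathbf x_{t,n}|\boldsymbol\mu,\boldsymbol\Sigma)\pi(\boldsymbol\mu,\boldsymbol\Sigma)$, with $L$ the normal likelihood. Weights. $\mathbf w_t$ ($t\in\{0,\dots,T-1\}$) is the multi-period optimal portfolio weight vector for the exponential utility $U(x)=-\exp(-\gamma x)$, with $C_t=(\gamma W_t\prod_{i=t+2}^T R_{f,i})^{-1}$, where $\gamma>0$ is the coefficient of absolute risk aversion, $W_t$ is the wealth at time $t$, $r_{f,i}$ is the risk-free return in period $i$, $R_{f,i}=1+r_{f,i}$, and $\prod_{i=T+1}^T R_{f,i}\equiv1$. $C_t$ and $r_{f,t+1}$ are treated as known; $\mathbf 1$ is the $k$-dimensional vector of ones. Priors. Diffuse (Jeffreys) prior: $\pi(\boldsymbol\mu,\boldsymbol\Sigma)\propto|\boldsymbol\Sigma|^{-(k+1)/2}$. Conjugate prior: $\boldsymbol\mu|\boldsymbol\Sigma\sim\mathcal N_k(\mathbf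 m_0,\frac1{r_0}\boldsymbol\Sigma)$, $\boldsymbol\Sigma\sim\mathcal{IW}_k(d_0,\mathbf S_0)$ with hyperparameters $\mathbf m_0$, $r_0$, $d_0$, $\mathbf S_0$. Here $\mathcal{IW}_k(d,\mathbf S)$ is the inverse Wishart distribution with $d$ degrees of freedom and parameter matrix $\mathbf S$, in the parametrization with density proportional to $|\boldsymbol\Sigma|^{-d/2}\exp(-\frac12\mathrm{tr}(\mathbf S\boldsymbol\Sigma^{-1}))$; equivalently $\boldsymbol\Sigma^{-1}$ is Wishart with $d-k-1$ degrees of freedom and scale matrix $\mathbf S^{-1}$. Data quantities. $\overline{\mathbf x}_t=\frac1n\sum_{i=t-n+1}^t\mathbf x_i$, $\mathbf S_t=\frac1{n-1}\sum_{i=t-n+1}^t(\mathbf x_i-\overline{\mathbf x}_t)(\mathbf x_i-\overline{\mathbf x}_t)^\top$; $\overline{\mathbf x}_{t,d}=\overline{\mathbf x}_t$, $\mathbf S_{t,d}=(n-1)\mathbf S_t$; $$\overline{\mathbf x}_{t,c}=\frac{n\overline{\mathbf x}_t+r_0\mathbf m_0}{n+r_0},\qquad \mathbf S_{t,c}=\mathbf S_{t,d}+\mathbf S_0+nr_0\frac{(\mathbf m_0-\overline{\mathbf x}_{t,c})(\mathbf m_0-\overline{\mathbf x}_{t,c})^\top}{n+r_0}.$$ Also $\mathbf S_{t,d}^*(\boldsymbol\mu)=\mathbf S_{t,d}+n(\boldsymbol\mu-\overline{\mathbf x}_{t,d})(\boldsymbol\mu-\overline{\mathbf x}_{t,d})^\top$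 and $\mathbf S_{t,c}^*(\boldsymbol\mu)=\mathbf S_{t,c}+(n+r_0)(\boldsymbol\mu-\overline{\mathbf x}_{t,c})(\boldsymbol\mu-\overline{\mathbf x}_{t,c})^\top$. Notation. $t_k(d,\mathbf a,\mathbf A)$ is the $k$-dimensional $t$-distribution with $d$ degrees of freedom, location vector $\mathbf a$ and dispersion matrix $\mathbf A$. $\stackrel{d}{=}$ is equality in distribution. $(\cdot)^{1/2}$ denotes a matrix square root.
   Formalization: In S_{t,c} the last term is taken with m_0 minus the sample mean x̄_t instead of the printed m_0 minus x̄_{t,c}, since (b) is false with the printed formula; (a) is stated for almost every sample, as S_{t,d} may be singular on a null set. *)

theory Defs
  imports "HOL-Probability.Probability"
begin

definition outer :: "real ^ 'm \<Rightarrow> real ^ 'n \<Rightarrow> real ^ 'n ^ 'm" where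
  "outer u v = (\<chi> i j. u $ i * v $ j)"

definition posdef :: "real ^ 'k ^ 'k \<Rightarrow> bool" where
  "posdef A \<longleftrightarrow> transpose A = A \<and> (\<forall>v. v \<noteq> 0 \<longrightarrow> v \<bullet> (A *v v) > 0)"

definition possemidef :: "real ^ 'k ^ 'k \<Rightarrow> bool" where
  "possemidef A \<longleftrightarrow> transpose A = A \<and> (\<forall>v. v \<bullet> (A *v v) \<ge> 0)"

text \<open>
  A Borel choice of a square root for every positive semidefinite matrix. Both the symmetric
  square root and the Cholesky factor are instances. Nothing is required of the values outside
  the positive semidefinite matrices.
\<close>

definition matrix_square_root :: "(real ^ 'p ^ 'p \<Rightarrow> real ^ 'p ^ 'p) \<Rightarrow> bool" where
  "matrix_square_root R \<longleftrightarrow> R \<in> borel_measurable borel \<and>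
     (\<forall>A. possemidef A \<longrightarrow> R A ** transpose (R A) = A)"

text \<open>
  Lebesgue measure on the symmetric matrices: the coordinates are the \<open>k(k+1)/2\<close> entries on and
  above the diagonal. They are indexed by the unordered pairs \<open>{i, j}\<close>, so that no order on the
  index type is needed.
\<close>

definition sym_lborel :: "(real ^ 'k ^ 'k) measure" where
  "sym_lborel = distr (\<Pi>\<^sub>M s\<in>{{i, j} | i j :: 'k. True}. lborel) borel (\<lambda>f. \<chi> i j. f {i, j})"

definition posdef_lborel :: "(real ^ 'k ^ 'k) measure" where
  "posdef_lborel = density sym_lborel (indicator {\<Sigma>. posdef \<Sigma>})"

definition mvnormal_density :: "real ^ 'k \<Rightarrow> real ^ 'k ^ 'k \<Rightarrow> real ^ 'k \<Rightarrow> real" where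
  "mvnormal_density \<mu> \<Sigma> x =
     exp (- ((x - \<mu>) \<bullet> (matrix_inv \<Sigma> *v (x - \<mu>))) / 2) / sqrt ((2 * pi) ^ CARD('k) * det \<Sigma>)"

definition mvnormal :: "real ^ 'k \<Rightarrow> real ^ 'k ^ 'k \<Rightarrow> (real ^ 'k) measure" where
  "mvnormal \<mu> \<Sigma> = density lborel (\<lambda>x. ennreal (mvnormal_density \<mu> \<Sigma> x))"

definition mvt_density :: "real \<Rightarrow> real ^ 'k \<Rightarrow> real ^ 'k ^ 'k \<Rightarrow> real ^ 'k \<Rightarrow> real" where
  "mvt_density d a A x =
     Gamma ((d + real CARD('k)) / 2) /
       (Gamma (d / 2) * (d * pi) powr (real CARD('k) / 2) * sqrt (det A)) *
     (1 + ((x - a) \<bullet> (matrix_inv A *v (x - a))) / d) powr (- (d + real CARD('k)) / 2)"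

definition mvt :: "real \<Rightarrow> real ^ 'k \<Rightarrow> real ^ 'k ^ 'k \<Rightarrow> (real ^ 'k) measure" where
  "mvt d a A = density lborel (\<lambda>x. ennreal (mvt_density d a A x))"

definition chi_square_density :: "real \<Rightarrow> real \<Rightarrow> real" where
  "chi_square_density d x =
     (if x > 0 then x powr (d / 2 - 1) * exp (- x / 2) / (2 powr (d / 2) * Gamma (d / 2)) else 0)"

definition chi_square :: "real \<Rightarrow> real measure" where
  "chi_square d = density lborel (\<lambda>x. ennreal (chi_square_density d x))"

text \<open>
  In this parametrization the inverse of the random matrix is Wishart with \<open>d - k - 1\<close> degrees of
  freedom and scale matrix \<open>S\<inverse>\<close>, so the density is integrable for \<open>d > 2 k\<close>.
\<close>

definition inverse_wishart_kernel :: "real \<Rightarrow> real ^ 'k ^ 'k \<Rightarrow> real ^ 'k ^ 'k \<Rightarrow> real" where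
  "inverse_wishart_kernel d S \<Sigma> =
     det \<Sigma> powr (- d / 2) * exp (- trace (S ** matrix_inv \<Sigma>) / 2)"

definition inverse_wishart_density :: "real \<Rightarrow> real ^ 'k ^ 'k \<Rightarrow> real ^ 'k ^ 'k \<Rightarrow> real" where
  "inverse_wishart_density d S \<Sigma> =
     inverse_wishart_kernel d S \<Sigma> / (\<integral>\<Omega>. inverse_wishart_kernel d S \<Omega> \<partial>posdef_lborel)"

text \<open>
  The observations up to time \<open>t\<close> carry the time stamps \<open>t - n + 1, \<dots>, t\<close>, which may be negative.
\<close>

definition obs_times :: "nat \<Rightarrow> int \<Rightarrow> int set" where
  "obs_times n t = {t - int n + 1..t}"

definition sampling_law ::
    "nat \<Rightarrow> int \<Rightarrow> real ^ 'k \<Rightarrow> real ^ 'k ^ 'k \<Rightarrow> (int \<Rightarrow> real ^ 'k) measure" where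
  "sampling_law n t \<mu> \<Sigma> = (\<Pi>\<^sub>M i\<in>obs_times n t. mvnormal \<mu> \<Sigma>)"

definition likelihood ::
    "nat \<Rightarrow> int \<Rightarrow> (int \<Rightarrow> real ^ 'k) \<Rightarrow> real ^ 'k \<Rightarrow> real ^ 'k ^ 'k \<Rightarrow> real" where
  "likelihood n t x \<mu> \<Sigma> = (\<Prod>i\<in>obs_times n t. mvnormal_density \<mu> \<Sigma> (x i))"

definition diffuse_prior :: "real ^ 'k \<Rightarrow> real ^ 'k ^ 'k \<Rightarrow> real" where
  "diffuse_prior \<mu> \<Sigma> = det \<Sigma> powr (- (real CARD('k) + 1) / 2)"

definition conjugate_prior ::
    "real ^ 'k \<Rightarrow> real \<Rightarrow> real \<Rightarrow> real ^ 'k ^ 'k \<Rightarrow> real ^ 'k \<Rightarrow> real ^ 'k ^ 'k \<Rightarrow> real" where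
  "conjugate_prior m\<^sub>0 r\<^sub>0 d\<^sub>0 S\<^sub>0 \<mu> \<Sigma> =
     mvnormal_density m\<^sub>0 ((1 / r\<^sub>0) *\<^sub>R \<Sigma>) \<mu> * inverse_wishart_density d\<^sub>0 S\<^sub>0 \<Sigma>"

definition unnormalized_posterior ::
    "(real ^ 'k \<Rightarrow> real ^ 'k ^ 'k \<Rightarrow> real) \<Rightarrow> nat \<Rightarrow> int \<Rightarrow> (int \<Rightarrow> real ^ 'k) \<Rightarrow>
     ((real ^ 'k) \<times> (real ^ 'k ^ 'k)) measure" where
  "unnormalized_posterior prior n t x =
     density (lborel \<Otimes>\<^sub>M posdef_lborel) (\<lambda>(\<mu>, \<Sigma>). ennreal (likelihood n t x \<mu> \<Sigma> * prior \<mu> \<Sigma>))"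

text \<open>
  Dividing by the total mass. This is a probability measure iff the total mass is positive and
  finite, i.e. iff the posterior is proper.
\<close>

definition posterior ::
    "(real ^ 'k \<Rightarrow> real ^ 'k ^ 'k \<Rightarrow> real) \<Rightarrow> nat \<Rightarrow> int \<Rightarrow> (int \<Rightarrow> real ^ 'k) \<Rightarrow>
     ((real ^ 'k) \<times> (real ^ 'k ^ 'k)) measure" where
  "posterior prior n t x =
     uniform_measure (unnormalized_posterior prior n t x)
       (space (unnormalized_posterior prior n t x))"

definition sample_mean :: "nat \<Rightarrow> int \<Rightarrow> (int \<Rightarrow> real ^ 'k) \<Rightarrow> real ^ 'k" where
  "sample_mean n t x = (1 / real n) *\<^sub>R (\<Sum>i\<in>obs_times n t. x i)"

definition sample_cov :: "nat \<Rightarrow> int \<Rightarrow> (int \<Rightarrow> real ^ 'k) \<Rightarrow> real ^ 'k ^ 'k" where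
  "sample_cov n t x = (1 / (real n - 1)) *\<^sub>R
     (\<Sum>i\<in>obs_times n t. outer (x i - sample_mean n t x) (x i - sample_mean n t x))"

definition xbar_d :: "nat \<Rightarrow> int \<Rightarrow> (int \<Rightarrow> real ^ 'k) \<Rightarrow> real ^ 'k" where
  "xbar_d n t x = sample_mean n t x"

definition S_d :: "nat \<Rightarrow> int \<Rightarrow> (int \<Rightarrow> real ^ 'k) \<Rightarrow> real ^ 'k ^ 'k" where
  "S_d n t x = (real n - 1) *\<^sub>R sample_cov n t x"

definition Sstar_d :: "nat \<Rightarrow> int \<Rightarrow> (int \<Rightarrow> real ^ 'k) \<Rightarrow> real ^ 'k \<Rightarrow> real ^ 'k ^ 'k" where
  "Sstar_d n t x \<mu> = S_d n t x + real n *\<^sub>R outer (\<mu> - xbar_d n t x) (\<mu> - xbar_d n t x)"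

definition xbar_c ::
    "real ^ 'k \<Rightarrow> real \<Rightarrow> nat \<Rightarrow> int \<Rightarrow> (int \<Rightarrow> real ^ 'k) \<Rightarrow> real ^ 'k" where
  "xbar_c m\<^sub>0 r\<^sub>0 n t x =
     (1 / (real n + r\<^sub>0)) *\<^sub>R (real n *\<^sub>R sample_mean n t x + r\<^sub>0 *\<^sub>R m\<^sub>0)"

text \<open>
  Completing the square in \<open>\<mu>\<close> leaves the distance of the prior mean to the sample mean (not to
  \<^const>\<open>xbar_c\<close>) in the last term.
\<close>

definition S_c ::
    "real ^ 'k \<Rightarrow> real \<Rightarrow> real ^ 'k ^ 'k \<Rightarrow> nat \<Rightarrow> int \<Rightarrow> (int \<Rightarrow> real ^ 'k) \<Rightarrow> real ^ 'k ^ 'k" where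
  "S_c m\<^sub>0 r\<^sub>0 S\<^sub>0 n t x = S_d n t x + S\<^sub>0 +
     (real n * r\<^sub>0 / (real n + r\<^sub>0)) *\<^sub>R outer (m\<^sub>0 - xbar_d n t x) (m\<^sub>0 - xbar_d n t x)"

definition Sstar_c ::
    "real ^ 'k \<Rightarrow> real \<Rightarrow> real ^ 'k ^ 'k \<Rightarrow> nat \<Rightarrow> int \<Rightarrow> (int \<Rightarrow> real ^ 'k) \<Rightarrow> real ^ 'k \<Rightarrow>
     real ^ 'k ^ 'k" where
  "Sstar_c m\<^sub>0 r\<^sub>0 S\<^sub>0 n t x \<mu> = S_c m\<^sub>0 r\<^sub>0 S\<^sub>0 n t x +
     (real n + r\<^sub>0) *\<^sub>R outer (\<mu> - xbar_c m\<^sub>0 r\<^sub>0 n t x) (\<mu> - xbar_c m\<^sub>0 r\<^sub>0 n t x)"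

definition wealth_const ::
    "real \<Rightarrow> (int \<Rightarrow> real) \<Rightarrow> (int \<Rightarrow> real) \<Rightarrow> int \<Rightarrow> int \<Rightarrow> real" where
  "wealth_const \<gamma> W rf T t = inverse (\<gamma> * W t * (\<Prod>i\<in>{t + 2..T}. 1 + rf i))"

definition weights :: "real \<Rightarrow> real \<Rightarrow> real ^ 'k \<Rightarrow> real ^ 'k ^ 'k \<Rightarrow> real ^ 'k" where
  "weights C r \<mu> \<Sigma> = C *\<^sub>R (matrix_inv \<Sigma> *v (\<mu> - r *\<^sub>R 1))"

text \<open>
  The right-hand side of the stochastic representation as a function of \<open>\<eta>\<close>, \<open>z\<close> and the excess
  mean \<open>m = \<mu> - r 1\<close>, with \<open>V\<close> the inverse of \<open>S\<^sup>*(\<mu>)\<close> and \<open>R\<close> the square root.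
\<close>

definition weights_rep ::
    "(real ^ 'p ^ 'p \<Rightarrow> real ^ 'p ^ 'p) \<Rightarrow> real \<Rightarrow> real ^ 'k ^ 'p \<Rightarrow> real ^ 'k ^ 'k \<Rightarrow> real ^ 'k \<Rightarrow>
     real \<Rightarrow> real ^ 'p \<Rightarrow> real ^ 'p" where
  "weights_rep R C L V m \<eta> z =
     (C * \<eta>) *\<^sub>R (L *v (V *v m)) +
     (C * sqrt \<eta>) *\<^sub>R
       (R ((m \<bullet> (V *v m)) *\<^sub>R (L ** V ** transpose L) - L ** V ** outer m m ** V ** transpose L)
          *v z)"

end

theory Submission
  imports Defs
begin

text \<open>
  On the positive definite matrices both posteriors have a density proportional to an inverse Wishart
  kernel \<open>(det \<Sigma>) powr (-(\<nu> + k + 1) / 2) * exp (- tr (S\<^sup>*(\<mu>) \<Sigma>\<^sup>-\<^sup>1) / 2)\<close> with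
  \<open>S\<^sup>*(\<mu>) = S + \<rho> (\<mu> - a) (\<mu> - a)\<^sup>T\<close>; only \<open>\<nu>\<close>, \<open>S\<close>, \<open>\<rho>\<close> and \<open>a\<close> depend on the prior
  (\<open>likelihood_diffuse_prior\<close>, \<open>likelihood_conjugate_prior\<close>). One argument, \<open>posterior_representation\<close>,
  therefore serves both parts: it integrates \<open>\<Sigma>\<close> out for fixed \<open>\<mu>\<close>, for which it needs the total mass
  of the kernel and the law of \<open>\<Sigma>\<^sup>-\<^sup>1 m\<close> with \<open>m = \<mu> - r 1\<close>.
  
  Both come from a Schur complement. Write \<open>S\<^sup>*(\<mu>) = A A\<^sup>T\<close> with an \<open>A\<close> for which \<open>m\<close> is a multiple of
  \<open>A e\<^sub>i\<close> (\<open>posdef_factor\<close>). The substitution \<open>\<Sigma> \<mapsto> A \<Sigma> A\<^sup>T\<close>, with Jacobian \<open>\<bar>det A\<bar> ^ (k + 1)\<close>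
  (\<open>nn_integral_sym_lborel_congruence\<close>), reduces the problem to \<open>S\<^sup>*(\<mu>) = 1\<close> and \<open>m = e\<^sub>i\<close>. Let \<open>D\<close> be \<open>\<Sigma>\<close>
  without row and column \<open>i\<close>, let \<open>- D u\<close> be the rest of column \<open>i\<close>, and let \<open>s\<close> be the Schur
  complement of \<open>D\<close>. Then \<open>\<Sigma>\<^sup>-\<^sup>1 e\<^sub>i = (e\<^sub>i + u) / s\<close>, \<open>det \<Sigma> = s det D\<close> and
  \<open>tr \<Sigma>\<^sup>-\<^sup>1 = tr D\<^sup>-\<^sup>1 + (1 + u \<bullet> u) / s\<close>, so the kernel is a function of \<open>D\<close> times a function of \<open>(s, u)\<close>.
  Under the second factor \<open>\<eta> = 1 / s\<close> is chi-square distributed and \<open>z = \<surd>\<eta> u\<close> is standard normal and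
  independent of \<open>\<eta>\<close>, and \<open>\<Sigma>\<^sup>-\<^sup>1 e\<^sub>i = \<eta> e\<^sub>i + \<surd>\<eta> z\<close> (\<open>nn_integral_iw_kernel_insert\<close>, \<open>schur_integral_eq\<close>).
  The first factor is the kernel in one dimension less with the exponent of the determinant lowered
  by one, so that the total mass is finite by induction on the dimension (\<open>iw_mass_finite\<close>). The
  dimension is a type; the induction therefore runs over sets \<open>I\<close> of indices, and a smaller matrix
  is a \<open>k \<times> k\<close> matrix that is the identity outside \<open>I\<close>.
  
  Undoing the substitution gives \<open>L \<Sigma>\<^sup>-\<^sup>1 m = \<eta> L V m + \<surd>\<eta> Q z\<close> with \<open>V\<close> the inverse of \<open>S\<^sup>*(\<mu>)\<close>, where
  \<open>Q Q\<^sup>T\<close> is the matrix under the root in the claim. The law of \<open>Q z\<close> depends on \<open>Q Q\<^sup>T\<close> only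
  (\<open>distr_std_mvnormal_matrix_cong\<close>), hence any square root may take the place of \<open>Q\<close>. The mass that
  is left for \<open>\<mu>\<close> is proportional to \<open>(det S\<^sup>*(\<mu>)) powr (- \<nu> / 2)\<close>, and since
  \<open>det S\<^sup>*(\<mu>) = det S * (1 + \<rho> (\<mu> - a) \<bullet> S\<^sup>-\<^sup>1 (\<mu> - a))\<close> this is the kernel of the t-distribution of the
  claim. All this needs \<open>S\<close> to be positive definite, which in the diffuse case holds for almost every
  sample because \<open>n > k\<close> (\<open>AE_posdef_S_d\<close>).
\<close>

section \<open>Matrix algebra\<close>

declare transpose_matrix_vector [simp del]

lemma matrix_add_rdistrib: "(A + B) ** C = A ** C + B ** (C :: real^'n^'m)"
  by (simp add: vec_eq_iff matrix_matrix_mult_def sum.distrib algebra_simps)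

lemma det_nonzeroI:
  fixes A :: "real^'n^'n"
  assumes "\<And>v. A *v v = 0 \<Longrightarrow> v = 0"
  shows "det A \<noteq> 0"
proof -
  obtain B where "B ** A = mat 1"
    using assms matrix_left_invertible_ker[of A] by blast
  then show ?thesis by (metis det_I det_mul mult_zero_right zero_neq_one)
qed

lemma matrix_inv_unique:
  fixes A B :: "real^'n^'n"
  assumes "A ** B = mat 1"
  shows "matrix_inv A = B"
proof -
  have BA: "B ** A = mat 1" using assms by (simp add: matrix_left_right_inverse)
  have "A ** matrix_inv A = mat 1 \<and> matrix_inv A ** A = mat 1"
    unfolding matrix_inv_def by (rule someI[of _ B]) (simp add: assms BA)
  then have "B ** (A ** matrix_inv A) = B" by simp
  then show ?thesis by (simp add: matrix_mul_assoc BA)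
qed

lemma matrix_inv_mult_self:
  fixes A :: "real^'n^'n"
  assumes "det A \<noteq> 0"
  shows "A ** matrix_inv A = mat 1" "matrix_inv A ** A = mat 1"
proof -
  obtain B where "A ** B = mat 1"
    using assms invertible_det_nz invertible_def by metis
  moreover from this have "matrix_inv A = B" by (rule matrix_inv_unique)
  ultimately show "A ** matrix_inv A = mat 1" "matrix_inv A ** A = mat 1"
    by (auto simp: matrix_left_right_inverse)
qed

lemma matrix_inv_cancel:
  fixes A :: "real^'n^'n"
  assumes "det A \<noteq> 0"
  shows "A *v (matrix_inv A *v x) = x" "matrix_inv A *v (A *v x) = x"
  using matrix_inv_mult_self[OF assms] by (simp_all add: matrix_vector_mul_assoc)

lemma matrix_inv_mult:
  fixes A B :: "real^'n^'n"
  assumes "det A \<noteq> 0" "det B \<noteq> 0"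
  shows "matrix_inv (A ** B) = matrix_inv B ** matrix_inv A"
proof (rule matrix_inv_unique)
  have "A ** B ** (matrix_inv B ** matrix_inv A) = A ** (B ** matrix_inv B) ** matrix_inv A"
    by (simp only: matrix_mul_assoc)
  then show "A ** B ** (matrix_inv B ** matrix_inv A) = mat 1"
    by (simp add: assms matrix_inv_mult_self)
qed

lemma matrix_inv_transpose:
  fixes A :: "real^'n^'n"
  assumes "det A \<noteq> 0"
  shows "matrix_inv (transpose A) = transpose (matrix_inv A)"
  by (rule matrix_inv_unique)
     (simp add: matrix_transpose_mul[symmetric] assms matrix_inv_mult_self transpose_mat)

lemma det_matrix_inv:
  fixes A :: "real^'n^'n"
  assumes "det A \<noteq> 0"
  shows "det (matrix_inv A) = 1 / det A"
proof -
  have "det A * det (matrix_inv A) = 1"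
    using matrix_inv_mult_self(1)[OF assms] by (metis det_I det_mul)
  then show ?thesis using assms by (simp add: field_simps)
qed

lemma matrix_inv_scaleR:
  fixes A :: "real^'n^'n"
  assumes "det A \<noteq> 0" "c \<noteq> 0"
  shows "matrix_inv (c *\<^sub>R A) = (1 / c) *\<^sub>R matrix_inv A"
  by (rule matrix_inv_unique) (simp add: assms matrix_inv_mult_self matrix_scalar_ac scalar_matrix_assoc[symmetric])

lemma det_scaleR:
  fixes A :: "real^'n^'n"
  shows "det (c *\<^sub>R A) = c ^ CARD('n) * det A"
proof -
  have "c *\<^sub>R A = mat c ** A"
    by (simp add: vec_eq_iff matrix_matrix_mult_def mat_def if_distrib if_distribR sum.delta cong: if_cong)
  moreover have "det (mat c :: real^'n^'n) = c ^ CARD('n)"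
    by (subst det_diagonal) (auto simp: mat_def)
  ultimately show ?thesis by (simp add: det_mul)
qed

lemma inner_matrix_vector_mul:
  fixes A :: "real^'n^'m"
  shows "x \<bullet> (A *v y) = (transpose A *v x) \<bullet> y"
  by (metis dot_lmul_matrix inner_commute transpose_transpose vector_transpose_matrix)

lemma axis_inner_matrix_axis: "axis i 1 \<bullet> ((A :: real^'n^'m) *v axis j 1) = A $ i $ j"
  by (simp add: inner_axis' matrix_vector_mul_component inner_axis)

lemma matrix_mult_axis_component: "((A :: real^'n^'m) *v axis j 1) $ i = A $ i $ j"
  by (simp add: matrix_vector_mul_component inner_axis)

lemma outer_mult_vec: "outer u v *v w = (v \<bullet> w) *\<^sub>R u"
  by (simp add: vec_eq_iff outer_def matrix_vector_mult_def inner_vec_def sum_distrib_left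
      mult_ac)

lemma mult_outer: "A ** outer u v = outer (A *v u) v"
  by (simp add: vec_eq_iff outer_def matrix_vector_mult_def matrix_matrix_mult_def sum_distrib_right
      sum_distrib_left mult_ac)

lemma outer_mult: "outer u v ** A = outer u (transpose A *v v)"
  by (simp add: vec_eq_iff outer_def matrix_vector_mult_def matrix_matrix_mult_def transpose_def
      sum_distrib_left mult_ac)

lemma transpose_outer: "transpose (outer u v) = outer v u"
  by (simp add: vec_eq_iff outer_def transpose_def)

lemma trace_outer: "trace (outer u v) = u \<bullet> v"
  by (simp add: trace_def outer_def inner_vec_def)

lemma trace_outer_mult: "trace (outer u v ** A) = v \<bullet> (A *v u)"
  unfolding outer_mult trace_outer
  by (subst inner_matrix_vector_mul) (simp add: inner_commute)

lemma trace_scaleR: "trace (c *\<^sub>R A) = c * trace (A :: real^'n^'n)"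
  by (simp add: trace_def sum_distrib_left)

lemma trace_sum: "trace (\<Sum>i\<in>I. f i) = (\<Sum>i\<in>I. trace (f i :: real^'n^'n))"
  by (induction I rule: infinite_finite_induct) (simp_all add: trace_add trace_0[unfolded mat_0])

lemma matrix_mult_sum_left: "(\<Sum>i\<in>I. f i) ** B = (\<Sum>i\<in>I. (f i :: real^'n^'n) ** B)"
  by (induction I rule: infinite_finite_induct) (simp_all add: matrix_add_rdistrib)

lemma outer_scaleR_left: "outer (c *\<^sub>R u) v = c *\<^sub>R outer u v"
  and outer_scaleR_right: "outer u (c *\<^sub>R v) = c *\<^sub>R outer u v"
  by (simp_all add: vec_eq_iff outer_def)

lemma transpose_add: "transpose (A + B) = transpose A + transpose (B :: real^'n^'m)"
  and transpose_scaleR: "transpose (c *\<^sub>R A) = c *\<^sub>R transpose A"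
  by (simp_all add: vec_eq_iff transpose_def)

section \<open>Positive definite matrices and orthogonal transformations\<close>

lemma posdef_det_nonzero: "posdef A \<Longrightarrow> det A \<noteq> 0"
  unfolding posdef_def by (rule det_nonzeroI) (metis inner_zero_right less_irrefl)

lemma posdef_congruence:
  assumes "posdef A" "det B \<noteq> 0"
  shows "posdef (transpose B ** A ** B)"
  unfolding posdef_def
proof (intro conjI allI impI)
  show "transpose (transpose B ** A ** B) = transpose B ** A ** B"
    using assms(1) by (simp add: posdef_def matrix_transpose_mul matrix_mul_assoc transpose_transpose)
  fix v :: "real^'a" assume v: "v \<noteq> 0"
  have Bv: "B *v v \<noteq> 0" using v assms(2) matrix_inv_cancel(2)[of B v] by auto
  have "v \<bullet> (transpose B ** A ** B *v v) = (B *v v) \<bullet> (A *v (B *v v))"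
    by (simp add: matrix_vector_mul_assoc[symmetric] inner_matrix_vector_mul transpose_transpose)
  also have "\<dots> > 0" using Bv assms(1) by (simp add: posdef_def)
  finally show "v \<bullet> (transpose B ** A ** B *v v) > 0" .
qed

text \<open>
  Gram-Schmidt orthogonalization of the standard basis for the inner product given by \<open>S\<close>, one axis
  at a time: once the axis \<open>i\<close> has been scaled to length one, its multiples are subtracted from the
  other axes. The axes treated before are already orthogonal to the axis \<open>i\<close> and do not change.
\<close>

lemma posdef_congruence_axes:
  fixes S :: "real^'n^'n" and I :: "'n set"
  assumes "posdef S"
  shows "\<exists>B. det B \<noteq> 0 \<and>
    (\<forall>p\<in>I. \<forall>q. (transpose B ** S ** B) $ p $ q = (if p = q then 1 else 0))"
proof (induction I rule: finite_induct[OF finite])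
  case 1
  then show ?case by (intro exI[of _ "mat 1"]) simp
next
  case (2 i I)
  then obtain B where B: "det B \<noteq> 0"
    "\<And>p q. p \<in> I \<Longrightarrow> (transpose B ** S ** B) $ p $ q = (if p = q then 1 else 0)" by blast
  define S' where "S' = transpose B ** S ** B"
  have S': "posdef S'" unfolding S'_def using assms B(1) by (rule posdef_congruence)
  then have tS': "transpose S' = S'" by (simp add: posdef_def)
  have sym: "S' $ p $ q = S' $ q $ p" for p q
    by (subst tS'[symmetric]) (simp add: transpose_def)
  define c where "c = S' $ i $ i"
  have c: "c > 0"
    using S' unfolding posdef_def c_def by (metis axis_eq_0_iff axis_inner_matrix_axis zero_neq_one)
  \<comment> \<open>The elementary matrix that scales the axis \<open>i\<close> and subtracts its multiples from the others.\<close>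
  define w :: "real^'n" where "w = (\<chi> j. if j = i then 1 / sqrt c - 1 else - S' $ i $ j / c)"
  define E where "E = mat 1 + outer (axis i 1) w"
  have Ev: "E *v v = v + (w \<bullet> v) *\<^sub>R axis i 1" for v
    by (simp add: E_def matrix_vector_mult_add_rdistrib outer_mult_vec)
  have detE: "det E \<noteq> 0"
  proof (rule det_nonzeroI)
    fix v assume v: "E *v v = 0"
    have "v $ j = 0" if "j \<noteq> i" for j
      using arg_cong[OF v, of "\<lambda>x. x $ j"] that by (simp add: Ev axis_def)
    then have vi: "v = v $ i *\<^sub>R axis i 1" by (auto simp: vec_eq_iff axis_def)
    have "(1 + w $ i) * v $ i = 0"
      using arg_cong[OF v, of "\<lambda>x. x $ i"]
      by (subst (asm) vi, subst (asm) Ev) (simp add: inner_axis algebra_simps)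
    then have "v $ i = 0" using c by (simp add: w_def)
    with vi show "v = 0" by simp
  qed
  define T where "T = transpose E ** S' ** E"
  have T: "T $ p $ q = (E *v axis p 1) \<bullet> (S' *v (E *v axis q 1))" for p q
    unfolding axis_inner_matrix_axis[symmetric] T_def
    by (simp add: matrix_vector_mul_assoc[symmetric] inner_matrix_vector_mul transpose_transpose)
  have Ea: "E *v axis j 1 = axis j 1 + w $ j *\<^sub>R axis i 1" for j
    by (simp add: Ev inner_axis)
  have T': "T $ p $ q = S' $ p $ q + w $ p * S' $ i $ q + w $ q * S' $ p $ i + w $ p * w $ q * c" for p q
    unfolding T Ea by (simp add: matrix_vector_right_distrib matrix_vector_mult_scaleR inner_add_left
      inner_add_right axis_inner_matrix_axis c_def algebra_simps)
  have T_i: "T $ i $ q = (if i = q then 1 else 0)" for q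
  proof (cases "q = i")
    case True
    have "T $ i $ i = c * (1 + w $ i)\<^sup>2"
      unfolding T' by (simp add: c_def power2_eq_square algebra_simps)
    also have "\<dots> = 1" using c by (simp add: w_def power_divide)
    finally show ?thesis using True by simp
  next
    case False
    have "w $ q * c = - S' $ i $ q" using c False by (simp add: w_def)
    then have "S' $ i $ q + w $ i * S' $ i $ q + w $ q * c + w $ i * (w $ q * c) = 0"
      by (simp add: algebra_simps)
    then show ?thesis using False unfolding T' by (simp add: c_def algebra_simps)
  qed
  have T_I: "T $ p $ q = (if p = q then 1 else 0)" if "p \<in> I" for p q
  proof -
    have p: "p \<noteq> i" using that 2 by auto
    have "S' $ p $ i = 0" using B(2)[OF that] p by (simp add: S'_def)
    then show ?thesis using B(2)[OF that] p sym[of i p] by (simp add: T' w_def S'_def)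
  qed
  have "transpose (B ** E) ** S ** (B ** E) = T"
    by (simp add: T_def S'_def matrix_transpose_mul matrix_mul_assoc)
  moreover have "det (B ** E) \<noteq> 0" using B(1) detE by (simp add: det_mul)
  ultimately show ?case using T_i T_I by (intro exI[of _ "B ** E"]) auto
qed

text \<open>
  The factor is not unique: \<open>A\<close> may be multiplied from the right by an orthogonal matrix. This freedom
  is used to turn \<open>A\<^sup>-\<^sup>1 m\<close> into the direction of the axis \<open>i\<close>.
\<close>

lemma posdef_factor:
  fixes S :: "real^'n^'n"
  assumes "posdef S"
  obtains A \<rho> where "det A \<noteq> 0" "S = A ** transpose A" "m = A *v (\<rho> *\<^sub>R axis i 1)"
proof -
  obtain B where B: "det B \<noteq> 0"
    "\<And>p q. (transpose B ** S ** B) $ p $ q = (if p = q then 1 else 0)"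
    using posdef_congruence_axes[OF assms, of UNIV] by auto
  have BSB: "transpose B ** S ** B = mat 1"
    using B(2) by (simp add: vec_eq_iff mat_def)
  obtain f :: "real^'n \<Rightarrow> real^'n" where f: "orthogonal_transformation f" "f (norm (transpose B *v m) *\<^sub>R axis i 1) = transpose B *v m"
    using orthogonal_transformation_exists[of "norm (transpose B *v m) *\<^sub>R axis i 1" "transpose B *v m"]
    by auto
  define U where "U = matrix f"
  have U: "U ** transpose U = mat 1"
    using f(1) unfolding U_def orthogonal_transformation_matrix orthogonal_matrix_def by auto
  have Uv: "U *v v = f v" for v
    using f(1) unfolding U_def orthogonal_transformation_def by (simp add: matrix_works)
  define Bi where "Bi = transpose (matrix_inv B)"
  have Bi: "Bi ** transpose B = mat 1"
    unfolding Bi_def by (simp add: matrix_transpose_mul[symmetric] B matrix_inv_mult_self transpose_mat)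
  have "det Bi \<noteq> 0" using B(1) by (simp add: Bi_def det_matrix_inv)
  moreover have "det U \<noteq> 0" using U by (metis det_I det_mul mult_zero_left zero_neq_one)
  ultimately have "det (Bi ** U) \<noteq> 0" by (simp add: det_mul)
  moreover have "S = (Bi ** U) ** transpose (Bi ** U)"
  proof -
    have "S = Bi ** (transpose B ** S ** B) ** matrix_inv B"
    proof -
      have "Bi ** (transpose B ** S ** B) ** matrix_inv B
        = (Bi ** transpose B) ** S ** (B ** matrix_inv B)" by (simp only: matrix_mul_assoc)
      also have "\<dots> = S"
        unfolding Bi matrix_inv_mult_self(1)[OF B(1)] matrix_mul_lid matrix_mul_rid ..
      finally show ?thesis by (rule sym)
    qed
    also have "\<dots> = Bi ** (U ** transpose U) ** transpose Bi"
      by (simp add: BSB U Bi_def transpose_transpose)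
    finally show ?thesis by (simp add: matrix_transpose_mul matrix_mul_assoc)
  qed
  moreover have "m = (Bi ** U) *v (norm (transpose B *v m) *\<^sub>R axis i 1)"
    by (simp only: matrix_vector_mul_assoc[symmetric] Uv f(2)) (simp add: matrix_vector_mul_assoc Bi)
  ultimately show thesis by (rule that)
qed

lemma posdef_det_pos: "posdef (S :: real^'n^'n) \<Longrightarrow> det S > 0"
proof -
  assume S: "posdef S"
  obtain A \<rho> where "det A \<noteq> 0" "S = A ** transpose A" "(0::real^'n) = A *v (\<rho> *\<^sub>R axis undefined 1)"
    using posdef_factor[OF S] .
  then show ?thesis by (auto simp: det_mul zero_less_mult_iff det_transpose)
qed

lemma posdef_matrix_inv:
  assumes "posdef A" shows "posdef (matrix_inv A)"
proof -
  have d: "det A \<noteq> 0" using assms by (rule posdef_det_nonzero)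
  have t: "transpose A = A" using assms by (simp add: posdef_def)
  have "posdef (transpose (matrix_inv A) ** A ** matrix_inv A)"
    using assms d by (intro posdef_congruence) (simp_all add: det_matrix_inv)
  moreover have "transpose (matrix_inv A) ** A ** matrix_inv A = matrix_inv A"
    using d t by (simp add: matrix_inv_transpose[symmetric] matrix_inv_mult_self)
  ultimately show ?thesis by simp
qed

lemma posdef_scaleR: "posdef A \<Longrightarrow> c > 0 \<Longrightarrow> posdef (c *\<^sub>R A)"
  by (simp add: posdef_def transpose_scaleR scaleR_matrix_vector_assoc[symmetric])

lemma quadratic_form_outer_self: "v \<bullet> (outer u u *v v) = (u \<bullet> v)\<^sup>2"
  by (simp add: outer_mult_vec power2_eq_square inner_commute)

lemma posdef_add_outer:
  assumes "posdef A" "c \<ge> 0" shows "posdef (A + c *\<^sub>R outer u u)"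
  using assms unfolding posdef_def
  by (auto simp: transpose_add transpose_scaleR transpose_outer matrix_vector_mult_add_rdistrib
      scaleR_matrix_vector_assoc[symmetric] inner_add_right quadratic_form_outer_self intro!: add_pos_nonneg)

lemma posdef_add: "posdef A \<Longrightarrow> transpose B = B \<Longrightarrow> (\<And>v. v \<bullet> (B *v v) \<ge> 0) \<Longrightarrow> posdef (A + B)"
  unfolding posdef_def
  by (auto simp: transpose_add matrix_vector_mult_add_rdistrib inner_add_right intro!: add_pos_nonneg)

lemma det_mat_add_axis: "det (mat 1 + c *\<^sub>R outer (axis i 1) (axis i 1) :: real^'n^'n) = 1 + c"
proof -
  have "det (mat 1 + c *\<^sub>R outer (axis i 1) (axis i 1) :: real^'n^'n)
     = (\<Prod>j\<in>UNIV. (mat 1 + c *\<^sub>R outer (axis i 1) (axis i 1) :: real^'n^'n) $ j $ j)"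
    by (rule det_diagonal) (auto simp: mat_def outer_def axis_def)
  also have "\<dots> = (\<Prod>j\<in>UNIV. if j = i then 1 + c else 1)"
    by (intro prod.cong) (auto simp: mat_def outer_def axis_def)
  finally show ?thesis by simp
qed

text \<open>
  The matrix determinant lemma. By \<open>posdef_factor\<close> it reduces to a rank-one update of the identity in
  the direction of an axis, which is diagonal.
\<close>

lemma det_add_outer:
  fixes S :: "real^'n^'n"
  assumes S: "posdef S"
  shows "det (S + c *\<^sub>R outer w w) = det S * (1 + c * (w \<bullet> (matrix_inv S *v w)))"
proof -
  fix i :: 'n
  obtain A \<rho> where A: "det A \<noteq> 0" "S = A ** transpose A" "w = A *v (\<rho> *\<^sub>R axis i 1)"
    using posdef_factor[OF S] .
  define e :: "real^'n" where "e = axis i 1"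
  have w: "w = \<rho> *\<^sub>R (A *v e)" using A(3) by (simp add: e_def matrix_vector_mult_scaleR)
  have "outer w w = \<rho>\<^sup>2 *\<^sub>R outer (A *v e) (A *v e)"
    unfolding w by (simp add: outer_scaleR_left outer_scaleR_right power2_eq_square)
  also have "outer (A *v e) (A *v e) = A ** outer e e ** transpose A"
    by (simp add: mult_outer outer_mult)
  finally have "S + c *\<^sub>R outer w w = A ** (mat 1 + (c * \<rho>\<^sup>2) *\<^sub>R outer e e) ** transpose A"
    unfolding A(2) by (simp add: matrix_add_rdistrib matrix_add_ldistrib
      matrix_scalar_ac scalar_matrix_assoc[symmetric])
  then have "det (S + c *\<^sub>R outer w w) = det S * (1 + c * \<rho>\<^sup>2)"
    by (simp add: det_mul det_mat_add_axis A(2) e_def)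
  moreover have "w \<bullet> (matrix_inv S *v w) = \<rho>\<^sup>2"
    using A(1) unfolding A(2,3)
    by (simp add: matrix_inv_mult matrix_vector_mul_assoc[symmetric] matrix_inv_cancel
       matrix_inv_transpose inner_matrix_vector_mul transpose_transpose power2_eq_square inner_axis)
  ultimately show ?thesis by simp
qed

text \<open>
  Two families of vectors with the same Gram matrix differ by an orthogonal transformation. The vectors
  are matched one after the other: the reflection that exchanges the image of the next \<open>x l\<close> with \<open>y l\<close>
  fixes the vectors matched so far, as these are orthogonal to the difference of the two.
\<close>

lemma orthogonal_transformation_of_equal_inner:
  fixes x y :: "'i \<Rightarrow> real^'n"
  assumes "finite J" "\<And>a b. a \<in> J \<Longrightarrow> b \<in> J \<Longrightarrow> x a \<bullet> x b = y a \<bullet> y b"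
  shows "\<exists>f. orthogonal_transformation f \<and> (\<forall>a\<in>J. f (x a) = y a)"
  using assms
proof (induction J rule: finite_induct)
  case empty
  then show ?case using orthogonal_transformation_id by blast
next
  case (insert l J)
  then obtain f where f: "orthogonal_transformation f" "\<And>a. a \<in> J \<Longrightarrow> f (x a) = y a" by auto
  define d where "d = f (x l) - y l"
  \<comment> \<open>For \<open>d = 0\<close> division by zero makes this the identity, as it should be.\<close>
  define g where "g v = v - (2 * (d \<bullet> v) / (d \<bullet> d)) *\<^sub>R d" for v
  have lg: "linear g"
    unfolding g_def by (intro linearI) (simp_all add: inner_add_right algebra_simps add_divide_distrib)
  have g: "orthogonal_transformation g"
    unfolding orthogonal_transformation_def
  proof (intro conjI lg allI)
    fix v w
    show "g v \<bullet> g w = v \<bullet> w"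
    proof (cases "d = 0")
      case False
      then have "d \<bullet> d \<noteq> 0" by simp
      then show ?thesis unfolding g_def
        by (simp add: inner_diff_left inner_diff_right inner_commute field_simps)
    qed (simp add: g_def)
  qed
  have fl: "f (x l) \<bullet> f (x l) = y l \<bullet> y l"
    using f(1) insert.prems[of l l] by (simp add: orthogonal_transformation_def)
  have gl: "g (f (x l)) = y l"
  proof (cases "d = 0")
    case False
    have "d \<bullet> d = 2 * (d \<bullet> f (x l))"
      unfolding d_def using fl by (simp add: d_def inner_diff_left inner_diff_right inner_commute)
    moreover have "d \<bullet> d \<noteq> 0" using False by simp
    ultimately have "2 * (d \<bullet> f (x l)) / (d \<bullet> d) = 1" by simp
    then have "g (f (x l)) = f (x l) - 1 *\<^sub>R d" unfolding g_def by (simp only:)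
    then show ?thesis by (simp add: d_def)
  qed (simp add: g_def d_def)
  have gJ: "g (y a) = y a" if "a \<in> J" for a
  proof -
    have "f (x l) \<bullet> f (x a) = y l \<bullet> y a"
      using f(1) insert.prems[of l a] that by (simp add: orthogonal_transformation_def)
    then show ?thesis using f(2)[OF that] by (simp add: g_def d_def inner_diff_left)
  qed
  have "orthogonal_transformation (g \<circ> f)"
    using g f(1) by (rule orthogonal_transformation_compose)
  moreover have "(g \<circ> f) (x a) = y a" if "a \<in> insert l J" for a
    using that gl gJ f(2) by (metis comp_apply insertE)
  ultimately show ?case by blast
qed


section \<open>Measurability of matrix operations\<close>

lemma borel_measurable_vec_lambda [measurable (raw)]:
  fixes f :: "'x \<Rightarrow> 'n::finite \<Rightarrow> 'b::euclidean_space"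
  assumes "\<And>i. (\<lambda>x. f x i) \<in> borel_measurable M"
  shows "(\<lambda>x. \<chi> i. f x i) \<in> borel_measurable M"
proof (subst borel_measurable_euclidean_space, rule ballI)
  fix b :: "'b^'n" assume "b \<in> Basis"
  then obtain i c where "b = axis i c" "c \<in> Basis" by (auto simp: Basis_vec_def)
  then show "(\<lambda>x. (\<chi> i. f x i) \<bullet> b) \<in> borel_measurable M"
    using assms[of i] by (simp add: inner_axis)
qed

lemma borel_measurable_vec_nth [measurable]:
  fixes i :: "'n::finite"
  shows "(\<lambda>x :: 'b::euclidean_space^'n. x $ i) \<in> borel_measurable borel"
  by (intro borel_measurable_continuous_onI continuous_intros)

lemma borel_measurable_matrix_vector_mult [measurable (raw)]:
  fixes f :: "'x \<Rightarrow> real^'n^'m"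
  assumes [measurable]: "f \<in> borel_measurable M" "g \<in> borel_measurable M"
  shows "(\<lambda>x. f x *v g x) \<in> borel_measurable M"
  unfolding matrix_vector_mult_def by measurable

lemma borel_measurable_matrix_matrix_mult [measurable (raw)]:
  fixes f :: "'x \<Rightarrow> real^'n^'m" and g :: "'x \<Rightarrow> real^'k^'n"
  assumes [measurable]: "f \<in> borel_measurable M" "g \<in> borel_measurable M"
  shows "(\<lambda>x. f x ** g x) \<in> borel_measurable M"
  unfolding matrix_matrix_mult_def by measurable

lemma borel_measurable_outer [measurable (raw)]:
  fixes f :: "'x \<Rightarrow> real^'m" and g :: "'x \<Rightarrow> real^'k"
  assumes [measurable]: "f \<in> borel_measurable M" "g \<in> borel_measurable M"
  shows "(\<lambda>x. outer (f x) (g x)) \<in> borel_measurable M"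
  unfolding outer_def by measurable

lemma borel_measurable_transpose [measurable (raw)]:
  fixes f :: "'x \<Rightarrow> real^'n^'m"
  assumes [measurable]: "f \<in> borel_measurable M"
  shows "(\<lambda>x. transpose (f x)) \<in> borel_measurable M"
  unfolding transpose_def by measurable

lemma borel_measurable_det [measurable (raw)]:
  fixes f :: "'x \<Rightarrow> real^'n^'n"
  assumes [measurable]: "f \<in> borel_measurable M"
  shows "(\<lambda>x. det (f x)) \<in> borel_measurable M"
  unfolding det_def by measurable

lemma borel_measurable_trace [measurable (raw)]:
  fixes f :: "'x \<Rightarrow> real^'n^'n"
  assumes [measurable]: "f \<in> borel_measurable M"
  shows "(\<lambda>x. trace (f x)) \<in> borel_measurable M"
  unfolding trace_def by measurable

text \<open>
  Invertible matrices are inverted by Cramer's rule, which is a Borel function. On the other matrices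
  the choice operator in the definition of the inverse has no witness, so the value is one constant.
\<close>

lemma borel_measurable_matrix_inv [measurable (raw)]:
  fixes f :: "'x \<Rightarrow> real^'n^'n"
  assumes f [measurable]: "f \<in> borel_measurable M"
  shows "(\<lambda>x. matrix_inv (f x)) \<in> borel_measurable M"
proof -
  define J :: "real^'n^'n" where "J = (SOME A'. False)"
  define C where "C A = (\<chi> k l. det (\<chi> i j. if j = k then axis l 1 $ i else (A :: real^'n^'n) $ i $ j) / det A)" for A
  have "matrix_inv A = (if det A = 0 then J else C A)" for A :: "real^'n^'n"
  proof (cases "det A = 0")
    case True
    then have e: "(A ** A' = mat 1 \<and> A' ** A = mat 1) = False" for A'
      by (metis det_I det_mul mult_zero_left zero_neq_one)
    show ?thesis using True by (simp add: matrix_inv_def J_def e)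
  next
    case False
    have "A *v (C A *v axis l 1) = axis l 1" for l
    proof (rule cramer[THEN iffD2, OF False])
      show "C A *v axis l 1 = (\<chi> k. det (\<chi> i j. if j = k then axis l 1 $ i else A $ i $ j) / det A)"
        by (simp add: vec_eq_iff matrix_mult_axis_component C_def)
    qed
    then have "(A ** C A) *v axis l 1 = axis l 1" for l
      by (simp add: matrix_vector_mul_assoc)
    then have "(A ** C A) $ i $ l = axis l 1 $ i" for i l
      by (metis matrix_mult_axis_component)
    then have "A ** C A = mat 1"
      by (simp add: vec_eq_iff mat_def axis_def)
    then have "matrix_inv A = C A" by (rule matrix_inv_unique)
    then show ?thesis using False by simp
  qed
  then have "(\<lambda>x. matrix_inv (f x)) = (\<lambda>x. if det (f x) = 0 then J else C (f x))" by auto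
  also have "\<dots> \<in> borel_measurable M" unfolding C_def by measurable
  finally show ?thesis .
qed

text \<open>
  By compactness of the sphere a positive definite quadratic form is bounded below by a positive
  multiple of \<open>v \<bullet> v\<close>. This makes the positive definite matrices a countable union of closed sets.
\<close>

lemma sets_Collect_posdef [measurable]: "{A :: real^'n^'n. posdef A} \<in> sets borel"
proof -
  have "{A :: real^'n^'n. posdef A} =
    {A. transpose A = A} \<inter> (\<Union>n::nat. \<Inter>v. {A. v \<bullet> (A *v v) \<ge> (1 / Suc n) * (v \<bullet> v)})"
    (is "_ = _ \<inter> ?U")
  proof (intro set_eqI iffI)
    fix A :: "real^'n^'n" assume A: "A \<in> {A. posdef A}"
    have "continuous_on (sphere 0 1) (\<lambda>v. v \<bullet> (A *v v))"
      by (intro continuous_intros linear_continuous_on_compose matrix_vector_mul_linear)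
    then obtain v where v: "v \<in> sphere 0 1" "\<And>w. w \<in> sphere 0 1 \<Longrightarrow> v \<bullet> (A *v v) \<le> w \<bullet> (A *v w)"
      using continuous_attains_inf[of "sphere (0::real^'n) 1" "\<lambda>v. v \<bullet> (A *v v)"] by auto
    from v(1) have "v \<noteq> 0" by auto
    with A have "v \<bullet> (A *v v) > 0" by (simp add: posdef_def)
    then obtain n :: nat where n: "1 / Suc n < v \<bullet> (A *v v)"
      using reals_Archimedean by (auto simp: inverse_eq_divide)
    have "w \<bullet> (A *v w) \<ge> (1 / Suc n) * (w \<bullet> w)" for w
    proof (cases "w = 0")
      case False
      define u where "u = w /\<^sub>R norm w"
      have w: "w = norm w *\<^sub>R u" using False by (simp add: u_def)
      have "u \<in> sphere 0 1" using False by (simp add: u_def)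
      then have "u \<bullet> (A *v u) \<ge> 1 / Suc n" using v(2)[of u] n by simp
      then have "(norm w)\<^sup>2 * (u \<bullet> (A *v u)) \<ge> (norm w)\<^sup>2 * (1 / Suc n)"
        by (intro mult_left_mono) auto
      moreover have "w \<bullet> (A *v w) = (norm w)\<^sup>2 * (u \<bullet> (A *v u))"
        by (subst (1 2) w) (simp add: matrix_vector_mult_scaleR power2_eq_square)
      ultimately show ?thesis by (simp add: dot_square_norm mult.commute)
    qed simp
    then show "A \<in> {A. transpose A = A} \<inter> ?U" using A by (auto simp: posdef_def)
  next
    fix A :: "real^'n^'n" assume "A \<in> {A. transpose A = A} \<inter> ?U"
    then obtain n where A: "transpose A = A" "\<And>v. v \<bullet> (A *v v) \<ge> (1 / Suc n) * (v \<bullet> v)" by auto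
    have "v \<bullet> (A *v v) > 0" if "v \<noteq> 0" for v
      by (rule less_le_trans[OF _ A(2)]) (simp add: that)
    with A show "A \<in> {A. posdef A}" by (simp add: posdef_def)
  qed
  also have "\<dots> \<in> sets borel"
  proof -
    have "closed {A :: real^'n^'n. v \<bullet> (A *v v) \<ge> (1 / Suc n) * (v \<bullet> v)}" for n and v :: "real^'n"
      unfolding matrix_vector_mult_def by (intro closed_Collect_le continuous_intros)
    then have "closed (\<Inter>v. {A :: real^'n^'n. v \<bullet> (A *v v) \<ge> (1 / Suc n) * (v \<bullet> v)})" for n
      by blast
    then have "?U \<in> sets borel" by (intro sets.countable_UN) (auto intro: borel_closed)
    moreover have "{A :: real^'n^'n. transpose A = A} \<in> sets borel" by measurable
    ultimately show ?thesis by simp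
  qed
  finally show ?thesis .
qed

lemma pred_posdef [measurable]: "Measurable.pred borel (posdef :: real^'n^'n \<Rightarrow> bool)"
  using sets_Collect_posdef[where 'n='n] by (simp add: pred_def)

section \<open>Linear changes of variables\<close>

lemma prod_Basis_vec: "(\<Prod>b\<in>Basis. f b) = (\<Prod>i\<in>UNIV. f (axis i 1 :: real^'n))"
proof -
  have "(Basis :: (real^'n) set) = range (\<lambda>i. axis i 1)" by (auto simp: Basis_vec_def)
  then show ?thesis by (subst (asm) set_eq_iff, subst prod.reindex[symmetric, unfolded o_def]) (auto simp: inj_on_def axis_eq_axis intro!: prod.cong)
qed

interpretation lborel_prod: product_sigma_finite "\<lambda>_. lborel :: real measure"
  by standard

lemma distr_PiM_lborel:
  "distr (\<Pi>\<^sub>M i\<in>UNIV. lborel) borel (\<lambda>f. \<chi> i. f i) = (lborel :: (real^'n) measure)"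
proof (rule lborel_eqI[symmetric])
  fix l u :: "real^'n" assume lu: "\<And>b. b \<in> Basis \<Longrightarrow> l \<bullet> b \<le> u \<bullet> b"
  have le: "l $ i \<le> u $ i" for i
    using lu[of "axis i 1"] by (auto simp: inner_axis axis_in_Basis_iff)
  have "(\<lambda>f. \<chi> i. f i) -` box l u \<inter> space (\<Pi>\<^sub>M i\<in>UNIV. lborel) = (\<Pi>\<^sub>E i\<in>UNIV. {l $ i<..<u $ i})"
    by (auto simp: space_PiM PiE_def Pi_def mem_box_cart)
  then have "emeasure (distr (\<Pi>\<^sub>M i\<in>UNIV. lborel) borel (\<lambda>f. \<chi> i. f i)) (box l u)
     = emeasure (\<Pi>\<^sub>M i\<in>UNIV. lborel) (\<Pi>\<^sub>E i\<in>UNIV. {l $ i<..<u $ i})"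
    by (simp add: emeasure_distr)
  also have "\<dots> = (\<Prod>i\<in>UNIV. ennreal (u $ i - l $ i))"
    by (subst lborel_prod.emeasure_PiM) (auto simp: le)
  also have "\<dots> = ennreal (\<Prod>b\<in>Basis. (u - l) \<bullet> b)"
    by (subst prod_ennreal) (auto simp: le prod_Basis_vec inner_axis)
  finally show "emeasure (distr (\<Pi>\<^sub>M i\<in>UNIV. lborel) borel (\<lambda>f. \<chi> i. f i)) (box l u)
    = ennreal (\<Prod>b\<in>Basis. (u - l) \<bullet> b)" .
qed simp

lemma measurable_PiM_lborel_component:
  assumes "i \<in> I" shows "(\<lambda>f. f i) \<in> borel_measurable (\<Pi>\<^sub>M i\<in>I. lborel :: real measure)"
  using measurable_component_singleton[OF assms, of "\<lambda>_. lborel :: real measure"] by simp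

lemma measurable_PiM_lborel_restrict:
  assumes "\<And>i. i \<in> I \<Longrightarrow> (\<lambda>f. g f i) \<in> borel_measurable M"
  shows "(\<lambda>f. \<lambda>i\<in>I. g f i) \<in> M \<rightarrow>\<^sub>M (\<Pi>\<^sub>M i\<in>I. lborel)"
  using assms by (intro measurable_restrict) simp

text \<open>
  The coordinate \<open>a\<close> is integrated first; for it the map is an affine substitution on the line, because
  \<open>g\<close> does not depend on it.
\<close>

lemma nn_integral_PiM_affine_coordinate:
  fixes F :: "('i \<Rightarrow> real) \<Rightarrow> ennreal"
  assumes I: "finite I" "a \<in> I" and c: "c \<noteq> 0"
    and F [measurable]: "F \<in> borel_measurable (\<Pi>\<^sub>M i\<in>I. lborel)"
    and g [measurable]: "g \<in> borel_measurable (\<Pi>\<^sub>M i\<in>I. lborel)"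
    and indep: "\<And>f y. g (f(a := y)) = g f"
  shows "(\<integral>\<^sup>+f. F f \<partial>(\<Pi>\<^sub>M i\<in>I. lborel))
    = ennreal \<bar>c\<bar> * (\<integral>\<^sup>+f. F (f(a := g f + c * f a)) \<partial>(\<Pi>\<^sub>M i\<in>I. lborel))"
proof -
  let ?J = "I - {a}"
  have J: "finite ?J" "a \<notin> ?J" "insert a ?J = I" using I by auto
  have upd: "(\<lambda>y. f(a := y)) \<in> borel \<rightarrow>\<^sub>M (\<Pi>\<^sub>M i\<in>I. lborel)"
    if "f \<in> space (\<Pi>\<^sub>M i\<in>?J. lborel)" for f
    by (rule measurable_fun_upd[where J = ?J]) (use that I in auto)
  have [measurable]: "(\<lambda>f. f a :: real) \<in> borel_measurable (\<Pi>\<^sub>M i\<in>I. lborel)"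
    using I(2) by (rule measurable_PiM_lborel_component)
  have shift [measurable]: "(\<lambda>f. f(a := g f + c * f a)) \<in> (\<Pi>\<^sub>M i\<in>I. lborel) \<rightarrow>\<^sub>M (\<Pi>\<^sub>M i\<in>I. lborel)"
    by (rule measurable_fun_upd[where J = I]) (use I in auto)
  have "(\<integral>\<^sup>+f. F f \<partial>(\<Pi>\<^sub>M i\<in>insert a ?J. lborel)) = (\<integral>\<^sup>+f. \<integral>\<^sup>+y. F (f(a := y)) \<partial>lborel \<partial>(\<Pi>\<^sub>M i\<in>?J. lborel))"
    by (rule lborel_prod.product_nn_integral_insert) (use J in simp_all)
  also have "\<dots> = (\<integral>\<^sup>+f. ennreal \<bar>c\<bar> * (\<integral>\<^sup>+y. F (f(a := g f + c * y)) \<partial>lborel) \<partial>(\<Pi>\<^sub>M i\<in>?J. lborel))"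
    by (intro nn_integral_cong nn_integral_real_affine c measurable_compose[OF upd F])
  also have "\<dots> = (\<integral>\<^sup>+f. (\<integral>\<^sup>+y. ennreal \<bar>c\<bar> * F (f(a := g f + c * y)) \<partial>lborel) \<partial>(\<Pi>\<^sub>M i\<in>?J. lborel))"
    by (intro nn_integral_cong nn_integral_cmult[symmetric]
        measurable_compose[OF _ measurable_compose[OF upd F]]) simp_all
  also have "\<dots> = (\<integral>\<^sup>+f. ennreal \<bar>c\<bar> * F (f(a := g f + c * f a)) \<partial>(\<Pi>\<^sub>M i\<in>insert a ?J. lborel))"
    by (subst lborel_prod.product_nn_integral_insert) (use J in \<open>simp_all add: indep\<close>)
  also have "\<dots> = ennreal \<bar>c\<bar> * (\<integral>\<^sup>+f. F (f(a := g f + c * f a)) \<partial>(\<Pi>\<^sub>M i\<in>insert a ?J. lborel))"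
    unfolding J(3) by (rule nn_integral_cmult) measurable
  finally show ?thesis unfolding J(3) .
qed

text \<open>
  Several coordinates at once. The sources \<open>h i\<close> that enter with a nonzero coefficient lie outside \<open>K\<close>,
  so they are never changed, and the coordinates in \<open>K\<close> can be treated in any order.
\<close>

lemma nn_integral_PiM_affine:
  fixes F :: "('i \<Rightarrow> real) \<Rightarrow> ennreal" and c e :: "'i \<Rightarrow> real"
  assumes I: "finite I" and K: "K \<subseteq> I" and c: "\<And>i. i \<in> K \<Longrightarrow> c i \<noteq> 0"
    and h: "\<And>i. i \<in> K \<Longrightarrow> h i \<in> I" "\<And>i. i \<in> K \<Longrightarrow> h i \<in> K \<Longrightarrow> e i = 0"
    and F [measurable]: "F \<in> borel_measurable (\<Pi>\<^sub>M i\<in>I. lborel)"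
  shows "(\<integral>\<^sup>+f. F f \<partial>(\<Pi>\<^sub>M i\<in>I. lborel)) = ennreal \<bar>\<Prod>i\<in>K. c i\<bar> *
    (\<integral>\<^sup>+f. F (\<lambda>i\<in>I. if i \<in> K then e i * f (h i) + c i * f i else f i) \<partial>(\<Pi>\<^sub>M i\<in>I. lborel))"
proof -
  let ?P = "\<Pi>\<^sub>M i\<in>I. lborel :: real measure"
  define m where "m L f = (\<lambda>i\<in>I. if i \<in> L then e i * f (h i) + c i * f i else f i)" for L and f :: "'i \<Rightarrow> real"
  have coord [measurable]: "(\<lambda>f. f i) \<in> borel_measurable ?P" if "i \<in> I" for i
    using that by (rule measurable_PiM_lborel_component)
  have m [measurable]: "m L \<in> ?P \<rightarrow>\<^sub>M ?P" if "L \<subseteq> K" for L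
    unfolding m_def[abs_def]
  proof (rule measurable_PiM_lborel_restrict)
    show "(\<lambda>f. if i \<in> L then e i * f (h i) + c i * f i else f i) \<in> borel_measurable ?P" if i: "i \<in> I" for i
    proof (cases "i \<in> L")
      case True
      then have [measurable]: "(\<lambda>f. f (h i)) \<in> borel_measurable ?P" using \<open>L \<subseteq> K\<close> h(1) by (intro coord) auto
      show ?thesis using True coord[OF i] by simp
    qed (use coord[OF i] in simp)
  qed
  have "(\<integral>\<^sup>+f. F f \<partial>?P) = ennreal \<bar>\<Prod>i\<in>L. c i\<bar> * (\<integral>\<^sup>+f. F (m L f) \<partial>?P)" if "L \<subseteq> K" for L
    using finite_subset[OF that finite_subset[OF K I]] that
  proof (induction L rule: finite_induct)
    case empty
    have "f \<in> space ?P \<Longrightarrow> m {} f = f" for f by (auto simp: m_def space_PiM PiE_def extensional_restrict)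
    then show ?case by (simp cong: nn_integral_cong)
  next
    case (insert a L)
    then have a: "a \<in> K" "a \<in> I" "h a \<in> I" "c a \<noteq> 0" and L [measurable]: "m L \<in> ?P \<rightarrow>\<^sub>M ?P" and ca [measurable]: "(\<lambda>f. f (h a)) \<in> borel_measurable ?P"
      using K h(1) c by (auto intro: m coord)
    have "(\<integral>\<^sup>+f. F (m L f) \<partial>?P) = ennreal \<bar>c a\<bar> * (\<integral>\<^sup>+f. F (m L (f(a := e a * f (h a) + c a * f a))) \<partial>?P)"
      by (rule nn_integral_PiM_affine_coordinate[where g = "\<lambda>f. e a * f (h a)"]) (use I a h(2)[of a] in auto)
    moreover have "m L (f(a := e a * f (h a) + c a * f a)) = m (insert a L) f" for f
    proof -
      have "e i = 0" if "i \<in> L" "h i = a" for i using that insert.prems h(2)[of i] by auto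
      then show ?thesis using insert.hyps by (auto simp: m_def restrict_def fun_eq_iff)
    qed
    ultimately show ?case using insert by (simp add: abs_mult ennreal_mult'' mult_ac)
  qed
  from this[of K] show ?thesis by (simp add: m_def)
qed

lemma nn_integral_PiM_scale:
  fixes F :: "('i \<Rightarrow> real) \<Rightarrow> ennreal"
  assumes "finite I" "\<And>i. c i \<noteq> 0" "F \<in> borel_measurable (\<Pi>\<^sub>M i\<in>I. lborel)"
  shows "(\<integral>\<^sup>+f. F f \<partial>(\<Pi>\<^sub>M i\<in>I. lborel))
    = ennreal \<bar>\<Prod>i\<in>I. c i\<bar> * (\<integral>\<^sup>+f. F (\<lambda>i\<in>I. c i * f i) \<partial>(\<Pi>\<^sub>M i\<in>I. lborel))"
  using nn_integral_PiM_affine[of I I c id "\<lambda>_. 0" F] assms by (simp cong: restrict_cong)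

lemma nn_integral_PiM_shear:
  fixes F :: "('i \<Rightarrow> real) \<Rightarrow> ennreal"
  assumes "finite I" "K \<subseteq> I" "h ` K \<subseteq> I - K" "F \<in> borel_measurable (\<Pi>\<^sub>M i\<in>I. lborel)"
  shows "(\<integral>\<^sup>+f. F (\<lambda>i\<in>I. if i \<in> K then f i + f (h i) else f i) \<partial>(\<Pi>\<^sub>M i\<in>I. lborel))
    = (\<integral>\<^sup>+f. F f \<partial>(\<Pi>\<^sub>M i\<in>I. lborel))"
  using nn_integral_PiM_affine[of I K "\<lambda>_. 1" h "\<lambda>_. 1" F] assms
  by (auto simp: add.commute image_subset_iff cong: if_cong)

lemma nn_integral_PiM_reindex:
  fixes F :: "('i \<Rightarrow> real) \<Rightarrow> ennreal"
  assumes I: "finite I" and h: "bij_betw h I J"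
    and F [measurable]: "F \<in> borel_measurable (\<Pi>\<^sub>M i\<in>I. lborel)"
  shows "(\<integral>\<^sup>+f. F (\<lambda>i\<in>I. f (h i)) \<partial>(\<Pi>\<^sub>M i\<in>J. lborel)) = (\<integral>\<^sup>+f. F f \<partial>(\<Pi>\<^sub>M i\<in>I. lborel))"
proof -
  let ?P = "\<Pi>\<^sub>M i\<in>I. lborel :: real measure" and ?Q = "\<Pi>\<^sub>M i\<in>J. lborel :: real measure"
  have J: "finite J" using I h bij_betw_finite by blast
  have hI: "h i \<in> J" if "i \<in> I" for i using h that by (auto simp: bij_betw_def)
  have m [measurable]: "(\<lambda>f. \<lambda>i\<in>I. f (h i)) \<in> ?Q \<rightarrow>\<^sub>M ?P"
    using hI by (intro measurable_restrict measurable_component_singleton)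
  have "distr ?Q ?P (\<lambda>f. \<lambda>i\<in>I. f (h i)) = ?P"
  proof (rule lborel_prod.PiM_eqI[OF I])
    fix A :: "'i \<Rightarrow> real set" assume A: "\<And>i. i \<in> I \<Longrightarrow> A i \<in> sets lborel"
    define k where "k = inv_into I h"
    have k: "k j \<in> I" "h (k j) = j" if "j \<in> J" for j
      using h that unfolding k_def by (auto simp: bij_betw_def inv_into_into f_inv_into_f)
    have kh: "k (h i) = i" if "i \<in> I" for i
      using h that unfolding k_def by (auto simp: bij_betw_def)
    have "(\<lambda>f. \<lambda>i\<in>I. f (h i)) -` Pi\<^sub>E I A \<inter> space ?Q = (\<Pi>\<^sub>E j\<in>J. A (k j))"
      using k hI kh by (auto simp: space_PiM PiE_def Pi_def) metis+
    then have "emeasure (distr ?Q ?P (\<lambda>f. \<lambda>i\<in>I. f (h i))) (Pi\<^sub>E I A) = emeasure ?Q (\<Pi>\<^sub>E j\<in>J. A (k j))"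
      using A I by (subst emeasure_distr) (auto intro: sets_PiM_I_finite)
    also have "\<dots> = (\<Prod>j\<in>J. emeasure lborel (A (k j)))"
      using k A by (intro lborel_prod.emeasure_PiM J) auto
    also have "\<dots> = (\<Prod>i\<in>I. emeasure lborel (A i))"
      by (rule prod.reindex_bij_witness[of _ h k]) (use k hI kh in auto)
    finally show "emeasure (distr ?Q ?P (\<lambda>f. \<lambda>i\<in>I. f (h i))) (Pi\<^sub>E I A) = (\<Prod>i\<in>I. emeasure lborel (A i))" .
  qed simp
  then show ?thesis using nn_integral_distr[OF m, of F] by simp
qed

text \<open>
  A measure on which matrices act is scaled by a power of the determinant as soon as this holds for the
  matrices of row operations, since these generate all invertible matrices and both sides are
  multiplicative. The lemma is applied to vectors, with exponent one, and to symmetric matrices under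
  congruence, with exponent \<open>k + 1\<close>.
\<close>

lemma nn_integral_matrix_action:
  fixes act :: "real^'n^'n \<Rightarrow> 'a \<Rightarrow> 'a" and M :: "'a measure"
  assumes act [measurable]: "\<And>A. act A \<in> M \<rightarrow>\<^sub>M M"
    and comp: "\<And>A B x. act (A ** B) x = act A (act B x)"
    and diagonal: "\<And>A (F :: 'a \<Rightarrow> ennreal). (\<And>i. A $ i = A $ i $ i *\<^sub>R axis i 1) \<Longrightarrow> det A = (\<Prod>i\<in>UNIV. A $ i $ i) \<Longrightarrow> det A \<noteq> 0 \<Longrightarrow>
      F \<in> borel_measurable M \<Longrightarrow> (\<integral>\<^sup>+x. F x \<partial>M) = ennreal (\<bar>det A\<bar> ^ d) * (\<integral>\<^sup>+x. F (act A x) \<partial>M)"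
    and swap: "\<And>A (F :: 'a \<Rightarrow> ennreal) m n. (\<And>i. A $ i = axis (Transposition.transpose m n i) 1) \<Longrightarrow>
      F \<in> borel_measurable M \<Longrightarrow> (\<integral>\<^sup>+x. F x \<partial>M) = (\<integral>\<^sup>+x. F (act A x) \<partial>M)"
    and shear: "\<And>A (F :: 'a \<Rightarrow> ennreal) m n. m \<noteq> n \<Longrightarrow> (\<And>i. A $ i = axis i 1 + (if i = m then axis n 1 else 0)) \<Longrightarrow>
      F \<in> borel_measurable M \<Longrightarrow> (\<integral>\<^sup>+x. F x \<partial>M) = (\<integral>\<^sup>+x. F (act A x) \<partial>M)"
    and A: "det A \<noteq> 0" and F: "F \<in> borel_measurable M"
  shows "(\<integral>\<^sup>+x. F x \<partial>M) = ennreal (\<bar>det A\<bar> ^ d) * (\<integral>\<^sup>+x. F (act A x) \<partial>M)"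
proof -
  have "det A \<noteq> 0 \<longrightarrow> (\<forall>F \<in> borel_measurable M.
      (\<integral>\<^sup>+x. F x \<partial>M) = ennreal (\<bar>det A\<bar> ^ d) * (\<integral>\<^sup>+x. F (act A x) \<partial>M))"
  proof (induction A rule: induct_matrix_elementary_alt)
    case (1 A B)
    show ?case
    proof (intro impI ballI)
      fix F :: "'a \<Rightarrow> ennreal" assume AB: "det (A ** B) \<noteq> 0" and [measurable]: "F \<in> borel_measurable M"
      then have AB: "det A \<noteq> 0" "det B \<noteq> 0" by (auto simp: det_mul)
      have "(\<integral>\<^sup>+x. F x \<partial>M) = ennreal (\<bar>det A\<bar> ^ d) * (\<integral>\<^sup>+x. F (act A x) \<partial>M)"
        by (rule 1(1)[rule_format, OF AB(1)]) measurable
      also have "(\<integral>\<^sup>+x. F (act A x) \<partial>M) = ennreal (\<bar>det B\<bar> ^ d) * (\<integral>\<^sup>+x. F (act A (act B x)) \<partial>M)"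
        by (rule 1(2)[rule_format, OF AB(2)]) measurable
      finally show "(\<integral>\<^sup>+x. F x \<partial>M) = ennreal (\<bar>det (A ** B)\<bar> ^ d) * (\<integral>\<^sup>+x. F (act (A ** B) x) \<partial>M)"
        by (simp add: det_mul abs_mult power_mult_distrib ennreal_mult'' comp mult.assoc)
    qed
  next
    case (2 A i)
    then show ?case by (simp add: det_zero_row)
  next
    case (3 A)
    then have "A $ i = A $ i $ i *\<^sub>R axis i 1" for i by (simp add: vec_eq_iff axis_def)
    moreover have "det A = (\<Prod>i\<in>UNIV. A $ i $ i)" by (rule det_diagonal) (use 3 in auto)
    ultimately show ?case using diagonal by blast
  next
    case (4 m n)
    define S :: "real^'n^'n" where "S = (\<chi> i j. mat 1 $ i $ Transposition.transpose m n j)"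
    have "\<bar>det S\<bar> = 1"
      using det_permute_columns[OF permutes_swap_id[of m UNIV n], of "mat 1 :: real^'n^'n"]
      by (simp add: S_def sign_swap_id)
    moreover have "S $ i = axis (Transposition.transpose m n i) 1" for i
      by (auto simp: S_def vec_eq_iff mat_def axis_def)
    ultimately have "(\<integral>\<^sup>+x. F x \<partial>M) = ennreal (\<bar>det S\<bar> ^ d) * (\<integral>\<^sup>+x. F (act S x) \<partial>M)"
      if "F \<in> borel_measurable M" for F :: "'a \<Rightarrow> ennreal" using swap[OF _ that, of S m n] by simp
    then show ?case unfolding S_def by blast
  next
    case (5 m n)
    define E :: "real^'n^'n" where "E = (\<chi> i j. of_bool (i = m \<and> j = n \<or> i = j))"
    have rows: "E $ i = axis i 1 + (if i = m then axis n 1 else 0)" for i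
      using 5 by (auto simp: E_def vec_eq_iff axis_def)
    have "E = (\<chi> k. if k = m then row m (mat 1) + 1 *s row n (mat 1) else row k (mat 1))"
      using 5 by (auto simp: vec_eq_iff rows mat_def row_def axis_def)
    then have "det E = 1" using det_row_operation[OF 5, of "mat 1 :: real^'n^'n" 1] by simp
    then have "(\<integral>\<^sup>+x. F x \<partial>M) = ennreal (\<bar>det E\<bar> ^ d) * (\<integral>\<^sup>+x. F (act E x) \<partial>M)"
      if "F \<in> borel_measurable M" for F :: "'a \<Rightarrow> ennreal" using shear[OF 5 rows that] by simp
    then show ?case unfolding E_def by blast
  qed
  then show ?thesis using A F by blast
qed

lemma nn_integral_lborel_matrix:
  fixes A :: "real^'n^'n" and F :: "real^'n \<Rightarrow> ennreal"
  assumes A: "det A \<noteq> 0" and F: "F \<in> borel_measurable borel"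
  shows "(\<integral>\<^sup>+x. F x \<partial>lborel) = ennreal \<bar>det A\<bar> * (\<integral>\<^sup>+x. F (A *v x) \<partial>lborel)"
proof -
  let ?P = "\<Pi>\<^sub>M i\<in>(UNIV::'n set). lborel :: real measure"
  have to_PiM: "(\<integral>\<^sup>+x. F x \<partial>lborel) = (\<integral>\<^sup>+f. F (\<chi> i. f i) \<partial>?P)"
    if [measurable]: "F \<in> borel_measurable borel" for F :: "real^'n \<Rightarrow> ennreal"
    by (subst distr_PiM_lborel[symmetric], subst nn_integral_distr) simp_all
  have "(\<integral>\<^sup>+x. F x \<partial>lborel) = ennreal (\<bar>det A\<bar> ^ 1) * (\<integral>\<^sup>+x. F (A *v x) \<partial>lborel)"
  proof (rule nn_integral_matrix_action[where act = "(*v)" and d = 1])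
    fix A :: "real^'n^'n" and F :: "real^'n \<Rightarrow> ennreal"
    assume rows: "\<And>i. A $ i = A $ i $ i *\<^sub>R axis i 1" and det: "det A = (\<Prod>i\<in>UNIV. A $ i $ i)" "det A \<noteq> 0"
      and "F \<in> borel_measurable lborel"
    then have [measurable]: "F \<in> borel_measurable borel" by simp
    have act: "A *v (\<chi> i. f i) = (\<chi> i. A $ i $ i * f i)" for f
      by (simp add: vec_eq_iff matrix_vector_mul_component) (subst rows, simp add: inner_axis')
    have "(\<integral>\<^sup>+f. F (\<chi> i. f i) \<partial>?P) = ennreal \<bar>det A\<bar> * (\<integral>\<^sup>+f. F (\<chi> i. (\<lambda>i\<in>UNIV. A $ i $ i * f i) i) \<partial>?P)"
      unfolding det(1) by (rule nn_integral_PiM_scale) (use det in \<open>auto simp: prod_zero_iff\<close>)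
    then show "(\<integral>\<^sup>+x. F x \<partial>lborel) = ennreal (\<bar>det A\<bar> ^ 1) * (\<integral>\<^sup>+x. F (A *v x) \<partial>lborel)"
      by (simp add: to_PiM act)
  next
    fix A :: "real^'n^'n" and F :: "real^'n \<Rightarrow> ennreal" and m n :: 'n
    assume rows: "\<And>i. A $ i = axis (Transposition.transpose m n i) 1" and "F \<in> borel_measurable lborel"
    then have [measurable]: "F \<in> borel_measurable borel" by simp
    have "A *v (\<chi> i. f i) = (\<chi> i. f (Transposition.transpose m n i))" for f
      by (simp add: vec_eq_iff matrix_vector_mul_component rows inner_axis')
    moreover have "(\<integral>\<^sup>+f. F (\<chi> i. (\<lambda>i\<in>UNIV. f (Transposition.transpose m n i)) i) \<partial>?P) = (\<integral>\<^sup>+f. F (\<chi> i. f i) \<partial>?P)"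
      by (rule nn_integral_PiM_reindex) simp_all
    ultimately show "(\<integral>\<^sup>+x. F x \<partial>lborel) = (\<integral>\<^sup>+x. F (A *v x) \<partial>lborel)" by (simp add: to_PiM)
  next
    fix A :: "real^'n^'n" and F :: "real^'n \<Rightarrow> ennreal" and m n :: 'n
    assume mn: "m \<noteq> n" and rows: "\<And>i. A $ i = axis i 1 + (if i = m then axis n 1 else 0)"
      and "F \<in> borel_measurable lborel"
    then have [measurable]: "F \<in> borel_measurable borel" by simp
    have "A *v (\<chi> i. f i) = (\<chi> i. if i \<in> {m} then f i + f n else f i)" for f
      by (simp add: vec_eq_iff matrix_vector_mul_component rows inner_add_left inner_axis')
    moreover have "(\<integral>\<^sup>+f. F (\<chi> i. (\<lambda>i\<in>UNIV. if i \<in> {m} then f i + f ((\<lambda>_. n) i) else f i) i) \<partial>?P) = (\<integral>\<^sup>+f. F (\<chi> i. f i) \<partial>?P)"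
      by (rule nn_integral_PiM_shear) (use mn in simp_all)
    ultimately show "(\<integral>\<^sup>+x. F x \<partial>lborel) = (\<integral>\<^sup>+x. F (A *v x) \<partial>lborel)" by (simp add: to_PiM)
  qed (use A F in \<open>simp_all add: matrix_vector_mul_assoc\<close>)
  then show ?thesis by simp
qed

section \<open>The standard normal distribution\<close>

abbreviation (input) std_mvnormal :: "(real^'n) measure" where
  "std_mvnormal \<equiv> mvnormal 0 (mat 1)"

lemma matrix_inv_mat_1 [simp]: "matrix_inv (mat 1 :: real^'n^'n) = mat 1"
  by (rule matrix_inv_unique) simp

lemma std_mvnormal_density_eq_prod:
  "mvnormal_density 0 (mat 1) (x :: real^'n) = (\<Prod>i\<in>UNIV. std_normal_density (x $ i))"
proof -
  have "(\<Prod>i\<in>UNIV. std_normal_density (x $ i))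
     = (\<Prod>i\<in>(UNIV :: 'n set). 1 / sqrt (2 * pi)) * exp (\<Sum>i\<in>UNIV. - (x $ i)\<^sup>2 / 2)"
    unfolding std_normal_density_def by (simp only: prod.distrib exp_sum[OF finite])
  also have "(\<Sum>i\<in>UNIV. - (x $ i)\<^sup>2 / 2) = - (x \<bullet> x) / 2"
    by (simp add: inner_vec_def power2_eq_square sum_negf sum_divide_distrib)
  finally show ?thesis
    unfolding mvnormal_density_def det_I mult_1_right real_sqrt_power by (simp add: power_divide)
qed

lemma PiM_density_lborel:
  fixes g :: "'i \<Rightarrow> real \<Rightarrow> ennreal"
  assumes I: "finite I" and [measurable]: "\<And>i. g i \<in> borel_measurable borel"
    and sf: "\<And>i. sigma_finite_measure (density lborel (g i))"
  shows "(\<Pi>\<^sub>M i\<in>I. density lborel (g i)) = density (\<Pi>\<^sub>M i\<in>I. lborel) (\<lambda>x. \<Prod>i\<in>I. g i (x i))"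
proof (rule sym, rule product_sigma_finite.PiM_eqI[OF _ I])
  show "product_sigma_finite (\<lambda>i. density lborel (g i))"
    by (simp add: product_sigma_finite_def sf)
  have [measurable]: "(\<lambda>x. \<Prod>i\<in>I. g i (x i)) \<in> borel_measurable (\<Pi>\<^sub>M i\<in>I. lborel)"
    by measurable
  show "sets (density (\<Pi>\<^sub>M i\<in>I. lborel) (\<lambda>x. \<Prod>i\<in>I. g i (x i))) = sets (\<Pi>\<^sub>M i\<in>I. density lborel (g i))"
    by (simp cong: sets_PiM_cong)
  fix A assume "\<And>i. i \<in> I \<Longrightarrow> A i \<in> sets (density lborel (g i))"
  then have A [measurable]: "\<And>i. i \<in> I \<Longrightarrow> A i \<in> sets borel" by simp
  have "emeasure (density (\<Pi>\<^sub>M i\<in>I. lborel) (\<lambda>x. \<Prod>i\<in>I. g i (x i))) (Pi\<^sub>E I A)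
     = (\<integral>\<^sup>+x. (\<Prod>i\<in>I. g i (x i)) * indicator (Pi\<^sub>E I A) x \<partial>(\<Pi>\<^sub>M i\<in>I. lborel))"
    by (intro emeasure_density sets_PiM_I_finite I) (use A in auto)
  also have "\<dots> = (\<integral>\<^sup>+x. (\<Prod>i\<in>I. g i (x i) * indicator (A i) (x i)) \<partial>(\<Pi>\<^sub>M i\<in>I. lborel))"
    by (intro nn_integral_cong) (auto simp: space_PiM PiE_def prod.distrib indicator_def Pi_def
       prod_zero_iff[OF I] I split: if_splits)
  also have "\<dots> = (\<Prod>i\<in>I. \<integral>\<^sup>+x. g i x * indicator (A i) x \<partial>lborel)"
    using A by (intro lborel_prod.product_nn_integral_prod I) simp
  also have "\<dots> = (\<Prod>i\<in>I. emeasure (density lborel (g i)) (A i))"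
    by (intro prod.cong refl emeasure_density[symmetric]) (simp_all add: A)
  finally show "emeasure (density (\<Pi>\<^sub>M i\<in>I. lborel) (\<lambda>x. \<Prod>i\<in>I. g i (x i))) (Pi\<^sub>E I A)
     = (\<Prod>i\<in>I. emeasure (density lborel (g i)) (A i))" .
qed

lemma borel_measurable_mvnormal_density [measurable (raw)]:
  assumes [measurable]: "f \<in> borel_measurable M" "g \<in> borel_measurable M" "h \<in> borel_measurable M"
  shows "(\<lambda>w. mvnormal_density (f w) (g w) (h w)) \<in> borel_measurable M"
  unfolding mvnormal_density_def by measurable

lemma sets_mvnormal [simp, measurable_cong]: "sets (mvnormal \<mu> \<Sigma>) = sets borel"
  and space_mvnormal [simp]: "space (mvnormal \<mu> \<Sigma>) = UNIV"
  by (simp_all add: mvnormal_def)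

lemma std_mvnormal_eq_distr_PiM:
  "(std_mvnormal :: (real^'n) measure) =
     distr (\<Pi>\<^sub>M i\<in>UNIV. density lborel (\<lambda>x. ennreal (std_normal_density x))) borel (\<lambda>f. \<chi> i. f i)"
proof -
  have "prob_space (density lborel (\<lambda>x. ennreal (std_normal_density x)))"
    by (rule prob_space_normal_density) simp
  then have "sigma_finite_measure (density lborel (\<lambda>x. ennreal (std_normal_density x)))"
    by (simp add: prob_space_imp_sigma_finite)
  then have "distr (\<Pi>\<^sub>M i\<in>UNIV. density lborel (\<lambda>x. ennreal (std_normal_density x))) borel (\<lambda>f. \<chi> i. f i)
    = distr (density (\<Pi>\<^sub>M i\<in>(UNIV::'n set). lborel) (\<lambda>x. ennreal (mvnormal_density 0 (mat 1) (\<chi> i. x i)))) borel (\<lambda>f. \<chi> i. f i)"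
    by (subst PiM_density_lborel) (auto simp: std_mvnormal_density_eq_prod prod_ennreal)
  also have "\<dots> = mvnormal 0 (mat 1)"
    unfolding mvnormal_def by (subst density_distr[symmetric]) (simp_all add: distr_PiM_lborel)
  finally show ?thesis ..
qed

lemma prob_space_std_mvnormal: "prob_space (std_mvnormal :: (real^'n) measure)"
  unfolding std_mvnormal_eq_distr_PiM
  by (intro prob_space.prob_space_distr prob_space_PiM prob_space_normal_density) simp_all

lemma nn_integral_std_mvnormal:
  "F \<in> borel_measurable borel \<Longrightarrow> (\<integral>\<^sup>+z. F z \<partial>(std_mvnormal :: (real^'n) measure)) =
    (\<integral>\<^sup>+z. ennreal (mvnormal_density 0 (mat 1) z) * F z \<partial>lborel)"
  unfolding mvnormal_def by (subst nn_integral_density) auto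

lemma distr_std_mvnormal_orthogonal:
  fixes f :: "real^'n \<Rightarrow> real^'n"
  assumes f: "orthogonal_transformation f"
  shows "distr std_mvnormal borel f = std_mvnormal"
proof (rule measure_eqI)
  define U where "U = matrix f"
  have Uv: "f v = U *v v" for v
    using f unfolding U_def orthogonal_transformation_def by (simp add: matrix_works)
  have d: "\<bar>det U\<bar> = 1"
    using f det_orthogonal_matrix[of U] unfolding U_def orthogonal_transformation_matrix by auto
  then have d0: "det U \<noteq> 0" by auto
  have [measurable]: "f \<in> borel_measurable borel" unfolding Uv by measurable
  fix A assume "A \<in> sets (distr std_mvnormal borel f)"
  then have A [measurable]: "A \<in> sets borel" by simp
  have fA [measurable]: "f -` A \<in> sets borel" by (rule measurable_sets_borel) measurable
  have "emeasure (std_mvnormal :: (real^'n) measure) A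
    = (\<integral>\<^sup>+z. ennreal (mvnormal_density 0 (mat 1) z) * indicator A z \<partial>lborel)"
    by (simp add: mvnormal_def emeasure_density)
  also have "\<dots> = (\<integral>\<^sup>+z. ennreal (mvnormal_density 0 (mat 1) (f z)) * indicator A (f z) \<partial>lborel)"
    by (subst nn_integral_lborel_matrix[OF d0]) (simp_all add: d Uv)
  also have "\<dots> = (\<integral>\<^sup>+z. ennreal (mvnormal_density 0 (mat 1) z) * indicator (f -` A) z \<partial>lborel)"
    using f by (simp add: mvnormal_density_def orthogonal_transformation_def indicator_def)
  also have "\<dots> = emeasure std_mvnormal (f -` A)"
    by (simp add: mvnormal_def emeasure_density)
  finally show "emeasure (distr std_mvnormal borel f) A = emeasure std_mvnormal A"
    by (simp add: emeasure_distr)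
qed simp

text \<open>
  The other coordinates integrate to one. With this, normal vectors of different dimensions can be
  compared in a common larger space.
\<close>

lemma distr_std_mvnormal_coordinates:
  fixes g :: "'a::finite \<Rightarrow> 'n::finite"
  assumes g: "inj g"
  shows "distr (std_mvnormal :: (real^'n) measure) borel (\<lambda>z. \<chi> a. z $ g a) = std_mvnormal"
proof -
  let ?N = "density lborel (\<lambda>x. ennreal (std_normal_density x))"
  have m: "(\<lambda>f. \<lambda>a\<in>UNIV. f (g a)) \<in> (\<Pi>\<^sub>M i\<in>UNIV. ?N) \<rightarrow>\<^sub>M (\<Pi>\<^sub>M a\<in>UNIV. ?N)"
    by (intro measurable_restrict measurable_component_singleton) simp
  have "distr (std_mvnormal :: (real^'n) measure) borel (\<lambda>z. \<chi> a. z $ g a)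
    = distr (\<Pi>\<^sub>M i\<in>UNIV. ?N) borel (\<lambda>f. \<chi> a. f (g a))"
    unfolding std_mvnormal_eq_distr_PiM by (subst distr_distr) (simp_all add: o_def)
  also have "\<dots> = distr (distr (\<Pi>\<^sub>M i\<in>UNIV. ?N) (\<Pi>\<^sub>M a\<in>UNIV. ?N) (\<lambda>f. \<lambda>a\<in>UNIV. f (g a))) borel (\<lambda>f. \<chi> a. f a)"
    by (subst distr_distr[OF _ m]) (simp_all add: o_def restrict_def)
  also have "distr (\<Pi>\<^sub>M i\<in>UNIV. ?N) (\<Pi>\<^sub>M a\<in>UNIV. ?N) (\<lambda>f. \<lambda>a\<in>UNIV. f (g a)) = (\<Pi>\<^sub>M a\<in>UNIV. ?N)"
    using g by (intro distr_PiM_reindex prob_space_normal_density) auto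
  finally show ?thesis unfolding std_mvnormal_eq_distr_PiM .
qed

text \<open>
  The law of \<open>Q z\<close> for a standard normal \<open>z\<close> depends on \<open>Q Q\<^sup>T\<close> only. After padding with zero columns,
  \<open>Q\<close> and \<open>B\<close> act on the same space, in dimension \<open>CARD('a) + CARD('b)\<close>. Their rows then have the same
  Gram matrix, so an orthogonal transformation carries one family of rows into the other, and the
  standard normal distribution is invariant under it.
\<close>

lemma distr_std_mvnormal_matrix_cong:
  fixes Q :: "real^'a^'p" and B :: "real^'b^'p"
  assumes eq: "Q ** transpose Q = B ** transpose B"
  shows "distr std_mvnormal borel ((*v) Q) = distr std_mvnormal borel ((*v) B)"
proof -
  define x :: "'p \<Rightarrow> real^('a + 'b)" where
    "x p = (\<chi> s. case s of Inl a \<Rightarrow> Q $ p $ a | Inr b \<Rightarrow> 0)" for p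
  define y :: "'p \<Rightarrow> real^('a + 'b)" where
    "y p = (\<chi> s. case s of Inl a \<Rightarrow> 0 | Inr b \<Rightarrow> B $ p $ b)" for p
  have sum: "(\<Sum>s\<in>UNIV. h s) = (\<Sum>a\<in>UNIV. h (Inl a)) + (\<Sum>b\<in>UNIV. h (Inr b))" for h :: "'a + 'b \<Rightarrow> real"
    by (simp add: UNIV_Plus_UNIV[symmetric] sum.Plus o_def del: UNIV_Plus_UNIV)
  have "x p \<bullet> x q = (Q ** transpose Q) $ p $ q" for p q
    by (simp add: inner_vec_def x_def sum matrix_matrix_mult_def transpose_def)
  moreover have "y p \<bullet> y q = (B ** transpose B) $ p $ q" for p q
    by (simp add: inner_vec_def y_def sum matrix_matrix_mult_def transpose_def)
  ultimately obtain f where f: "orthogonal_transformation f" "\<And>p. f (x p) = y p"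
    using orthogonal_transformation_of_equal_inner[of UNIV x y] by (auto simp: eq)
  have [measurable]: "f \<in> borel_measurable borel"
    using f(1) unfolding orthogonal_transformation_def
    by (intro borel_measurable_continuous_onI linear_continuous_on linear_conv_bounded_linear[THEN iffD1]) auto
  have Q: "Q *v (\<chi> a. z $ Inl a) = (\<chi> p. x p \<bullet> z)" for z
    by (simp add: vec_eq_iff inner_vec_def x_def sum matrix_vector_mult_def)
  have B: "B *v (\<chi> a. z $ Inr a) = (\<chi> p. y p \<bullet> z)" for z
    by (simp add: vec_eq_iff inner_vec_def y_def sum matrix_vector_mult_def)
  have "distr std_mvnormal borel ((*v) Q) = distr std_mvnormal borel (\<lambda>z. \<chi> p. x p \<bullet> z)"
    by (subst distr_std_mvnormal_coordinates[of "Inl :: 'a \<Rightarrow> 'a + 'b", symmetric])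
       (simp_all add: distr_distr o_def Q)
  also have "(\<lambda>z. \<chi> p. x p \<bullet> z) = (\<lambda>z. \<chi> p. y p \<bullet> z) \<circ> f"
    using f by (simp add: fun_eq_iff vec_eq_iff orthogonal_transformation_def flip: f(2))
  also have "distr std_mvnormal borel ((\<lambda>z. \<chi> p. y p \<bullet> z) \<circ> f)
    = distr (distr std_mvnormal borel f) borel (\<lambda>z. \<chi> p. y p \<bullet> z)"
    by (subst distr_distr) simp_all
  also have "\<dots> = distr std_mvnormal borel (\<lambda>z. \<chi> p. y p \<bullet> z)"
    by (simp only: distr_std_mvnormal_orthogonal[OF f(1)])
  also have "\<dots> = distr std_mvnormal borel ((*v) B)"
    by (subst distr_std_mvnormal_coordinates[of "Inr :: 'b \<Rightarrow> 'a + 'b", symmetric])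
       (simp_all add: distr_distr o_def B)
  finally show ?thesis .
qed


section \<open>Lebesgue measure on symmetric matrices\<close>

definition index_pairs :: "'k set \<Rightarrow> 'k set set" where
  "index_pairs I = {{i, j} | i j. i \<in> I \<and> j \<in> I}"

text \<open>
  It stands for a symmetric \<open>I \<times> I\<close> matrix while its type does not depend on \<open>I\<close>. Completing it by the
  identity leaves the determinant as it is and preserves positive definiteness.
\<close>

definition sym_of :: "'k set \<Rightarrow> ('k set \<Rightarrow> real) \<Rightarrow> real^'k^'k" where
  "sym_of I f = (\<chi> i j. if i \<in> I \<and> j \<in> I then f {i, j} else if i = j then 1 else 0)"

abbreviation sym_PiM :: "'k set \<Rightarrow> ('k set \<Rightarrow> real) measure" where
  "sym_PiM I \<equiv> (\<Pi>\<^sub>M s\<in>index_pairs I. lborel)"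

lemma index_pairsI: "i \<in> I \<Longrightarrow> j \<in> I \<Longrightarrow> {i, j} \<in> index_pairs I"
  by (auto simp: index_pairs_def)

lemma index_pairs_singletonI: "i \<in> I \<Longrightarrow> {i} \<in> index_pairs I"
  using index_pairsI[of i I i] by simp

lemma congruence_component:
  fixes A :: "real^'k^'m"
  shows "(A ** M ** transpose A) $ i $ j = A $ i \<bullet> (M *v A $ j)"
proof -
  have a: "transpose A *v axis i 1 = A $ i" for i
    by (simp add: vec_eq_iff matrix_mult_axis_component) (simp add: transpose_def)
  have "(A ** M ** transpose A) $ i $ j = axis i 1 \<bullet> (A *v (M *v (transpose A *v axis j 1)))"
    by (simp add: axis_inner_matrix_axis[symmetric] matrix_vector_mul_assoc matrix_mul_assoc)
  then show ?thesis by (simp only: inner_matrix_vector_mul a)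
qed

lemma index_pairs_insert:
  "index_pairs (insert i I) = index_pairs I \<union> (\<lambda>j. {i, j}) ` insert i I"
  by (auto simp: index_pairs_def insert_commute)

lemma index_pairs_mem: "s \<in> index_pairs I \<Longrightarrow> j \<in> s \<Longrightarrow> j \<in> I"
  by (auto simp: index_pairs_def)

lemma measurable_sym_of:
  fixes I :: "'k::finite set"
  assumes "index_pairs I \<subseteq> J"
  shows "sym_of I \<in> borel_measurable (\<Pi>\<^sub>M s\<in>J. lborel)"
  unfolding sym_of_def[abs_def]
proof (intro borel_measurable_vec_lambda)
  fix i j
  show "(\<lambda>f. if i \<in> I \<and> j \<in> I then f {i, j} else if i = j then 1 else 0)
    \<in> borel_measurable (\<Pi>\<^sub>M s\<in>J. lborel :: real measure)"
    using assms index_pairsI[of i I j]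
    by (cases "i \<in> I \<and> j \<in> I") (auto intro: measurable_PiM_lborel_component)
qed

lemma measurable_sym_of_sym_PiM [measurable]: "sym_of (I :: 'k::finite set) \<in> borel_measurable (sym_PiM I)"
  by (rule measurable_sym_of) simp

lemma sym_lborel_eq: "(sym_lborel :: (real^'k^'k) measure) = distr (sym_PiM UNIV) borel (sym_of UNIV)"
  by (simp add: sym_lborel_def index_pairs_def sym_of_def[abs_def])

lemma nn_integral_sym_lborel:
  fixes F :: "real^'k^'k \<Rightarrow> ennreal"
  assumes [measurable]: "F \<in> borel_measurable borel"
  shows "(\<integral>\<^sup>+\<Sigma>. F \<Sigma> \<partial>sym_lborel) = (\<integral>\<^sup>+f. F (sym_of UNIV f) \<partial>sym_PiM UNIV)"
  unfolding sym_lborel_eq by (rule nn_integral_distr) measurable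

lemma sets_sym_lborel [simp, measurable_cong]: "sets sym_lborel = sets borel"
  and space_sym_lborel [simp]: "space sym_lborel = UNIV"
  by (simp_all add: sym_lborel_def)

text \<open>
  The Jacobian of a diagonal congruence: each index \<open>i\<close> occurs once in each of the \<open>card I - 1\<close> proper
  pairs that contain it, and twice in the diagonal pair \<open>{i}\<close>. The square at \<open>{i}\<close> has to be spelled
  out because a set does not record that \<open>i\<close> occurs twice.
\<close>

lemma prod_index_pairs:
  fixes c :: "'k::finite \<Rightarrow> real" and I :: "'k set"
  defines "d s \<equiv> (if \<exists>i. s = {i} then (c (the_elem s))\<^sup>2 else \<Prod>i\<in>s. c i)"
  shows "(\<Prod>s\<in>index_pairs I. d s) = (\<Prod>i\<in>I. c i) ^ (card I + 1)"
proof (induction I rule: finite_induct[OF finite])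
  case 1
  then show ?case by (simp add: index_pairs_def)
next
  case (2 i I)
  have d: "d {i, j} = c i * c j" for j
    by (cases "i = j") (auto simp: d_def power2_eq_square doubleton_eq_iff)
  have disj: "index_pairs I \<inter> (\<lambda>j. {i, j}) ` insert i I = {}"
    using 2(2) by (auto dest: index_pairs_mem)
  have "(\<Prod>s\<in>index_pairs (insert i I). d s)
     = (\<Prod>s\<in>index_pairs I. d s) * (\<Prod>s\<in>(\<lambda>j. {i, j}) ` insert i I. d s)"
    unfolding index_pairs_insert using disj by (intro prod.union_disjoint) auto
  also have "(\<Prod>s\<in>(\<lambda>j. {i, j}) ` insert i I. d s) = (\<Prod>j\<in>insert i I. c i * c j)"
    by (subst prod.reindex) (auto simp: inj_on_def doubleton_eq_iff d)
  also have "\<dots> = c i * c i * (c i ^ card I * (\<Prod>j\<in>I. c j))"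
    using 2 by (simp add: prod.distrib)
  finally show ?case using 2 by (simp add: power_mult_distrib mult_ac)
qed

text \<open>
  The Jacobian of \<open>\<Sigma> \<mapsto> A \<Sigma> A\<^sup>T\<close> on the symmetric matrices. Permutations of rows permute the coordinates,
  and adding one row to another shears them.
\<close>

lemma nn_integral_sym_lborel_congruence:
  fixes A :: "real^'k^'k" and F :: "real^'k^'k \<Rightarrow> ennreal"
  assumes A: "det A \<noteq> 0" and F: "F \<in> borel_measurable borel"
  shows "(\<integral>\<^sup>+\<Sigma>. F \<Sigma> \<partial>sym_lborel)
    = ennreal (\<bar>det A\<bar> ^ (CARD('k) + 1)) * (\<integral>\<^sup>+\<Sigma>. F (A ** \<Sigma> ** transpose A) \<partial>sym_lborel)"
proof -
  let ?P = "sym_PiM (UNIV :: 'k set)" and ?s = "sym_of (UNIV :: 'k set)"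
  have mem: "{i, j} \<in> index_pairs (UNIV :: 'k set)" for i j by (rule index_pairsI) auto
  have mem1: "{i} \<in> index_pairs (UNIV :: 'k set)" for i using mem[of i i] by simp
  show ?thesis
  proof (rule nn_integral_matrix_action[where act = "\<lambda>A \<Sigma>. A ** \<Sigma> ** transpose A" and d = "CARD('k) + 1"])
    fix A :: "real^'k^'k" and F :: "real^'k^'k \<Rightarrow> ennreal"
    assume rows: "\<And>i. A $ i = A $ i $ i *\<^sub>R axis i 1" and det: "det A = (\<Prod>i\<in>UNIV. A $ i $ i)" "det A \<noteq> 0"
      and "F \<in> borel_measurable sym_lborel"
    then have [measurable]: "F \<in> borel_measurable borel" by (simp cong: measurable_cong_sets)
    define c where "c i = A $ i $ i" for i
    have c: "c i \<noteq> 0" for i using det by (auto simp: c_def)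
    define d where "d s = (if \<exists>i. s = {i} then (c (the_elem s))\<^sup>2 else \<Prod>i\<in>s. c i)" for s
    have d: "d {i, j} = c i * c j" for i j
      by (cases "i = j") (auto simp: d_def power2_eq_square doubleton_eq_iff)
    have d0: "d s \<noteq> 0" for s using c by (auto simp: d_def)
    have Ai: "A $ i = c i *\<^sub>R axis i 1" for i using rows[of i] by (simp add: c_def)
    have act: "A ** ?s f ** transpose A = ?s (\<lambda>s\<in>index_pairs UNIV. d s * f s)" for f
      by (simp add: vec_eq_iff congruence_component Ai matrix_vector_mult_scaleR axis_inner_matrix_axis)
         (simp add: sym_of_def d mem mult_ac)
    have "(\<integral>\<^sup>+f. F (?s f) \<partial>?P) = ennreal \<bar>\<Prod>s\<in>index_pairs UNIV. d s\<bar> * (\<integral>\<^sup>+f. F (?s (\<lambda>s\<in>index_pairs UNIV. d s * f s)) \<partial>?P)"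
      by (rule nn_integral_PiM_scale) (use d0 in auto)
    also have "(\<Prod>s\<in>index_pairs UNIV. d s) = det A ^ (CARD('k) + 1)"
      unfolding d_def prod_index_pairs by (simp add: det(1) c_def)
    finally show "(\<integral>\<^sup>+\<Sigma>. F \<Sigma> \<partial>sym_lborel)
      = ennreal (\<bar>det A\<bar> ^ (CARD('k) + 1)) * (\<integral>\<^sup>+\<Sigma>. F (A ** \<Sigma> ** transpose A) \<partial>sym_lborel)"
      by (simp add: nn_integral_sym_lborel act power_abs abs_mult restrict_def)
  next
    fix A :: "real^'k^'k" and F :: "real^'k^'k \<Rightarrow> ennreal" and m n :: 'k
    let ?t = "Transposition.transpose m n"
    assume rows: "\<And>i. A $ i = axis (?t i) 1" and "F \<in> borel_measurable sym_lborel"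
    then have [measurable]: "F \<in> borel_measurable borel" by (simp cong: measurable_cong_sets)
    have act: "A ** ?s f ** transpose A = ?s (\<lambda>s\<in>index_pairs UNIV. f (?t ` s))" for f
      by (simp add: vec_eq_iff congruence_component rows axis_inner_matrix_axis) (simp add: sym_of_def mem)
    have bij: "bij_betw (\<lambda>s. ?t ` s) (index_pairs UNIV) (index_pairs UNIV)"
      by (rule bij_betwI[where g = "\<lambda>s. ?t ` s"]) (auto simp: index_pairs_def image_image)
    have "(\<integral>\<^sup>+f. F (?s (\<lambda>s\<in>index_pairs UNIV. f (?t ` s))) \<partial>?P) = (\<integral>\<^sup>+f. F (?s f) \<partial>?P)"
      by (rule nn_integral_PiM_reindex[OF _ bij]) simp_all
    then show "(\<integral>\<^sup>+\<Sigma>. F \<Sigma> \<partial>sym_lborel) = (\<integral>\<^sup>+\<Sigma>. F (A ** \<Sigma> ** transpose A) \<partial>sym_lborel)"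
      by (simp add: nn_integral_sym_lborel act)
  next
    fix A :: "real^'k^'k" and F :: "real^'k^'k \<Rightarrow> ennreal" and m n :: 'k
    assume mn: "m \<noteq> n" and rows: "\<And>i. A $ i = axis i 1 + (if i = m then axis n 1 else 0)"
      and "F \<in> borel_measurable sym_lborel"
    then have [measurable]: "F \<in> borel_measurable borel" by (simp cong: measurable_cong_sets)
    define K where "K = (\<lambda>j. {m, j}) ` (UNIV - {m})"
    define h where "h s = insert n (s - {m})" for s
    \<comment> \<open>The shear \<open>sh\<close> acts first and has already changed the entry at \<open>{m, n}\<close>; hence the minus sign.\<close>
    define up where "up f = f({m} := (2 * f {m, n} - f {n}) + 1 * f {m})" for f :: "'k set \<Rightarrow> real"
    define sh where "sh f = (\<lambda>s\<in>index_pairs UNIV. if s \<in> K then f s + f (h s) else f s)" for f :: "'k set \<Rightarrow> real"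
    have h: "h ` K \<subseteq> index_pairs UNIV - K"
    proof
      fix x assume "x \<in> h ` K"
      then obtain j where j: "j \<noteq> m" "x = h {m, j}" by (auto simp: K_def)
      have "x = {n, j}" using j by (auto simp: h_def)
      moreover have "{n, j} \<notin> K" using j mn by (auto simp: K_def doubleton_eq_iff)
      ultimately show "x \<in> index_pairs UNIV - K" using mem by simp
    qed
    have sh: "sh f {i, j} = (if i = m \<and> j = m then f {m} else if i = m then f {m, j} + f {n, j}
      else if j = m then f {m, i} + f {n, i} else f {i, j})" for f i j
    proof -
      have "{i, j} \<in> K \<longleftrightarrow> (i = m \<and> j \<noteq> m \<or> i \<noteq> m \<and> j = m)"
      proof -
        have "{i, j} \<in> K \<longleftrightarrow> (\<exists>l. l \<noteq> m \<and> {i, j} = {m, l})" unfolding K_def by blast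
        then show ?thesis unfolding doubleton_eq_iff by metis
      qed
      moreover have "h {m, j} = {n, j}" if "j \<noteq> m" for j using that by (auto simp: h_def)
      moreover have "{i, m} = {m, i}" by auto
      ultimately show ?thesis
        by (cases "i = m"; cases "j = m") (simp_all add: sh_def mem mem1)
    qed
    have act: "A ** ?s f ** transpose A = ?s (up (sh f))" for f
    proof -
      have "(A ** ?s f ** transpose A) $ i $ j = f {i, j} + (if i = m then f {n, j} else 0)
        + (if j = m then f {i, n} else 0) + (if i = m \<and> j = m then f {n} else 0)" for i j
        by (simp add: congruence_component rows matrix_vector_right_distrib inner_add_left inner_add_right
            axis_inner_matrix_axis) (simp add: sym_of_def insert_commute)
      moreover have "up (sh f) {i, j} = f {i, j} + (if i = m then f {n, j} else 0)
        + (if j = m then f {i, n} else 0) + (if i = m \<and> j = m then f {n} else 0)" for i j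
      proof -
        have c: "{n, m} = {m, n}" "{i, n} = {n, i}" "{i, m} = {m, i}" by auto
        have "sh f {n} = f {n}" "sh f {m} = f {m}" "sh f {m, n} = f {m, n} + f {n}"
          using mn sh[of f n n] sh[of f m n] sh[of f m m] by simp_all
        then show ?thesis using c
          by (cases "i = m"; cases "j = m") (simp_all add: up_def sh singleton_insert_inj_eq')
      qed
      ultimately show ?thesis by (simp add: vec_eq_iff sym_of_def)
    qed
    have [measurable]: "(\<lambda>f. f {m, n}) \<in> borel_measurable ?P" "(\<lambda>f. f {n}) \<in> borel_measurable ?P"
      "(\<lambda>f. f {m}) \<in> borel_measurable ?P"
      by (auto intro!: measurable_PiM_lborel_component mem mem1)
    have mup: "(\<lambda>f. ?s (up f)) \<in> borel_measurable ?P"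
      unfolding sym_of_def
    proof (rule borel_measurable_vec_lambda, rule borel_measurable_vec_lambda)
      fix i j
      have [measurable]: "(\<lambda>f. f {i, j}) \<in> borel_measurable ?P"
        by (auto intro!: measurable_PiM_lborel_component mem)
      have "(\<lambda>f. up f {i, j}) \<in> borel_measurable ?P"
      proof (cases "{i, j} = {m}")
        case True
        then have "up f {i, j} = (2 * f {m, n} - f {n}) + 1 * f {m}" for f by (simp add: up_def)
        then show ?thesis by simp
      next
        case False
        then have "up f {i, j} = f {i, j}" for f unfolding up_def by (rule fun_upd_other)
        then show ?thesis by simp
      qed
      then show "(\<lambda>f. if i \<in> UNIV \<and> j \<in> UNIV then up f {i, j} else if i = j then 1 else 0) \<in> borel_measurable ?P"
        by simp
    qed
    have "(\<integral>\<^sup>+f. F (?s f) \<partial>?P) = ennreal \<bar>1\<bar> * (\<integral>\<^sup>+f. F (?s (f({m} := (2 * f {m, n} - f {n}) + 1 * f {m}))) \<partial>?P)"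
      by (rule nn_integral_PiM_affine_coordinate) (use mn mem1 in \<open>auto simp: doubleton_eq_iff\<close>)
    also have "\<dots> = (\<integral>\<^sup>+f. F (?s (up f)) \<partial>?P)" by (simp add: up_def)
    also have "\<dots> = (\<integral>\<^sup>+f. F (?s (up (sh f))) \<partial>?P)"
      unfolding sh_def
      by (rule nn_integral_PiM_shear[symmetric]) (use h mem mup in \<open>auto simp: K_def\<close>)
    finally show "(\<integral>\<^sup>+\<Sigma>. F \<Sigma> \<partial>sym_lborel) = (\<integral>\<^sup>+\<Sigma>. F (A ** \<Sigma> ** transpose A) \<partial>sym_lborel)"
      by (simp add: nn_integral_sym_lborel act)
  next
    show "A ** B ** \<Sigma> ** transpose (A ** B) = A ** (B ** \<Sigma> ** transpose B) ** transpose A" for A B \<Sigma> :: "real^'k^'k"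
      by (simp add: matrix_transpose_mul matrix_mul_assoc)
  qed (use A F in \<open>simp_all cong: measurable_cong_sets\<close>)
qed

definition vec_mask :: "'k set \<Rightarrow> real^'k \<Rightarrow> real^'k" where
  "vec_mask I z = (\<chi> j. if j \<in> I then z $ j else 0)"

text \<open>
  The matrix \<open>D\<close> bordered by the row and column \<open>i\<close>, with diagonal entry \<open>a\<close> and off-diagonal part \<open>b\<close>.
  It is meant for a \<open>D\<close> whose row and column \<open>i\<close> are those of the identity, and for \<open>b $ i = 0\<close>; the
  subtracted one removes the diagonal entry that \<open>D\<close> already has at \<open>i\<close>.
\<close>

definition border :: "'k \<Rightarrow> real \<Rightarrow> real^'k \<Rightarrow> real^'k^'k \<Rightarrow> real^'k^'k" where
  "border i a b D = D + outer (axis i 1) b + outer b (axis i 1) + (a - 1) *\<^sub>R outer (axis i 1) (axis i 1)"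

lemma measurable_vec_mask [measurable]: "vec_mask I \<in> borel_measurable borel"
  unfolding vec_mask_def[abs_def] by measurable

lemma measurable_border [measurable (raw)]:
  assumes [measurable]: "a \<in> borel_measurable M" "b \<in> borel_measurable M" "D \<in> borel_measurable M"
  shows "(\<lambda>x. border i (a x) (b x) (D x)) \<in> borel_measurable M"
  unfolding border_def by measurable

text \<open>
  An integral over \<open>I\<close>-indexed vectors, written over the full space: the other coordinates are integrated
  against a probability density. Taking the normal density for it lets them merge later with the
  Gaussian factor of the kernel.
\<close>

lemma nn_integral_PiM_vec_mask:
  fixes I :: "'k::finite set" and H :: "real^'k \<Rightarrow> ennreal"
  assumes [measurable]: "H \<in> borel_measurable borel"
  shows "(\<integral>\<^sup>+f. H (\<chi> j. if j \<in> I then f j else 0) \<partial>(\<Pi>\<^sub>M i\<in>I. lborel))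
    = (\<integral>\<^sup>+z. ennreal (\<Prod>j\<in>-I. std_normal_density (z $ j)) * H (vec_mask I z) \<partial>lborel)"
proof -
  let ?P = "\<lambda>I. \<Pi>\<^sub>M i\<in>I. lborel :: real measure"
  have one: "(\<integral>\<^sup>+y. ennreal (\<Prod>j\<in>-I. std_normal_density (y j)) \<partial>?P (-I)) = 1"
  proof -
    have "(\<integral>\<^sup>+y. ennreal (std_normal_density y) \<partial>lborel) = 1"
      using prob_space.emeasure_space_1[OF prob_space_normal_density, of 1 0]
      by (simp add: emeasure_density)
    then show ?thesis
      by (simp add: prod_ennreal[symmetric]) (subst lborel_prod.product_nn_integral_prod, simp_all)
  qed
  have m: "(\<lambda>f. H (\<chi> j. if j \<in> I then f j else 0)) \<in> borel_measurable (?P I)"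
  proof (rule measurable_compose[where g = H and N = borel])
    show "(\<lambda>f. \<chi> j. if j \<in> I then f j else 0) \<in> borel_measurable (?P I)"
    proof (rule borel_measurable_vec_lambda)
      show "(\<lambda>f. if j \<in> I then f j else 0) \<in> borel_measurable (?P I)" for j
        by (cases "j \<in> I") (auto intro: measurable_PiM_lborel_component)
    qed
  qed simp
  have "(\<integral>\<^sup>+z. ennreal (\<Prod>j\<in>-I. std_normal_density (z $ j)) * H (vec_mask I z) \<partial>lborel)
    = (\<integral>\<^sup>+f. ennreal (\<Prod>j\<in>-I. std_normal_density (f j)) * H (\<chi> j. if j \<in> I then f j else 0) \<partial>?P (I \<union> -I))"
    by (subst distr_PiM_lborel[symmetric], subst nn_integral_distr) (simp_all add: vec_mask_def cong: if_cong)
  also have "\<dots> = (\<integral>\<^sup>+x. \<integral>\<^sup>+y. ennreal (\<Prod>j\<in>-I. std_normal_density (merge I (-I) (x, y) j)) * H (\<chi> j. if j \<in> I then merge I (-I) (x, y) j else 0) \<partial>?P (-I) \<partial>?P I)"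
    by (rule lborel_prod.product_nn_integral_fold) (simp_all add: Un_commute)
  also have "\<dots> = (\<integral>\<^sup>+x. \<integral>\<^sup>+y. ennreal (\<Prod>j\<in>-I. std_normal_density (y j)) * H (\<chi> j. if j \<in> I then x j else 0) \<partial>?P (-I) \<partial>?P I)"
    by (intro nn_integral_cong arg_cong2[where f = "(*)"] arg_cong[where f = ennreal] arg_cong[where f = H] prod.cong)
       (auto simp: vec_eq_iff)
  also have "\<dots> = (\<integral>\<^sup>+x. H (\<chi> j. if j \<in> I then x j else 0) \<partial>?P I)"
    by (subst nn_integral_multc) (simp_all add: one)
  finally show ?thesis ..
qed

text \<open>
  Fubini for the entries of a symmetric matrix on \<open>insert i I\<close>: the diagonal entry \<open>a\<close> at \<open>i\<close>, the entries
  that couple \<open>i\<close> to \<open>I\<close>, and the block on \<open>I\<close>.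
\<close>

lemma nn_integral_sym_border:
  fixes I :: "'k::finite set" and F :: "real^'k^'k \<Rightarrow> ennreal"
  assumes i: "i \<notin> I" and F [measurable]: "F \<in> borel_measurable borel"
  shows "(\<integral>\<^sup>+f. F (sym_of (insert i I) f) \<partial>sym_PiM (insert i I))
    = (\<integral>\<^sup>+g. \<integral>\<^sup>+z. ennreal (\<Prod>j\<in>-I. std_normal_density (z $ j)) *
        (\<integral>\<^sup>+a. F (border i a (vec_mask I z) (sym_of I g)) \<partial>lborel) \<partial>lborel \<partial>sym_PiM I)"
proof -
  let ?P = "\<lambda>I. \<Pi>\<^sub>M i\<in>I. lborel :: real measure"
  define J where "J = (\<lambda>j. {i, j}) ` I"
  define K where "K = index_pairs I"
  define v where "v f = (\<chi> j. if j \<in> I then f {i, j} else 0)" for f :: "'k set \<Rightarrow> real"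
  have J: "finite J" "K \<inter> J = {}" "{i} \<notin> K \<union> J" "index_pairs (insert i I) = insert {i} (K \<union> J)" "finite K"
    using i by (auto simp: J_def K_def index_pairs_insert doubleton_eq_iff dest: index_pairs_mem)
  have b: "sym_of (insert i I) (f({i} := a)) = border i a (v f) (sym_of I f)" for f a
    using i by (auto simp: vec_eq_iff sym_of_def border_def v_def outer_def axis_def insert_commute doubleton_eq_iff)
  have [measurable]: "v \<in> borel_measurable (?P L)" if "J \<subseteq> L" for L
    unfolding v_def[abs_def]
  proof (rule borel_measurable_vec_lambda)
    show "(\<lambda>f. if j \<in> I then f {i, j} else 0) \<in> borel_measurable (?P L)" for j
      using that by (cases "j \<in> I") (auto simp: J_def intro: measurable_PiM_lborel_component)
  qed
  have m1 [measurable]: "v \<in> borel_measurable (?P (K \<union> J))" "sym_of I \<in> borel_measurable (?P (K \<union> J))"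
     "v \<in> borel_measurable (?P J)" "sym_of I \<in> borel_measurable (?P K)"
    by (auto intro: measurable_sym_of simp: K_def)
  have "(\<integral>\<^sup>+f. F (sym_of (insert i I) f) \<partial>sym_PiM (insert i I))
    = (\<integral>\<^sup>+f. \<integral>\<^sup>+a. F (sym_of (insert i I) (f({i} := a))) \<partial>lborel \<partial>?P (K \<union> J))"
    unfolding J(4) using J by (intro lborel_prod.product_nn_integral_insert) (auto simp flip: J(4))
  also have "\<dots> = (\<integral>\<^sup>+f. \<integral>\<^sup>+a. F (border i a (v f) (sym_of I f)) \<partial>lborel \<partial>?P (K \<union> J))"
    by (simp only: b)
  also have "\<dots> = (\<integral>\<^sup>+g. \<integral>\<^sup>+h. \<integral>\<^sup>+a. F (border i a (v (merge K J (g, h))) (sym_of I (merge K J (g, h)))) \<partial>lborel \<partial>?P J \<partial>?P K)"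
    using J by (intro lborel_prod.product_nn_integral_fold) auto
  also have "\<dots> = (\<integral>\<^sup>+g. \<integral>\<^sup>+h. \<integral>\<^sup>+a. F (border i a (v h) (sym_of I g)) \<partial>lborel \<partial>?P J \<partial>?P K)"
  proof -
    have "sym_of I (merge K J (g, h)) = sym_of I g" for g h
      by (auto simp: vec_eq_iff sym_of_def K_def index_pairsI index_pairs_singletonI merge_def)
    moreover have "v (merge K J (g, h)) = v h" for g h
      using J(2) by (auto simp: vec_eq_iff v_def J_def merge_def)
    ultimately show ?thesis by simp
  qed
  also have "\<dots> = (\<integral>\<^sup>+g. \<integral>\<^sup>+z. ennreal (\<Prod>j\<in>-I. std_normal_density (z $ j)) *
        (\<integral>\<^sup>+a. F (border i a (vec_mask I z) (sym_of I g)) \<partial>lborel) \<partial>lborel \<partial>?P K)"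
  proof (rule nn_integral_cong)
    fix g
    define H where "H b = (\<integral>\<^sup>+a. F (border i a b (sym_of I g)) \<partial>lborel)" for b
    have [measurable]: "H \<in> borel_measurable borel" unfolding H_def by measurable
    have bij: "bij_betw (\<lambda>j. {i, j}) I J" by (auto simp: bij_betw_def J_def inj_on_def doubleton_eq_iff)
    have "(\<integral>\<^sup>+h. H (v h) \<partial>?P J) = (\<integral>\<^sup>+h. H (\<chi> j. if j \<in> I then (\<lambda>j\<in>I. h {i, j}) j else 0) \<partial>?P J)"
      by (simp add: v_def cong: if_cong)
    also have "\<dots> = (\<integral>\<^sup>+f. H (\<chi> j. if j \<in> I then f j else 0) \<partial>?P I)"
    proof (rule nn_integral_PiM_reindex[OF _ bij])
      show "(\<lambda>f. H (\<chi> j. if j \<in> I then f j else 0)) \<in> borel_measurable (?P I)"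
      proof (rule measurable_compose[where g = H and N = borel], rule borel_measurable_vec_lambda)
        show "(\<lambda>f. if j \<in> I then f j else 0) \<in> borel_measurable (?P I)" for j
          by (cases "j \<in> I") (auto intro: measurable_PiM_lborel_component)
      qed simp
    qed simp
    also have "\<dots> = (\<integral>\<^sup>+z. ennreal (\<Prod>j\<in>-I. std_normal_density (z $ j)) * H (vec_mask I z) \<partial>lborel)"
      by (rule nn_integral_PiM_vec_mask) measurable
    finally show "(\<integral>\<^sup>+h. \<integral>\<^sup>+a. F (border i a (v h) (sym_of I g)) \<partial>lborel \<partial>?P J)
      = (\<integral>\<^sup>+z. ennreal (\<Prod>j\<in>-I. std_normal_density (z $ j)) *
        (\<integral>\<^sup>+a. F (border i a (vec_mask I z) (sym_of I g)) \<partial>lborel) \<partial>lborel)"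
      unfolding H_def .
  qed
  finally show ?thesis unfolding K_def .
qed


section \<open>Schur complements\<close>

lemma symmetric_nth: "transpose A = A \<Longrightarrow> A $ p $ q = A $ q $ p"
  by (drule arg_cong[where f = "\<lambda>A. A $ q $ p"]) (simp add: transpose_def)

definition unit_outside :: "'k set \<Rightarrow> real^'k^'k \<Rightarrow> bool" where
  "unit_outside I D \<longleftrightarrow> transpose D = D \<and> (\<forall>p q. p \<notin> I \<longrightarrow> D $ p $ q = (if p = q then 1 else 0))"

lemma unit_outside_sym_of: "unit_outside I (sym_of I g)"
  by (auto simp: unit_outside_def sym_of_def vec_eq_iff transpose_def insert_commute)

lemma unit_outside_nth:
  assumes "unit_outside I D" "p \<notin> I"
  shows "(D *v z) $ p = z $ p"
proof -
  have "(D *v z) $ p = (\<Sum>q\<in>UNIV. (if p = q then 1 else 0) * z $ q)"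
    using assms by (simp add: matrix_vector_mult_def unit_outside_def)
  then show ?thesis by (simp add: if_distrib if_distribR sum.delta cong: if_cong)
qed

lemma unit_outside_axis:
  assumes "unit_outside I D" "p \<notin> I"
  shows "D *v axis p 1 = axis p 1"
proof -
  have "D $ q $ p = D $ p $ q" for q
    using assms by (intro symmetric_nth) (simp add: unit_outside_def)
  then show ?thesis using assms
    by (simp add: vec_eq_iff matrix_mult_axis_component unit_outside_def) (simp add: axis_def eq_commute)
qed

lemma vec_mask_nth: "vec_mask I z $ p = (if p \<in> I then z $ p else 0)"
  by (simp add: vec_mask_def)

lemma unit_outside_mask:
  assumes "unit_outside I D"
  shows "vec_mask I (D *v z) = D *v vec_mask I z"
proof -
  have z: "D $ p $ q = 0" if "p \<in> I" "q \<notin> I" for p q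
    using assms that symmetric_nth[of D p q] by (auto simp: unit_outside_def)
  have "(D *v z) $ p = (D *v vec_mask I z) $ p" if "p \<in> I" for p
    unfolding matrix_vector_mult_def using z that by (auto simp: vec_mask_nth intro!: sum.cong)
  moreover have "(D *v vec_mask I z) $ p = 0" if "p \<notin> I" for p
    using unit_outside_nth[OF assms that] that by (simp add: vec_mask_nth)
  ultimately show ?thesis by (simp add: vec_eq_iff vec_mask_nth)
qed

lemma vec_mask_uminus: "vec_mask I (- z) = - vec_mask I z"
  by (simp add: vec_eq_iff vec_mask_def)

lemma border_mult_vec:
  "border i a b D *v v = D *v v + (b \<bullet> v) *\<^sub>R axis i 1 + (v $ i) *\<^sub>R b + ((a - 1) * v $ i) *\<^sub>R axis i 1"
  by (simp add: border_def matrix_vector_mult_add_rdistrib outer_mult_vec inner_axis' scaleR_matrix_vector_assoc[symmetric])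

lemma vec_split_coordinate:
  obtains v' where "v = v' + (v $ i) *\<^sub>R axis i (1::real)" "v' $ i = 0"
proof (rule that[of "v - (v $ i) *\<^sub>R axis i 1"])
qed (simp_all add: axis_def)

lemma unit_outside_quadratic:
  fixes v' :: "real^'k"
  assumes D: "unit_outside I D" and i: "i \<notin> I" and v': "v' $ i = 0"
  shows "(v' + c *\<^sub>R axis i 1) \<bullet> (D *v (v' + c *\<^sub>R axis i 1)) = v' \<bullet> (D *v v') + c\<^sup>2"
  using v' unit_outside_axis[OF D i] unit_outside_nth[OF D i, of v']
  by (simp add: matrix_vector_right_distrib matrix_vector_mult_scaleR inner_add_left inner_add_right
      inner_axis inner_axis' power2_eq_square)

lemma posdef_border_imp_posdef:
  assumes D: "unit_outside I D" and i: "i \<notin> I" and b: "b $ i = 0" and pd: "posdef (border i a b D)"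
  shows "posdef D"
  unfolding posdef_def
proof (intro conjI allI impI)
  show "transpose D = D" using D by (simp add: unit_outside_def)
  fix v :: "real^'a" assume v: "v \<noteq> 0"
  obtain v' where v': "v = v' + (v $ i) *\<^sub>R axis i 1" "v' $ i = 0" by (rule vec_split_coordinate)
  have eq: "v' \<bullet> (border i a b D *v v') = v' \<bullet> (D *v v')"
    using v'(2) by (simp add: border_mult_vec inner_add_right inner_axis)
  have q: "v \<bullet> (D *v v) = v' \<bullet> (D *v v') + (v $ i)\<^sup>2"
    by (subst (1 2) v'(1)) (rule unit_outside_quadratic[OF D i v'(2)])
  show "v \<bullet> (D *v v) > 0"
  proof (cases "v' = 0")
    case True
    then have "v $ i \<noteq> 0" using v v'(1) by auto
    then show ?thesis using True q by simp
  next
    case False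
    then have "v' \<bullet> (D *v v') > 0" using pd eq by (metis posdef_def)
    then show ?thesis using q by (simp add: add_pos_nonneg)
  qed
qed

text \<open>
  The matrix arises from the identity by adding multiples of the other rows to the row \<open>i\<close>.
\<close>

lemma det_mat_add_outer_axis:
  fixes v :: "real^'k"
  assumes "v $ i = 0"
  shows "det (mat 1 + outer (axis i 1) v) = 1"
proof -
  have rows: "row j (mat 1 :: real^'k^'k) = axis j 1" for j
    by (auto simp: row_def mat_def vec_eq_iff axis_def)
  have "v \<in> vec.span {row j (mat 1 :: real^'k^'k) | j. j \<noteq> i}"
  proof -
    have "v = (\<Sum>j\<in>UNIV. v $ j *s axis j 1)" by (simp add: basis_expansion)
    moreover have "v $ j *s axis j 1 \<in> vec.span {row j (mat 1 :: real^'k^'k) | j. j \<noteq> i}" for j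
    proof (cases "j = i")
      case False
      then have "axis j 1 \<in> {row j (mat 1 :: real^'k^'k) | j. j \<noteq> i}" by (auto simp: rows)
      then show ?thesis by (intro vec.span_scale vec.span_base)
    qed (simp add: assms vec.span_zero)
    ultimately show ?thesis by (metis (no_types, lifting) vec.span_sum)
  qed
  then have "det (\<chi> k. if k = i then row i (mat 1 :: real^'k^'k) + v else row k (mat 1)) = det (mat 1 :: real^'k^'k)"
    by (rule det_row_span)
  moreover have "(\<chi> k. if k = i then row i (mat 1 :: real^'k^'k) + v else row k (mat 1)) = mat 1 + outer (axis i 1) v"
    by (auto simp: vec_eq_iff rows outer_def) (auto simp: axis_def mat_def)
  ultimately show ?thesis by simp
qed

text \<open>
  With the parametrization \<open>b = - D u\<close> and \<open>a = s + u \<bullet> D u\<close> the bordered matrix has Schur complement \<open>s\<close>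
  over \<open>D\<close>: subtracting \<open>u\<close> times the rows of \<open>I\<close> from the row \<open>i\<close>, and likewise for the columns, turns
  \<open>D\<close> with diagonal entry \<open>s\<close> at \<open>i\<close> into the bordered matrix.
\<close>

context
  fixes I :: "'k::finite set" and D :: "real^'k^'k" and i :: 'k and u :: "real^'k" and s :: real
  assumes D: "unit_outside I D" and i: "i \<notin> I" and pd: "posdef D" and u: "u $ i = 0"
begin

lemma border_eq_congruence:
  "border i (s + u \<bullet> (D *v u)) (- (D *v u)) D =
    (mat 1 + outer (axis i 1) (- u)) ** (D + (s - 1) *\<^sub>R outer (axis i 1) (axis i 1)) **
      transpose (mat 1 + outer (axis i 1) (- u))"
proof -
  have tD: "transpose D = D" using D by (simp add: unit_outside_def)
  have Cv: "(mat 1 + outer (axis i 1) (- u)) *v v = v - (u \<bullet> v) *\<^sub>R axis i 1" for v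
    by (simp only: matrix_vector_mult_add_rdistrib outer_mult_vec) simp
  have Ctv: "transpose (mat 1 + outer (axis i 1) (- u)) *v v = v - (v $ i) *\<^sub>R u" for v
    by (simp only: transpose_add transpose_outer transpose_mat matrix_vector_mult_add_rdistrib outer_mult_vec)
       (simp add: inner_axis')
  have uDv: "u \<bullet> (D *v v) = (D *v u) \<bullet> v" for v
    by (simp add: inner_matrix_vector_mul tD)
  have Di: "(D *v v) $ i = v $ i" for v by (rule unit_outside_nth[OF D i])
  have "border i (s + u \<bullet> (D *v u)) (- (D *v u)) D *v v =
    (mat 1 + outer (axis i 1) (- u)) *v ((D + (s - 1) *\<^sub>R outer (axis i 1) (axis i 1)) *v
      (transpose (mat 1 + outer (axis i 1) (- u)) *v v))" for v
    unfolding Cv Ctv using u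
    by (simp add: border_mult_vec matrix_vector_mult_add_rdistrib scaleR_matrix_vector_assoc[symmetric]
        outer_mult_vec inner_axis inner_axis' matrix_vector_mult_diff_distrib matrix_vector_mult_scaleR
        inner_diff_right inner_add_right uDv) (simp add: algebra_simps inner_commute)
  then show ?thesis by (simp add: matrix_eq matrix_vector_mul_assoc matrix_mul_assoc)
qed

private lemma border_mult_schur_vector:
  "border i (s + u \<bullet> (D *v u)) (- (D *v u)) D *v (axis i 1 + u) = s *\<^sub>R axis i 1"
  and border_mult_axis:
  "border i (s + u \<bullet> (D *v u)) (- (D *v u)) D *v axis i 1 = (s + u \<bullet> (D *v u)) *\<^sub>R axis i 1 - D *v u"
  using u unit_outside_axis[OF D i] unit_outside_nth[OF D i, of u]
  by (simp_all add: border_mult_vec matrix_vector_right_distrib inner_add_right inner_axis inner_axis'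
      algebra_simps inner_commute)

lemma posdef_border_iff: "posdef (border i (s + u \<bullet> (D *v u)) (- (D *v u)) D) \<longleftrightarrow> s > 0"
proof
  assume p: "posdef (border i (s + u \<bullet> (D *v u)) (- (D *v u)) D)"
  have "(axis i 1 + u) $ i \<noteq> 0" using u by simp
  then have "axis i 1 + u \<noteq> 0" by (metis zero_index)
  then have "(axis i 1 + u) \<bullet> (s *\<^sub>R axis i 1) > 0" using p by (metis posdef_def border_mult_schur_vector)
  then show "s > 0" using u by (simp add: inner_add_left inner_axis inner_axis')
next
  assume s: "s > 0"
  let ?Ds = "D + (s - 1) *\<^sub>R outer (axis i 1) (axis i 1)"
  have "posdef ?Ds"
    unfolding posdef_def
  proof (intro conjI allI impI)
    show "transpose ?Ds = ?Ds" using D by (simp add: unit_outside_def transpose_add transpose_scaleR transpose_outer)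
    fix v :: "real^'k" assume v: "v \<noteq> 0"
    obtain v' where v': "v = v' + (v $ i) *\<^sub>R axis i 1" "v' $ i = 0" by (rule vec_split_coordinate)
    have q: "v \<bullet> (D *v v) = v' \<bullet> (D *v v') + (v $ i)\<^sup>2"
      by (subst (1 2) v'(1)) (rule unit_outside_quadratic[OF D i v'(2)])
    have qs: "v \<bullet> (?Ds *v v) = v' \<bullet> (D *v v') + s * (v $ i)\<^sup>2"
      by (simp add: matrix_vector_mult_add_rdistrib scaleR_matrix_vector_assoc[symmetric]
          outer_mult_vec inner_add_right q inner_axis inner_axis' power2_eq_square algebra_simps)
    show "v \<bullet> (?Ds *v v) > 0"
    proof (cases "v' = 0")
      case True
      then have "v $ i \<noteq> 0" using v v'(1) by auto
      then show ?thesis using True qs s by simp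
    next
      case False
      then have "v' \<bullet> (D *v v') > 0" using pd by (simp add: posdef_def)
      then show ?thesis using qs s by (simp add: add_pos_nonneg)
    qed
  qed
  then have "posdef (transpose (transpose (mat 1 + outer (axis i 1) (- u))) ** ?Ds ** transpose (mat 1 + outer (axis i 1) (- u)))"
    by (rule posdef_congruence) (simp add: det_transpose det_mat_add_outer_axis u)
  then show "posdef (border i (s + u \<bullet> (D *v u)) (- (D *v u)) D)"
    by (simp add: border_eq_congruence)
qed

lemma det_border: "det (border i (s + u \<bullet> (D *v u)) (- (D *v u)) D) = s * det D"
proof -
  have "matrix_inv D *v axis i 1 = axis i 1"
    using matrix_inv_cancel(2)[OF posdef_det_nonzero[OF pd], of "axis i 1"] unit_outside_axis[OF D i] by simp
  then show ?thesis using u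
    by (simp add: border_eq_congruence det_mul det_transpose det_mat_add_outer_axis det_add_outer[OF pd] inner_axis)
qed

text \<open>
  The inverse of \<open>D\<close>, with its unit entry at \<open>i\<close> removed, plus a rank-one term along \<open>w = e\<^sub>i + u\<close>. The
  vector \<open>w\<close> is the solution of \<open>\<Sigma> w = s e\<^sub>i\<close>.
\<close>

lemma matrix_inv_border:
  assumes s: "s \<noteq> 0"
  shows "matrix_inv (border i (s + u \<bullet> (D *v u)) (- (D *v u)) D) =
    matrix_inv D - outer (axis i 1) (axis i 1) + (1 / s) *\<^sub>R outer (axis i 1 + u) (axis i 1 + u)"
    (is "matrix_inv ?B = ?X")
proof (rule matrix_inv_unique)
  have d: "det D \<noteq> 0" using pd by (rule posdef_det_nonzero)
  have tD: "transpose D = D" using D by (simp add: unit_outside_def)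
  have ei: "matrix_inv D *v axis i 1 = axis i 1"
    using matrix_inv_cancel(2)[OF d, of "axis i 1"] unit_outside_axis[OF D i] by simp
  have "?B *v (?X *v v) = v" for v
  proof -
    have Di: "(matrix_inv D *v v) $ i = v $ i"
      using unit_outside_nth[OF D i, of "matrix_inv D *v v"] matrix_inv_cancel(1)[OF d, of v] by simp
    have uDv: "(D *v u) \<bullet> (matrix_inv D *v v) = u \<bullet> v"
      by (metis inner_matrix_vector_mul tD matrix_inv_cancel(1)[OF d])
    have X: "?X *v v = matrix_inv D *v v - (v $ i) *\<^sub>R axis i 1 + (((axis i 1 + u) \<bullet> v) / s) *\<^sub>R (axis i 1 + u)"
      by (simp add: matrix_vector_mult_add_rdistrib scaleR_matrix_vector_assoc[symmetric] outer_mult_vec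
          matrix_vector_mult_diff_rdistrib inner_axis')
    have "?B *v (?X *v v) = ?B *v (matrix_inv D *v v) - (v $ i) *\<^sub>R (?B *v axis i 1)
       + (((axis i 1 + u) \<bullet> v) / s) *\<^sub>R (?B *v (axis i 1 + u))"
      unfolding X by (simp only: matrix_vector_right_distrib matrix_vector_mult_diff_distrib matrix_vector_mult_scaleR)
    also have "?B *v (matrix_inv D *v v) = v - (u \<bullet> v) *\<^sub>R axis i 1 - (v $ i) *\<^sub>R (D *v u)
       + ((s + u \<bullet> (D *v u) - 1) * v $ i) *\<^sub>R axis i 1"
      by (simp add: border_mult_vec matrix_inv_cancel[OF d] Di uDv)
    also have "(((axis i 1 + u) \<bullet> v) / s) *\<^sub>R (?B *v (axis i 1 + u)) = (v $ i + u \<bullet> v) *\<^sub>R axis i 1"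
      unfolding border_mult_schur_vector using s by (simp add: inner_add_left inner_axis')
    finally show ?thesis
      unfolding border_mult_axis by (simp add: algebra_simps)
  qed
  then have "(?B ** ?X) *v v = mat 1 *v v" for v by (simp add: matrix_vector_mul_assoc)
  then show "?B ** ?X = mat 1" unfolding matrix_eq by blast
qed

lemma trace_matrix_inv_border:
  assumes s: "s \<noteq> 0"
  shows "trace (matrix_inv (border i (s + u \<bullet> (D *v u)) (- (D *v u)) D)) =
    trace (matrix_inv D) - 1 + (1 + u \<bullet> u) / s"
  using u unfolding matrix_inv_border[OF s]
  by (simp add: trace_add trace_sub trace_scaleR trace_outer inner_add_left inner_add_right inner_axis inner_axis')

lemma matrix_inv_border_axis:
  assumes s: "s \<noteq> 0"
  shows "matrix_inv (border i (s + u \<bullet> (D *v u)) (- (D *v u)) D) *v axis i 1 = (1 / s) *\<^sub>R (axis i 1 + u)"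
proof -
  have "matrix_inv D *v axis i 1 = axis i 1"
    using matrix_inv_cancel(2)[OF posdef_det_nonzero[OF pd], of "axis i 1"] unit_outside_axis[OF D i] by simp
  then show ?thesis using u unfolding matrix_inv_border[OF s]
    by (simp add: matrix_vector_mult_add_rdistrib matrix_vector_mult_diff_rdistrib
        scaleR_matrix_vector_assoc[symmetric] outer_mult_vec
        inner_add_left inner_axis inner_axis' del: scaleR_add_right)
qed

end


section \<open>The chi-square distribution\<close>

lemma nn_integral_reciprocal:
  fixes f :: "real \<Rightarrow> ennreal"
  assumes f [measurable]: "f \<in> borel_measurable borel"
  shows "(\<integral>\<^sup>+s. f s * indicator {0<..} s \<partial>lborel) =
    (\<integral>\<^sup>+\<eta>. f (1 / \<eta>) * ennreal (1 / \<eta>\<^sup>2) * indicator {0<..} \<eta> \<partial>lborel)"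
proof -
  \<comment> \<open>The intervals are invariant under \<open>x \<mapsto> 1 / x\<close> and exhaust the positive numbers.\<close>
  define U where "U n = {1 / (real n + 2)..real n + 2}" for n :: nat
  have U: "incseq U"
    by (rule monoI) (auto simp: U_def frac_le intro: order_trans[rotated])
  have UN: "(\<Union>n. U n) = {0<..}"
  proof (intro set_eqI iffI)
    fix x assume "x \<in> (\<Union>n. U n)"
    then obtain n where "1 / (real n + 2) \<le> x" by (auto simp: U_def)
    moreover have "0 < 1 / (real n + 2)" by simp
    ultimately show "x \<in> {0<..}" unfolding greaterThan_iff by linarith
  next
    fix x :: real assume x: "x \<in> {0<..}"
    obtain n where n: "max x (1 / x) < real n" using reals_Archimedean2 by blast
    then have "1 / x \<le> real n + 2" by simp
    then have "1 / (real n + 2) \<le> x" using x by (simp add: field_simps)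
    then have "x \<in> U n" using n by (simp add: U_def)
    then show "x \<in> (\<Union>n. U n)" by blast
  qed
  have step: "(\<integral>\<^sup>+s. f s * indicator (U n) s \<partial>lborel) = (\<integral>\<^sup>+\<eta>. f (1 / \<eta>) * ennreal (1 / \<eta>\<^sup>2) * indicator (U n) \<eta> \<partial>lborel)" for n
  proof -
    let ?a = "1 / (real n + 2)" and ?b = "real n + 2"
    have ab: "0 < ?a" "?a < ?b" by (auto simp: field_simps intro!: add_pos_nonneg less_le_trans[of 1 4])
    \<comment> \<open>The substitution rule needs an increasing function, so the line is reflected first.\<close>
    have "(\<integral>\<^sup>+s. f s * indicator (U n) s \<partial>lborel) = (\<integral>\<^sup>+s. f (- s) * indicator (U n) (- s) \<partial>lborel)"
      unfolding U_def by (subst nn_integral_real_affine[where c = "-1" and t = 0]) simp_all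
    also have "\<dots> = (\<integral>\<^sup>+s. f (- s) * indicator {- 1 / ?a..- 1 / ?b} s \<partial>lborel)"
      by (intro nn_integral_cong) (auto simp: U_def indicator_def)
    also have "\<dots> = (\<integral>\<^sup>+\<eta>. f (- (- 1 / \<eta>)) * ennreal (1 / \<eta>\<^sup>2) * indicator {?a..?b} \<eta> \<partial>lborel)"
    proof (rule nn_integral_substitution_aux)
      show "((\<lambda>x. - 1 / x) has_real_derivative 1 / x\<^sup>2) (at x)" if "x \<in> {?a..?b}" for x
      proof -
        have "x \<noteq> 0" using that ab by auto
        then show ?thesis by (auto intro!: derivative_eq_intros simp: power2_eq_square)
      qed
      show "continuous_on {?a..?b} (\<lambda>x. 1 / x\<^sup>2)"
        using ab by (intro continuous_intros) auto
    qed (use ab in auto)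
    finally show ?thesis by (simp add: U_def)
  qed
  have sup: "(\<integral>\<^sup>+s. g s * indicator {0<..} s \<partial>lborel) = (SUP n. \<integral>\<^sup>+s. g s * indicator (U n) s \<partial>lborel)"
    if [measurable]: "g \<in> borel_measurable borel" for g :: "real \<Rightarrow> ennreal"
  proof -
    have Um: "U n \<in> sets borel" for n by (simp add: U_def)
    have "(SUP n. emeasure (density lborel g) (U n)) = emeasure (density lborel g) (\<Union>n. U n)"
      using U Um by (intro SUP_emeasure_incseq) auto
    then show ?thesis using Um by (simp add: UN emeasure_density)
  qed
  show ?thesis by (subst (1 2) sup) (simp_all add: step)
qed

lemma measurable_chi_square_density [measurable]: "chi_square_density \<nu> \<in> borel_measurable borel"
  unfolding chi_square_density_def[abs_def] by measurable

lemma sets_chi_square [simp, measurable_cong]: "sets (chi_square \<nu>) = sets borel"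
  and space_chi_square [simp]: "space (chi_square \<nu>) = UNIV"
  by (simp_all add: chi_square_def)

lemma nn_integral_chi_square:
  "F \<in> borel_measurable borel \<Longrightarrow>
    (\<integral>\<^sup>+\<eta>. F \<eta> \<partial>chi_square \<nu>) = (\<integral>\<^sup>+\<eta>. ennreal (chi_square_density \<nu> \<eta>) * F \<eta> \<partial>lborel)"
  unfolding chi_square_def by (subst nn_integral_density) auto

text \<open>
  The Gamma integral with a rate. It normalizes the chi-square density, and it represents a power of
  \<open>q\<close> as a mixture of exponentials for the multivariate t-distribution.
\<close>

lemma nn_integral_gamma_scaled:
  fixes a q :: real
  assumes a: "a > 0" and q: "q > 0"
  shows "(\<integral>\<^sup>+t. ennreal (t powr (a - 1) * exp (- (q * t))) * indicator {0<..} t \<partial>lborel) = ennreal (Gamma a * q powr (- a))"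
proof -
  have "ennreal (Gamma a) = (\<integral>\<^sup>+t. ennreal (indicator {0..} t * t powr (a - 1) / exp t) \<partial>lborel)"
    by (rule Gamma_conv_nn_integral_real[OF a])
  also have "\<dots> = ennreal \<bar>q\<bar> * (\<integral>\<^sup>+t. ennreal (indicator {0..} (0 + q * t) * (0 + q * t) powr (a - 1) / exp (0 + q * t)) \<partial>lborel)"
    by (rule nn_integral_real_affine) (use q in auto)
  also have "(\<integral>\<^sup>+t. ennreal (indicator {0..} (0 + q * t) * (0 + q * t) powr (a - 1) / exp (0 + q * t)) \<partial>lborel)
    = (\<integral>\<^sup>+t. ennreal (q powr (a - 1)) * (ennreal (t powr (a - 1) * exp (- (q * t))) * indicator {0<..} t) \<partial>lborel)"
  proof (intro nn_integral_cong)
    fix t :: real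
    consider "t < 0" | "t = 0" | "t > 0" by linarith
    then show "ennreal (indicator {0..} (0 + q * t) * (0 + q * t) powr (a - 1) / exp (0 + q * t))
      = ennreal (q powr (a - 1)) * (ennreal (t powr (a - 1) * exp (- (q * t))) * indicator {0<..} t)"
    proof cases
      case 1
      then have "q * t < 0" using q by (simp add: mult_pos_neg)
      then show ?thesis using 1 by simp
    next
      case 3
      then show ?thesis using q
        by (simp add: powr_mult exp_minus ennreal_mult'[symmetric] divide_inverse mult_ac)
    qed simp
  qed
  also have "\<dots> = ennreal (q powr (a - 1)) * (\<integral>\<^sup>+t. ennreal (t powr (a - 1) * exp (- (q * t))) * indicator {0<..} t \<partial>lborel)"
    by (rule nn_integral_cmult) measurable
  finally have *: "ennreal (Gamma a) = ennreal (q powr a) *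
      (\<integral>\<^sup>+t. ennreal (t powr (a - 1) * exp (- (q * t))) * indicator {0<..} t \<partial>lborel)"
    using q by (simp add: mult.assoc[symmetric] ennreal_mult'[symmetric] powr_mult_base)
  have "ennreal (Gamma a * q powr (- a)) = ennreal (q powr (- a)) * ennreal (Gamma a)"
    by (simp add: ennreal_mult''[symmetric] mult.commute)
  also have "\<dots> = (\<integral>\<^sup>+t. ennreal (t powr (a - 1) * exp (- (q * t))) * indicator {0<..} t \<partial>lborel)"
    unfolding * using q by (simp add: mult.assoc[symmetric] ennreal_mult'[symmetric] powr_add[symmetric])
  finally show ?thesis ..
qed

lemma prob_space_chi_square:
  assumes "\<nu> > 0" shows "prob_space (chi_square \<nu>)"
proof
  have G: "Gamma (\<nu> / 2) > 0" using assms by (simp add: Gamma_real_pos)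
  have "emeasure (chi_square \<nu>) (space (chi_square \<nu>)) = (\<integral>\<^sup>+x. ennreal (chi_square_density \<nu> x) \<partial>lborel)"
    by (simp add: chi_square_def emeasure_density)
  also have "\<dots> = (\<integral>\<^sup>+x. ennreal (1 / (2 powr (\<nu> / 2) * Gamma (\<nu> / 2))) *
      (ennreal (x powr (\<nu> / 2 - 1) * exp (- (1 / 2 * x))) * indicator {0<..} x) \<partial>lborel)"
    using G by (intro nn_integral_cong) (auto simp: chi_square_density_def indicator_def ennreal_mult''[symmetric])
  also have "\<dots> = ennreal (1 / (2 powr (\<nu> / 2) * Gamma (\<nu> / 2))) * ennreal (Gamma (\<nu> / 2) * (1 / 2) powr (- (\<nu> / 2)))"
    using nn_integral_gamma_scaled[of "\<nu> / 2" "1 / 2"] assms by (subst nn_integral_cmult) simp_all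
  also have "\<dots> = 1"
    using G by (simp add: ennreal_mult''[symmetric] powr_minus powr_divide field_simps)
  finally show "emeasure (chi_square \<nu>) (space (chi_square \<nu>)) = 1" .
qed

section \<open>The inverse Wishart kernel\<close>

text \<open>
  The inverse Wishart kernel with scale matrix \<open>1\<close>, extended by zero. The parameter \<open>c\<close> is half of the
  degrees of freedom; it is the quantity that drops by one when the dimension does.
\<close>

definition iw_kernel :: "real \<Rightarrow> real^'k^'k \<Rightarrow> real" where
  "iw_kernel c \<Sigma> = (if posdef \<Sigma> then det \<Sigma> powr (- c) * exp (- trace (matrix_inv \<Sigma>) / 2) else 0)"

lemma measurable_iw_kernel [measurable]: "iw_kernel c \<in> borel_measurable borel"
  unfolding iw_kernel_def[abs_def] by measurable

text \<open>
  The factor that \<open>s\<close> and \<open>u\<close> contribute to the integral of the kernel when row and column \<open>i\<close> are split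
  off; the vector \<open>u\<close> consists of the coordinates of \<open>z\<close> in \<open>I\<close>. The leading one in the exponent comes
  from \<open>tr D\<^sup>-\<^sup>1\<close>, which counts the unit entry of \<open>D\<close> at \<open>i\<close>.
\<close>

definition schur_integral :: "'k set \<Rightarrow> 'k \<Rightarrow> real \<Rightarrow> (real^'k \<Rightarrow> ennreal) \<Rightarrow> ennreal" where
  "schur_integral I i c H = (\<integral>\<^sup>+z. ennreal (\<Prod>j\<in>-I. std_normal_density (z $ j)) *
    (\<integral>\<^sup>+s. ennreal (s powr (- c) * exp ((1 - (1 + vec_mask I z \<bullet> vec_mask I z) / s) / 2)) *
       H ((1 / s) *\<^sub>R (axis i 1 + vec_mask I z)) * indicator {0<..} s \<partial>lborel) \<partial>lborel)"

text \<open>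
  The kernel separates after the substitution \<open>b = - D u\<close>, \<open>a = s + u \<bullet> D u\<close>. Its Jacobian \<open>det D\<close> lowers
  the exponent of \<open>det D\<close> by one. If \<open>D\<close> is not positive definite, neither is the bordered matrix.
\<close>

lemma nn_integral_iw_kernel_insert:
  fixes I :: "'k::finite set"
  assumes i: "i \<notin> I" and H [measurable]: "H \<in> borel_measurable borel"
  shows "(\<integral>\<^sup>+f. ennreal (iw_kernel c (sym_of (insert i I) f)) * H (matrix_inv (sym_of (insert i I) f) *v axis i 1) \<partial>sym_PiM (insert i I))
    = (\<integral>\<^sup>+g. ennreal (iw_kernel (c - 1) (sym_of I g)) \<partial>sym_PiM I) * schur_integral I i c H"
proof -
  define G where "G \<Sigma> = ennreal (iw_kernel c \<Sigma>) * H (matrix_inv \<Sigma> *v axis i 1)" for \<Sigma> :: "real^'k^'k"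
  let ?q = "\<lambda>D. det D powr (- c) * exp (- trace (matrix_inv D) / 2)"
  define \<phi> where "\<phi> z = ennreal (\<Prod>j\<in>-I. std_normal_density (z $ j))" for z :: "real^'k"
  have [measurable]: "G \<in> borel_measurable borel" "\<phi> \<in> borel_measurable borel"
    unfolding G_def \<phi>_def by measurable
  have inner: "(\<integral>\<^sup>+z. \<phi> z * (\<integral>\<^sup>+a. G (border i a (vec_mask I z) D) \<partial>lborel) \<partial>lborel)
    = ennreal (iw_kernel (c - 1) D) * schur_integral I i c H" if D: "unit_outside I D" for D
  proof (cases "posdef D")
    case False
    have "\<not> posdef (border i a (vec_mask I z) D)" for a z
      using posdef_border_imp_posdef[OF D i, of "vec_mask I z" a] False i by (auto simp: vec_mask_nth)
    then show ?thesis using False by (simp add: G_def iw_kernel_def)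
  next
    case True
    define h where "h z s = ennreal (s powr (- c) * exp ((1 - (1 + vec_mask I z \<bullet> vec_mask I z) / s) / 2)) *
       H ((1 / s) *\<^sub>R (axis i 1 + vec_mask I z)) * indicator {0<..} s" for z :: "real^'k" and s
    \<comment> \<open>The substitution \<open>b = - D u\<close>; the coordinates outside \<open>I\<close> only change sign.\<close>
    define A where "A = (- 1) *\<^sub>R D"
    have d: "det D > 0" using True by (rule posdef_det_pos)
    have dA: "\<bar>det A\<bar> = det D" unfolding A_def det_scaleR using d by (simp add: abs_mult power_abs)
    have Az: "A *v z = - (D *v z)" for z
      unfolding A_def scaleR_matrix_vector_assoc[symmetric] by simp
    have "(\<integral>\<^sup>+z. \<phi> z * (\<integral>\<^sup>+a. G (border i a (vec_mask I z) D) \<partial>lborel) \<partial>lborel)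
      = ennreal \<bar>det A\<bar> * (\<integral>\<^sup>+z. \<phi> (A *v z) * (\<integral>\<^sup>+a. G (border i a (vec_mask I (A *v z)) D) \<partial>lborel) \<partial>lborel)"
      by (rule nn_integral_lborel_matrix) (use d dA in auto)
    also have "(\<integral>\<^sup>+z. \<phi> (A *v z) * (\<integral>\<^sup>+a. G (border i a (vec_mask I (A *v z)) D) \<partial>lborel) \<partial>lborel)
      = (\<integral>\<^sup>+z. ennreal (?q D) * (\<phi> z * (\<integral>\<^sup>+s. h z s \<partial>lborel)) \<partial>lborel)"
    proof (intro nn_integral_cong)
      fix z :: "real^'k"
      define u where "u = vec_mask I z"
      have u: "u $ i = 0" using i by (simp add: u_def vec_mask_nth)
      have p: "\<phi> (A *v z) = \<phi> z"
        unfolding \<phi>_def Az by (intro arg_cong[where f = ennreal] prod.cong)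
          (simp_all add: unit_outside_nth[OF D] std_normal_density_def)
      have m: "vec_mask I (A *v z) = - (D *v u)"
        by (simp add: Az vec_mask_uminus unit_outside_mask[OF D] u_def)
      have "(\<integral>\<^sup>+a. G (border i a (- (D *v u)) D) \<partial>lborel) = ennreal \<bar>1\<bar> * (\<integral>\<^sup>+s. G (border i (u \<bullet> (D *v u) + 1 * s) (- (D *v u)) D) \<partial>lborel)"
        by (rule nn_integral_real_affine) simp_all
      also have "\<dots> = (\<integral>\<^sup>+s. G (border i (s + u \<bullet> (D *v u)) (- (D *v u)) D) \<partial>lborel)"
        by (simp add: add.commute)
      also have "\<dots> = (\<integral>\<^sup>+s. ennreal (?q D) * h z s \<partial>lborel)"
      proof (intro nn_integral_cong)
        fix s :: real
        show "G (border i (s + u \<bullet> (D *v u)) (- (D *v u)) D) = ennreal (?q D) * h z s"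
        proof (cases "s > 0")
          case False
          then show ?thesis by (simp add: G_def h_def iw_kernel_def posdef_border_iff[OF D i True u])
        next
          case s: True
          have "iw_kernel c (border i (s + u \<bullet> (D *v u)) (- (D *v u)) D)
            = (s * det D) powr (- c) * exp (- (trace (matrix_inv D) - 1 + (1 + u \<bullet> u) / s) / 2)"
            using s by (simp add: iw_kernel_def posdef_border_iff[OF D i True u] det_border[OF D i True u]
               trace_matrix_inv_border[OF D i True u])
          also have "- (trace (matrix_inv D) - 1 + (1 + u \<bullet> u) / s) / 2 = - trace (matrix_inv D) / 2 + (1 - (1 + u \<bullet> u) / s) / 2"
            by (simp add: field_simps)
          also have "(s * det D) powr (- c) * exp \<dots> = ?q D *
              (s powr (- c) * exp ((1 - (1 + u \<bullet> u) / s) / 2))"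
            using s d by (subst exp_add, subst powr_mult) (simp_all add: mult_ac)
          finally show ?thesis using s
            by (simp add: G_def h_def u_def[symmetric] matrix_inv_border_axis[OF D i True u] ennreal_mult'' mult_ac)
        qed
      qed
      also have "\<dots> = ennreal (?q D) * (\<integral>\<^sup>+s. h z s \<partial>lborel)"
        unfolding h_def by (rule nn_integral_cmult) measurable
      finally show "\<phi> (A *v z) * (\<integral>\<^sup>+a. G (border i a (vec_mask I (A *v z)) D) \<partial>lborel)
        = ennreal (?q D) * (\<phi> z * (\<integral>\<^sup>+s. h z s \<partial>lborel))"
        unfolding p m by (simp add: mult_ac)
    qed
    also have "\<dots> = ennreal (?q D) * schur_integral I i c H"
      unfolding schur_integral_def \<phi>_def h_def by (rule nn_integral_cmult) measurable
    also have "ennreal \<bar>det A\<bar> * (ennreal (?q D) * schur_integral I i c H)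
      = ennreal (iw_kernel (c - 1) D) * schur_integral I i c H"
    proof -
      have "det D * det D powr (- c) = det D powr (- (c - 1))"
        using d by (simp add: powr_mult_base)
      then show ?thesis using True d
        by (simp add: dA iw_kernel_def mult.assoc[symmetric] ennreal_mult''[symmetric])
    qed
    finally show ?thesis .
  qed
  have "(\<integral>\<^sup>+f. G (sym_of (insert i I) f) \<partial>sym_PiM (insert i I))
    = (\<integral>\<^sup>+g. ennreal (iw_kernel (c - 1) (sym_of I g)) * schur_integral I i c H \<partial>sym_PiM I)"
    by (subst nn_integral_sym_border[OF i]) (simp_all add: inner unit_outside_sym_of flip: \<phi>_def)
  also have "\<dots> = (\<integral>\<^sup>+g. ennreal (iw_kernel (c - 1) (sym_of I g)) \<partial>sym_PiM I) * schur_integral I i c H"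
    by (rule nn_integral_multc) measurable
  finally show ?thesis unfolding G_def .
qed


text \<open>
  The Gaussian factor of the coordinates in \<open>I\<close> and the auxiliary densities of the other coordinates
  together form the standard normal density of the whole vector.
\<close>

lemma std_normal_density_prod_compl:
  fixes I :: "'k::finite set"
  shows "(\<Prod>j\<in>-I. std_normal_density (z $ j)) * exp (- (vec_mask I z \<bullet> vec_mask I z) / 2)
    = sqrt (2 * pi) ^ card I * mvnormal_density 0 (mat 1) z"
proof -
  have "vec_mask I z \<bullet> vec_mask I z = (\<Sum>j\<in>UNIV. if j \<in> I then (z $ j)\<^sup>2 else 0)"
    by (simp add: inner_vec_def vec_mask_nth power2_eq_square if_distrib cong: if_cong)
  also have "\<dots> = (\<Sum>j\<in>I. (z $ j)\<^sup>2)" by (simp add: sum.If_cases)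
  finally have e: "exp (- (vec_mask I z \<bullet> vec_mask I z) / 2) = (\<Prod>j\<in>I. exp (- (z $ j)\<^sup>2 / 2))"
    by (simp add: exp_sum[symmetric] sum_negf sum_divide_distrib)
  have "(\<Prod>j\<in>I. std_normal_density (z $ j)) = (1 / sqrt (2 * pi)) ^ card I * (\<Prod>j\<in>I. exp (- (z $ j)\<^sup>2 / 2))"
    unfolding std_normal_density_def prod.distrib by simp
  then have "(\<Prod>j\<in>I. exp (- (z $ j)\<^sup>2 / 2)) = sqrt (2 * pi) ^ card I * (\<Prod>j\<in>I. std_normal_density (z $ j))"
    by (simp add: power_divide)
  moreover have "(\<Prod>j\<in>UNIV. std_normal_density (z $ j))
    = (\<Prod>j\<in>I. std_normal_density (z $ j)) * (\<Prod>j\<in>-I. std_normal_density (z $ j))"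
    by (subst prod.union_disjoint[symmetric]) auto
  ultimately show ?thesis unfolding e std_mvnormal_density_eq_prod by (simp add: mult_ac)
qed

lemma mvnormal_density_std_nonneg: "mvnormal_density 0 (mat 1) z \<ge> 0"
  by (simp add: mvnormal_density_def)

text \<open>
  With \<open>\<eta> = 1 / s\<close> and \<open>u = z / \<surd>\<eta>\<close> the integrand splits into a chi-square density in \<open>\<eta>\<close> and a standard
  normal density in \<open>z\<close>. The power of \<open>\<eta>\<close> collects \<open>c\<close> from the kernel, \<open>-2\<close> from the reciprocal
  and \<open>- card I / 2\<close> from the scaling of \<open>u\<close>.
\<close>

lemma schur_integral_eq:
  fixes I :: "'k::finite set"
  assumes \<nu>: "2 * c - real (card I) - 2 = \<nu>" "\<nu> > 0" and H [measurable]: "H \<in> borel_measurable borel"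
  shows "schur_integral I i c H = ennreal (exp (1 / 2) * sqrt (2 * pi) ^ card I * (2 powr (\<nu> / 2) * Gamma (\<nu> / 2))) *
    (\<integral>\<^sup>+\<eta>. \<integral>\<^sup>+z. H (\<eta> *\<^sub>R axis i 1 + sqrt \<eta> *\<^sub>R vec_mask I z) \<partial>std_mvnormal \<partial>chi_square \<nu>)"
proof -
  define \<phi> where "\<phi> z = (\<Prod>j\<in>-I. std_normal_density (z $ j))" for z :: "real^'k"
  have \<phi>0: "\<phi> z \<ge> 0" for z unfolding \<phi>_def by (intro prod_nonneg) simp
  have [measurable]: "\<phi> \<in> borel_measurable borel" unfolding \<phi>_def by measurable
  define m where "m z = vec_mask I z \<bullet> vec_mask I z" for z :: "real^'k"
  have [measurable]: "m \<in> borel_measurable borel" unfolding m_def by measurable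
  let ?e = "axis i 1 :: real^'k"
  have \<nu>2: "c = 2 + (\<nu> / 2 - 1) + real (card I) / 2" using \<nu>(1) by (simp add: field_simps)
  define K where "K = exp (1 / 2) * sqrt (2 * pi) ^ card I * (2 powr (\<nu> / 2) * Gamma (\<nu> / 2))"
  have G: "Gamma (\<nu> / 2) > 0" using \<nu> by (simp add: Gamma_real_pos)
  have K0: "K > 0" using G by (simp add: K_def)
  define g where "g z \<eta> = ennreal (\<phi> z * (\<eta> powr (c - 2) * exp ((1 - \<eta> * (1 + m z)) / 2))) *
      H (\<eta> *\<^sub>R (?e + vec_mask I z)) * indicator {0<..} \<eta>" for z \<eta>
  have [measurable]: "(\<lambda>(z, \<eta>). g z \<eta>) \<in> borel_measurable (lborel \<Otimes>\<^sub>M lborel)"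
    unfolding g_def by measurable
  have "schur_integral I i c H = (\<integral>\<^sup>+z. \<integral>\<^sup>+\<eta>. g z \<eta> \<partial>lborel \<partial>lborel)"
    unfolding schur_integral_def \<phi>_def[symmetric] m_def[symmetric]
  proof (intro nn_integral_cong)
    fix z
    have "(\<integral>\<^sup>+s. ennreal (s powr (- c) * exp ((1 - (1 + m z) / s) / 2)) * H ((1 / s) *\<^sub>R (?e + vec_mask I z)) * indicator {0<..} s \<partial>lborel)
      = (\<integral>\<^sup>+\<eta>. ennreal ((1 / \<eta>) powr (- c) * exp ((1 - (1 + m z) / (1 / \<eta>)) / 2)) * H ((1 / (1 / \<eta>)) *\<^sub>R (?e + vec_mask I z))
          * ennreal (1 / \<eta>\<^sup>2) * indicator {0<..} \<eta> \<partial>lborel)"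
      by (rule nn_integral_reciprocal) measurable
    also have "ennreal (\<phi> z) * \<dots> = (\<integral>\<^sup>+\<eta>. g z \<eta> \<partial>lborel)"
    proof (subst nn_integral_cmult[symmetric], measurable, intro nn_integral_cong)
      fix \<eta> :: real
      show "ennreal (\<phi> z) * (ennreal ((1 / \<eta>) powr (- c) * exp ((1 - (1 + m z) / (1 / \<eta>)) / 2)) * H ((1 / (1 / \<eta>)) *\<^sub>R (?e + vec_mask I z))
          * ennreal (1 / \<eta>\<^sup>2) * indicator {0<..} \<eta>) = g z \<eta>"
      proof (cases "\<eta> > 0")
        case True
        have q: "(1 / \<eta>) powr (- c) * (1 / \<eta>\<^sup>2) = \<eta> powr (c - 2)"
          using True by (simp add: powr_divide powr_minus powr_diff field_simps)
        have reorder: "ennreal p * ennreal (a * b) * ennreal d = ennreal (p * (a * d * b))"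
          if "p \<ge> 0" "a \<ge> 0" "b \<ge> 0" "d \<ge> 0" for p a b d
          using that by (simp add: ennreal_mult mult_ac)
        have "ennreal (\<phi> z) * ennreal ((1 / \<eta>) powr (- c) * exp ((1 - (1 + m z) / (1 / \<eta>)) / 2)) * ennreal (1 / \<eta>\<^sup>2)
          = ennreal (\<phi> z * ((1 / \<eta>) powr (- c) * (1 / \<eta>\<^sup>2) * exp ((1 - (1 + m z) / (1 / \<eta>)) / 2)))"
          by (rule reorder) (simp_all add: \<phi>0)
        also have "\<dots> = ennreal (\<phi> z * (\<eta> powr (c - 2) * exp ((1 - \<eta> * (1 + m z)) / 2)))"
          unfolding q by (simp add: mult.commute)
        finally have eq: "ennreal (\<phi> z) * ennreal ((1 / \<eta>) powr (- c) * exp ((1 - (1 + m z) / (1 / \<eta>)) / 2)) * ennreal (1 / \<eta>\<^sup>2)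
          = ennreal (\<phi> z * (\<eta> powr (c - 2) * exp ((1 - \<eta> * (1 + m z)) / 2)))" .
        have v: "(1 / (1 / \<eta>)) *\<^sub>R (?e + vec_mask I z) = \<eta> *\<^sub>R (?e + vec_mask I z)" by simp
        show ?thesis using True unfolding g_def eq[symmetric] v by (simp only: mult_ac)
      qed (simp add: g_def)
    qed
    finally show "ennreal (\<phi> z) * (\<integral>\<^sup>+s. ennreal (s powr (- c) * exp ((1 - (1 + m z) / s) / 2)) * H ((1 / s) *\<^sub>R (?e + vec_mask I z)) * indicator {0<..} s \<partial>lborel)
      = (\<integral>\<^sup>+\<eta>. g z \<eta> \<partial>lborel)" .
  qed
  also have "\<dots> = (\<integral>\<^sup>+\<eta>. \<integral>\<^sup>+z. g z \<eta> \<partial>lborel \<partial>lborel)"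
    by (rule pair_sigma_finite.Fubini'[symmetric]) (auto intro!: pair_sigma_finite.intro lborel.sigma_finite_measure_axioms)
  also have "\<dots> = (\<integral>\<^sup>+\<eta>. ennreal K * (ennreal (chi_square_density \<nu> \<eta>) *
      (\<integral>\<^sup>+z. H (\<eta> *\<^sub>R ?e + sqrt \<eta> *\<^sub>R vec_mask I z) \<partial>std_mvnormal)) \<partial>lborel)"
  proof (intro nn_integral_cong)
    fix \<eta> :: real
    show "(\<integral>\<^sup>+z. g z \<eta> \<partial>lborel) = ennreal K * (ennreal (chi_square_density \<nu> \<eta>) *
      (\<integral>\<^sup>+z. H (\<eta> *\<^sub>R ?e + sqrt \<eta> *\<^sub>R vec_mask I z) \<partial>std_mvnormal))"
    proof (cases "\<eta> > 0")
      case False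
      then show ?thesis by (simp add: g_def chi_square_density_def)
    next
      case \<eta>: True
      \<comment> \<open>Only the coordinates in \<open>I\<close> are scaled; the auxiliary ones are left as they are.\<close>
      define B :: "real^'k^'k" where "B = (\<chi> p q. if p = q then (if p \<in> I then 1 / sqrt \<eta> else 1) else 0)"
      have "det B = (\<Prod>p\<in>UNIV. if p \<in> I then 1 / sqrt \<eta> else 1)"
        by (subst det_diagonal) (auto simp: B_def)
      then have dB: "det B = \<eta> powr (- (real (card I) / 2))"
        using \<eta> by (simp add: prod.If_cases powr_half_sqrt[symmetric] power_divide powr_power powr_minus field_simps)
      have Bz: "(B *v z) $ p = (if p \<in> I then z $ p / sqrt \<eta> else z $ p)" for z p
      proof -
        have "B $ p = (if p \<in> I then 1 / sqrt \<eta> else 1) *\<^sub>R axis p 1"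
          by (auto simp: vec_eq_iff B_def axis_def)
        then show ?thesis by (simp add: matrix_vector_mul_component inner_axis')
      qed
      have mB: "vec_mask I (B *v z) = (1 / sqrt \<eta>) *\<^sub>R vec_mask I z" for z
        by (simp add: vec_eq_iff vec_mask_nth Bz)
      have m_B: "m (B *v z) = m z / \<eta>" for z
        using \<eta> by (simp add: m_def mB)
      have \<phi>B: "\<phi> (B *v z) = \<phi> z" for z
        unfolding \<phi>_def by (intro prod.cong) (simp_all add: Bz)
      have "(\<integral>\<^sup>+z. g z \<eta> \<partial>lborel) = ennreal \<bar>det B\<bar> * (\<integral>\<^sup>+z. g (B *v z) \<eta> \<partial>lborel)"
        by (rule nn_integral_lborel_matrix) (use \<eta> in \<open>auto simp: dB g_def\<close>)
      also have "\<dots> = (\<integral>\<^sup>+z. ennreal \<bar>det B\<bar> * g (B *v z) \<eta> \<partial>lborel)"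
        by (rule nn_integral_cmult[symmetric]) (simp add: g_def)
      also have "\<dots> = (\<integral>\<^sup>+z. ennreal (K * chi_square_density \<nu> \<eta>) *
          (ennreal (mvnormal_density 0 (mat 1) z) * H (\<eta> *\<^sub>R ?e + sqrt \<eta> *\<^sub>R vec_mask I z)) \<partial>lborel)"
      proof (intro nn_integral_cong)
        fix z :: "real^'k"
        have v: "\<eta> *\<^sub>R (?e + vec_mask I (B *v z)) = \<eta> *\<^sub>R ?e + sqrt \<eta> *\<^sub>R vec_mask I z"
          using \<eta> by (simp add: mB scaleR_add_right real_div_sqrt)
        have x: "exp ((1 - \<eta> * (1 + m (B *v z))) / 2) = exp (1 / 2) * exp (- \<eta> / 2) * exp (- m z / 2)"
          using \<eta> unfolding m_B by (simp add: exp_add[symmetric] field_simps)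
        have "det B * (\<phi> (B *v z) * (\<eta> powr (c - 2) * exp ((1 - \<eta> * (1 + m (B *v z))) / 2)))
          = exp (1 / 2) * (\<eta> powr (- (real (card I) / 2)) * \<eta> powr (c - 2)) * exp (- \<eta> / 2) * (\<phi> z * exp (- m z / 2))"
          unfolding x dB \<phi>B by (simp add: mult_ac)
        also have "\<eta> powr (- (real (card I) / 2)) * \<eta> powr (c - 2) = \<eta> powr (\<nu> / 2 - 1)"
          by (simp add: powr_add[symmetric] \<nu>2)
        also have "\<phi> z * exp (- m z / 2) = sqrt (2 * pi) ^ card I * mvnormal_density 0 (mat 1) z"
          unfolding \<phi>_def m_def by (rule std_normal_density_prod_compl)
        also have "exp (1 / 2) * \<eta> powr (\<nu> / 2 - 1) * exp (- \<eta> / 2) * (sqrt (2 * pi) ^ card I * mvnormal_density 0 (mat 1) z)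
          = K * chi_square_density \<nu> \<eta> * mvnormal_density 0 (mat 1) z"
          using \<eta> G by (simp add: K_def chi_square_density_def)
        finally have "ennreal (det B) * ennreal (\<phi> (B *v z) * (\<eta> powr (c - 2) * exp ((1 - \<eta> * (1 + m (B *v z))) / 2)))
          = ennreal (K * chi_square_density \<nu> \<eta>) * ennreal (mvnormal_density 0 (mat 1) z)"
          by (simp add: ennreal_mult'[symmetric] ennreal_mult''[symmetric] dB mvnormal_density_std_nonneg)
        then show "ennreal \<bar>det B\<bar> * g (B *v z) \<eta> = ennreal (K * chi_square_density \<nu> \<eta>) *
          (ennreal (mvnormal_density 0 (mat 1) z) * H (\<eta> *\<^sub>R ?e + sqrt \<eta> *\<^sub>R vec_mask I z))"
          using \<eta> by (simp add: g_def v mult.assoc[symmetric] dB)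
      qed
      also have "\<dots> = ennreal (K * chi_square_density \<nu> \<eta>) * (\<integral>\<^sup>+z. H (\<eta> *\<^sub>R ?e + sqrt \<eta> *\<^sub>R vec_mask I z) \<partial>std_mvnormal)"
        by (subst nn_integral_cmult) (simp_all add: nn_integral_std_mvnormal)
      finally show ?thesis using K0 by (simp add: ennreal_mult' mult.assoc)
    qed
  qed
  also have "\<dots> = ennreal K * (\<integral>\<^sup>+\<eta>. \<integral>\<^sup>+z. H (\<eta> *\<^sub>R ?e + sqrt \<eta> *\<^sub>R vec_mask I z) \<partial>std_mvnormal \<partial>chi_square \<nu>)"
  proof -
    interpret sigma_finite_measure "std_mvnormal :: (real^'k) measure"
      using prob_space_std_mvnormal by (rule prob_space_imp_sigma_finite)
    show ?thesis by (subst nn_integral_cmult) (simp_all add: nn_integral_chi_square)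
  qed
  finally show ?thesis unfolding K_def .
qed

lemma iw_mass_insert:
  fixes I :: "'k::finite set"
  assumes i: "i \<notin> I" and c: "c > real (card I) + 1"
  shows "(\<integral>\<^sup>+f. ennreal (iw_kernel c (sym_of (insert i I) f)) \<partial>sym_PiM (insert i I))
    = (\<integral>\<^sup>+g. ennreal (iw_kernel (c - 1) (sym_of I g)) \<partial>sym_PiM I) * schur_integral I i c (\<lambda>_. 1)"
    and "schur_integral I i c (\<lambda>_. 1) \<noteq> 0" "schur_integral I i c (\<lambda>_. 1) \<noteq> \<infinity>"
proof -
  show "(\<integral>\<^sup>+f. ennreal (iw_kernel c (sym_of (insert i I) f)) \<partial>sym_PiM (insert i I))
    = (\<integral>\<^sup>+g. ennreal (iw_kernel (c - 1) (sym_of I g)) \<partial>sym_PiM I) * schur_integral I i c (\<lambda>_. 1)"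
    using nn_integral_iw_kernel_insert[OF i, of "\<lambda>_. 1" c] by simp
  define \<nu> where "\<nu> = 2 * c - real (card I) - 2"
  have \<nu>: "\<nu> > 0" using c by (simp add: \<nu>_def)
  have "Gamma (\<nu> / 2) > 0" using \<nu> by (simp add: Gamma_real_pos)
  moreover have "schur_integral I i c (\<lambda>_. 1) = ennreal (exp (1 / 2) * sqrt (2 * pi) ^ card I * (2 powr (\<nu> / 2) * Gamma (\<nu> / 2)))"
    using schur_integral_eq[OF \<nu>_def[symmetric] \<nu>, of "\<lambda>_. 1" i]
      prob_space.emeasure_space_1[OF prob_space_chi_square[OF \<nu>]]
      prob_space.emeasure_space_1[OF prob_space_std_mvnormal[where 'n='k]]
    by simp
  ultimately show "schur_integral I i c (\<lambda>_. 1) \<noteq> 0" "schur_integral I i c (\<lambda>_. 1) \<noteq> \<infinity>"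
    by (auto simp: ennreal_eq_0_iff not_le mult_le_0_iff)
qed

text \<open>
  Splitting off an index lowers both \<open>c\<close> and the number of indices by one, so the condition is preserved.
  At the end of the recursion stands the single matrix \<open>1\<close>.
\<close>

lemma iw_mass_finite:
  fixes I :: "'k::finite set"
  assumes "c > real (card I)"
  shows "(\<integral>\<^sup>+f. ennreal (iw_kernel c (sym_of I f)) \<partial>sym_PiM I) \<noteq> 0 \<and>
    (\<integral>\<^sup>+f. ennreal (iw_kernel c (sym_of I f)) \<partial>sym_PiM I) \<noteq> \<infinity>"
  using assms
proof (induction I arbitrary: c rule: finite_induct[OF finite])
  case 1
  have e: "sym_of {} f = (mat 1 :: real^'k^'k)" for f by (simp add: sym_of_def mat_def)
  have "posdef (mat 1 :: real^'k^'k)" by (simp add: posdef_def)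
  then have "iw_kernel c (mat 1 :: real^'k^'k) > 0" by (simp add: iw_kernel_def)
  moreover have "index_pairs {} = ({} :: 'k set set)" by (simp add: index_pairs_def)
  ultimately show ?case by (simp add: e PiM_empty nn_integral_count_space_finite)
next
  case (2 i I)
  then have c: "c > real (card I) + 1" by simp
  then have "c - 1 > real (card I)" by simp
  from 2(3)[OF this] iw_mass_insert[OF 2(2) c] show ?case
    by (auto simp: ennreal_mult_eq_top_iff)
qed


abbreviation iw_mass :: "'k::finite itself \<Rightarrow> real \<Rightarrow> ennreal" where
  "iw_mass _ c \<equiv> (\<integral>\<^sup>+\<Sigma>. ennreal (iw_kernel c (\<Sigma> :: real^'k::finite^'k)) \<partial>sym_lborel)"

lemma iw_mass_nonzero_finite:
  assumes "c > real CARD('k)"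
  shows "iw_mass TYPE('k::finite) c \<noteq> 0" "iw_mass TYPE('k) c \<noteq> \<infinity>"
  using iw_mass_finite[of "UNIV :: 'k set" c] assms by (simp_all add: nn_integral_sym_lborel)

text \<open>
  The mass of the smaller matrices is not known explicitly. It cancels against the same expression for
  the constant function one, which is the total mass.
\<close>

lemma nn_integral_iw_kernel_axis:
  fixes i :: "'k::finite" and H :: "real^'k \<Rightarrow> ennreal"
  assumes c: "c > real CARD('k)" and [measurable]: "H \<in> borel_measurable borel"
    and \<nu>: "\<nu> = 2 * c - real CARD('k) - 1"
  shows "(\<integral>\<^sup>+\<Sigma>. ennreal (iw_kernel c \<Sigma>) * H (matrix_inv \<Sigma> *v axis i 1) \<partial>sym_lborel)
    = iw_mass TYPE('k) c *
      (\<integral>\<^sup>+\<eta>. \<integral>\<^sup>+z. H (\<eta> *\<^sub>R axis i 1 + sqrt \<eta> *\<^sub>R vec_mask (-{i}) z) \<partial>std_mvnormal \<partial>chi_square \<nu>)"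
proof -
  let ?I = "-{i}"
  have ins: "insert i ?I = UNIV" by auto
  have cd: "card ?I = CARD('k) - 1" by (simp add: Compl_eq_Diff_UNIV card_Diff_singleton)
  have k1: "CARD('k) \<ge> 1" by (simp add: Suc_leI)
  then have k1': "real CARD('k) \<ge> 1" by linarith
  have \<nu>': "2 * c - real (card ?I) - 2 = \<nu>" using k1 by (simp add: \<nu> cd of_nat_diff)
  have \<nu>0: "\<nu> > 0" unfolding \<nu> using c k1' by linarith
  define K where "K = ennreal (exp (1 / 2) * sqrt (2 * pi) ^ card ?I * (2 powr (\<nu> / 2) * Gamma (\<nu> / 2)))"
  have eq: "(\<integral>\<^sup>+\<Sigma>. ennreal (iw_kernel c \<Sigma>) * H (matrix_inv \<Sigma> *v axis i 1) \<partial>sym_lborel)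
    = (\<integral>\<^sup>+g. ennreal (iw_kernel (c - 1) (sym_of ?I g)) \<partial>sym_PiM ?I) * (K *
      (\<integral>\<^sup>+\<eta>. \<integral>\<^sup>+z. H (\<eta> *\<^sub>R axis i 1 + sqrt \<eta> *\<^sub>R vec_mask (-{i}) z) \<partial>std_mvnormal \<partial>chi_square \<nu>))"
    if [measurable]: "H \<in> borel_measurable borel" for H :: "real^'k \<Rightarrow> ennreal"
    using nn_integral_iw_kernel_insert[of i ?I H c] schur_integral_eq[OF \<nu>' \<nu>0, of H i]
    by (simp add: nn_integral_sym_lborel ins K_def)
  have "iw_mass TYPE('k) c = (\<integral>\<^sup>+g. ennreal (iw_kernel (c - 1) (sym_of ?I g)) \<partial>sym_PiM ?I) * K"
    using eq[of "\<lambda>_. 1"] prob_space.emeasure_space_1[OF prob_space_chi_square[OF \<nu>0]]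
      prob_space.emeasure_space_1[OF prob_space_std_mvnormal[where 'n='k]]
    by simp
  then show ?thesis by (simp add: eq mult.assoc)
qed

lemma sets_posdef_lborel [simp, measurable_cong]: "sets posdef_lborel = sets borel"
  and space_posdef_lborel [simp]: "space posdef_lborel = UNIV"
  by (simp_all add: posdef_lborel_def)

lemma nn_integral_posdef_lborel:
  fixes F :: "real^'k^'k \<Rightarrow> ennreal"
  assumes [measurable]: "F \<in> borel_measurable borel"
  shows "(\<integral>\<^sup>+\<Sigma>. F \<Sigma> \<partial>posdef_lborel) = (\<integral>\<^sup>+\<Sigma>. indicator {\<Sigma>. posdef \<Sigma>} \<Sigma> * F \<Sigma> \<partial>sym_lborel)"
  unfolding posdef_lborel_def by (rule nn_integral_density) measurable

lemma measurable_inverse_wishart_kernel [measurable (raw)]: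
  assumes [measurable]: "S \<in> borel_measurable M" "f \<in> borel_measurable M"
  shows "(\<lambda>x. inverse_wishart_kernel d (S x) (f x)) \<in> borel_measurable M"
  unfolding inverse_wishart_kernel_def by measurable

lemma posdef_congruence_iff:
  fixes A :: "real^'k^'k"
  assumes A: "det A \<noteq> 0"
  shows "posdef (A ** \<Sigma> ** transpose A) \<longleftrightarrow> posdef \<Sigma>"
proof
  assume "posdef \<Sigma>"
  then have "posdef (transpose (transpose A) ** \<Sigma> ** transpose A)"
    by (rule posdef_congruence) (simp add: A det_transpose)
  then show "posdef (A ** \<Sigma> ** transpose A)" by simp
next
  assume p: "posdef (A ** \<Sigma> ** transpose A)"
  have "posdef (transpose (transpose (matrix_inv A)) ** (A ** \<Sigma> ** transpose A) ** transpose (matrix_inv A))"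
    using p by (rule posdef_congruence) (simp add: A det_transpose det_matrix_inv)
  moreover have "transpose (transpose (matrix_inv A)) ** (A ** \<Sigma> ** transpose A) ** transpose (matrix_inv A)
    = (matrix_inv A ** A) ** \<Sigma> ** transpose (matrix_inv A ** A)"
    unfolding matrix_transpose_mul transpose_transpose by (simp only: matrix_mul_assoc)
  ultimately show "posdef \<Sigma>" by (simp add: matrix_inv_mult_self A)
qed

lemma matrix_inv_congruence:
  fixes A :: "real^'k^'k"
  assumes A: "det A \<noteq> 0" and \<Sigma>: "det \<Sigma> \<noteq> 0"
  shows "matrix_inv (A ** \<Sigma> ** transpose A) = transpose (matrix_inv A) ** matrix_inv \<Sigma> ** matrix_inv A"
  using assms by (simp add: matrix_inv_mult det_mul det_transpose matrix_inv_transpose matrix_mul_assoc)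

text \<open>
  The substitution \<open>\<Sigma> \<mapsto> A \<Sigma> A\<^sup>T\<close> turns the scale matrix \<open>A A\<^sup>T\<close> into the identity. The Jacobian and the
  determinant of the kernel combine to the power \<open>- \<nu> / 2\<close> of \<open>det (A A\<^sup>T)\<close>.
\<close>

lemma nn_integral_inverse_wishart_factored:
  fixes A :: "real^'k^'k" and H :: "real^'k \<Rightarrow> ennreal"
  assumes A: "det A \<noteq> 0" and c: "c > real CARD('k)" and H [measurable]: "H \<in> borel_measurable borel"
    and \<nu>: "\<nu> = 2 * c - real CARD('k) - 1"
  shows "(\<integral>\<^sup>+\<Sigma>. ennreal (inverse_wishart_kernel (2 * c) (A ** transpose A) \<Sigma>) *
      H (matrix_inv \<Sigma> *v (A *v axis i 1)) \<partial>posdef_lborel)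
    = ennreal (det (A ** transpose A) powr (- \<nu> / 2)) * (iw_mass TYPE('k) c *
      (\<integral>\<^sup>+\<eta>. \<integral>\<^sup>+z. H (transpose (matrix_inv A) *v (\<eta> *\<^sub>R axis i 1 + sqrt \<eta> *\<^sub>R vec_mask (-{i}) z))
        \<partial>std_mvnormal \<partial>chi_square \<nu>))"
proof -
  let ?S = "A ** transpose A" and ?At = "transpose (matrix_inv A)"
  define G where "G \<Sigma> = indicator {\<Sigma>. posdef \<Sigma>} \<Sigma> *
     (ennreal (inverse_wishart_kernel (2 * c) ?S \<Sigma>) * H (matrix_inv \<Sigma> *v (A *v axis i 1)))" for \<Sigma>
  have [measurable]: "G \<in> borel_measurable borel" unfolding G_def by measurable
  have dS: "det ?S = \<bar>det A\<bar> powr 2"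
    using A by (simp add: det_mul det_transpose power2_eq_square)
  have G: "G (A ** \<Sigma> ** transpose A) = ennreal (det ?S powr (- c)) * (ennreal (iw_kernel c \<Sigma>) * H (?At *v (matrix_inv \<Sigma> *v axis i 1)))" for \<Sigma>
  proof (cases "posdef \<Sigma>")
    case False
    then show ?thesis by (simp add: G_def iw_kernel_def posdef_congruence_iff[OF A])
  next
    case True
    then have d: "det \<Sigma> > 0" by (rule posdef_det_pos)
    then have inv: "matrix_inv (A ** \<Sigma> ** transpose A) = ?At ** matrix_inv \<Sigma> ** matrix_inv A"
      using A by (simp add: matrix_inv_congruence)
    have "?S ** (?At ** matrix_inv \<Sigma> ** matrix_inv A) = A ** (transpose (matrix_inv A ** A) ** (matrix_inv \<Sigma> ** matrix_inv A))"
      by (simp only: matrix_transpose_mul matrix_mul_assoc)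
    then have "trace (?S ** (?At ** matrix_inv \<Sigma> ** matrix_inv A)) = trace (A ** (matrix_inv \<Sigma> ** matrix_inv A))"
      by (simp add: matrix_inv_mult_self A)
    also have "\<dots> = trace (matrix_inv \<Sigma> ** (matrix_inv A ** A))"
      by (subst trace_mul_sym) (simp only: matrix_mul_assoc)
    finally have tr: "trace (?S ** (?At ** matrix_inv \<Sigma> ** matrix_inv A)) = trace (matrix_inv \<Sigma>)"
      by (simp add: matrix_inv_mult_self A)
    have "det (A ** \<Sigma> ** transpose A) = det ?S * det \<Sigma>" by (simp add: det_mul)
    moreover have "det ?S \<ge> 0" unfolding dS by simp
    ultimately have ker: "inverse_wishart_kernel (2 * c) ?S (A ** \<Sigma> ** transpose A) = det ?S powr (- c) * iw_kernel c \<Sigma>"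
      using d True by (simp add: inverse_wishart_kernel_def inv tr iw_kernel_def powr_mult)
    have "matrix_inv (A ** \<Sigma> ** transpose A) *v (A *v axis i 1) = ?At *v (matrix_inv \<Sigma> *v axis i 1)"
      by (simp add: inv matrix_vector_mul_assoc[symmetric] matrix_inv_cancel[OF A])
    then show ?thesis using True
      by (simp add: G_def posdef_congruence_iff[OF A] ker ennreal_mult' mult.assoc)
  qed
  have "(\<integral>\<^sup>+\<Sigma>. G \<Sigma> \<partial>sym_lborel) = ennreal (\<bar>det A\<bar> ^ (CARD('k) + 1)) * (\<integral>\<^sup>+\<Sigma>. G (A ** \<Sigma> ** transpose A) \<partial>sym_lborel)"
    by (rule nn_integral_sym_lborel_congruence[OF A]) measurable
  also have "(\<integral>\<^sup>+\<Sigma>. G (A ** \<Sigma> ** transpose A) \<partial>sym_lborel) = ennreal (det ?S powr (- c)) *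
      (\<integral>\<^sup>+\<Sigma>. ennreal (iw_kernel c \<Sigma>) * H (?At *v (matrix_inv \<Sigma> *v axis i 1)) \<partial>sym_lborel)"
    unfolding G by (rule nn_integral_cmult) measurable
  also have "(\<integral>\<^sup>+\<Sigma>. ennreal (iw_kernel c \<Sigma>) * H (?At *v (matrix_inv \<Sigma> *v axis i 1)) \<partial>sym_lborel)
    = iw_mass TYPE('k) c * (\<integral>\<^sup>+\<eta>. \<integral>\<^sup>+z. H (?At *v (\<eta> *\<^sub>R axis i 1 + sqrt \<eta> *\<^sub>R vec_mask (-{i}) z)) \<partial>std_mvnormal \<partial>chi_square \<nu>)"
    using nn_integral_iw_kernel_axis[OF c _ \<nu>, of "\<lambda>v. H (?At *v v)" i] by simp
  also have "ennreal (\<bar>det A\<bar> ^ (CARD('k) + 1)) * (ennreal (det ?S powr (- c)) * X) = ennreal (det ?S powr (- \<nu> / 2)) * X" for X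
  proof -
    have "\<bar>det A\<bar> ^ (CARD('k) + 1) = \<bar>det A\<bar> powr real (CARD('k) + 1)"
      using A by (subst powr_realpow) auto
    then have "\<bar>det A\<bar> ^ (CARD('k) + 1) * det ?S powr (- c) = \<bar>det A\<bar> powr (real (CARD('k) + 1) + 2 * (- c))"
      unfolding dS by (simp only: powr_powr powr_add)
    also have "real (CARD('k) + 1) + 2 * (- c) = 2 * (- \<nu> / 2)" by (simp add: \<nu>)
    also have "\<bar>det A\<bar> powr (2 * (- \<nu> / 2)) = det ?S powr (- \<nu> / 2)"
      unfolding dS by (simp only: powr_powr)
    finally have "\<bar>det A\<bar> ^ (CARD('k) + 1) * det ?S powr (- c) = det ?S powr (- \<nu> / 2)" .
    then show ?thesis by (simp add: mult.assoc[symmetric] ennreal_mult'[symmetric])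
  qed
  finally show ?thesis
    by (subst nn_integral_posdef_lborel) (simp_all add: G_def)
qed

text \<open>
  Here the normal vector \<open>z\<close> of dimension \<open>k\<close> is replaced by one of dimension \<open>p\<close>. It enters through
  \<open>Q = \<rho> L A\<^sup>-\<^sup>T P\<close>, where \<open>P\<close> projects along the axis \<open>i\<close> and \<open>m = \<rho> A e\<^sub>i\<close>, and \<open>Q Q\<^sup>T\<close> is the argument of
  the square root in \<^const>\<open>weights_rep\<close>.
\<close>

lemma nn_integral_inverse_wishart:
  fixes S :: "real^'k^'k" and L :: "real^'k^'p" and H :: "real^'p \<Rightarrow> ennreal"
  assumes S: "posdef S" and c: "c > real CARD('k)" and R: "matrix_square_root R"
    and H [measurable]: "H \<in> borel_measurable borel"
    and \<nu>: "\<nu> = 2 * c - real CARD('k) - 1"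
  shows "(\<integral>\<^sup>+\<Sigma>. ennreal (inverse_wishart_kernel (2 * c) S \<Sigma>) *
      H (L *v (C *\<^sub>R (matrix_inv \<Sigma> *v m))) \<partial>posdef_lborel)
    = ennreal (det S powr (- \<nu> / 2)) * (iw_mass TYPE('k) c *
      (\<integral>\<^sup>+\<eta>. \<integral>\<^sup>+z. H (weights_rep R C L (matrix_inv S) m \<eta> z) \<partial>std_mvnormal \<partial>chi_square \<nu>))"
proof -
  fix i :: 'k
  obtain A \<rho> where A: "det A \<noteq> 0" "S = A ** transpose A" "m = A *v (\<rho> *\<^sub>R axis i 1)"
    using posdef_factor[OF S] .
  define At where "At = transpose (matrix_inv A)"
  define e :: "real^'k" where "e = axis i 1"
  define P where "P = mat 1 - outer e e"
  define V where "V = matrix_inv S"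
  define Q where "Q = \<rho> *\<^sub>R (L ** At ** P)"
  define M where "M = (m \<bullet> (V *v m)) *\<^sub>R (L ** V ** transpose L) - L ** V ** outer m m ** V ** transpose L"
  have m: "m = \<rho> *\<^sub>R (A *v e)" using A(3) by (simp add: e_def matrix_vector_mult_scaleR)
  have V: "V = At ** matrix_inv A"
    using A(1) unfolding V_def A(2) by (simp add: matrix_inv_mult det_transpose matrix_inv_transpose At_def)
  have tAt: "transpose At = matrix_inv A" by (simp add: At_def)
  have tV: "transpose V = V" unfolding V by (simp add: matrix_transpose_mul tAt) (simp add: At_def)
  have Vm: "V *v m = \<rho> *\<^sub>R (At *v e)"
    unfolding V m by (simp add: matrix_vector_mul_assoc[symmetric] matrix_vector_mult_scaleR matrix_inv_cancel[OF A(1)])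
  have mVm: "m \<bullet> (V *v m) = \<rho>\<^sup>2"
  proof -
    have "m \<bullet> (V *v m) = \<rho>\<^sup>2 * ((A *v e) \<bullet> (At *v e))"
      unfolding Vm by (simp add: m power2_eq_square)
    also have "(A *v e) \<bullet> (At *v e) = e \<bullet> e"
      by (simp add: inner_matrix_vector_mul tAt matrix_inv_cancel[OF A(1)])
    finally show ?thesis by (simp add: e_def inner_axis)
  qed
  have ee: "e \<bullet> e = 1" by (simp add: e_def inner_axis)
  have Pz: "vec_mask (-{i}) z = P *v z" for z
    by (auto simp: P_def vec_eq_iff vec_mask_nth matrix_vector_mult_diff_rdistrib outer_mult_vec e_def inner_axis')
      (auto simp: axis_def)
  have tP: "transpose P = P"
    by (auto simp: P_def vec_eq_iff transpose_def mat_def outer_def)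
  have PP: "P ** transpose P = P"
  proof -
    have "P *v (transpose P *v v) = P *v v" for v
      unfolding tP by (simp add: P_def matrix_vector_mult_diff_rdistrib outer_mult_vec
          inner_diff_right ee)
    then show ?thesis by (simp add: matrix_eq matrix_vector_mul_assoc)
  qed
  have QQ: "Q ** transpose Q = M"
  proof -
    have "Q ** transpose Q = \<rho>\<^sup>2 *\<^sub>R (L ** At ** (P ** transpose P) ** matrix_inv A ** transpose L)"
      unfolding Q_def by (simp add: transpose_scaleR matrix_transpose_mul tAt matrix_mul_assoc
          matrix_scalar_ac scalar_matrix_assoc[symmetric] power2_eq_square)
    also have "L ** At ** (P ** transpose P) ** matrix_inv A ** transpose L
       = L ** V ** transpose L - outer (L *v (At *v e)) (L *v (At *v e))"
    proof -
      have "(L ** At ** P ** matrix_inv A ** transpose L) *v v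
         = (L ** V ** transpose L - outer (L *v (At *v e)) (L *v (At *v e))) *v v" for v
        by (simp add: P_def V matrix_vector_mul_assoc[symmetric] matrix_vector_mult_diff_rdistrib
            matrix_vector_mult_diff_distrib outer_mult_vec matrix_vector_mult_scaleR
            inner_matrix_vector_mul[of e] inner_matrix_vector_mul[of "transpose (matrix_inv A) *v e"] At_def)
      then show ?thesis unfolding PP by (simp add: matrix_eq)
    qed
    finally have "Q ** transpose Q = \<rho>\<^sup>2 *\<^sub>R (L ** V ** transpose L) - \<rho>\<^sup>2 *\<^sub>R outer (L *v (At *v e)) (L *v (At *v e))"
      by (simp add: scaleR_diff_right)
    also have "\<rho>\<^sup>2 *\<^sub>R outer (L *v (At *v e)) (L *v (At *v e)) = L ** V ** outer m m ** V ** transpose L"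
    proof -
      have "L ** V ** outer m m ** V ** transpose L = outer (L *v (V *v m)) (L *v (V *v m))"
        by (simp add: mult_outer outer_mult tV matrix_vector_mul_assoc[symmetric])
      then show ?thesis unfolding Vm
        by (simp add: matrix_vector_mult_scaleR outer_scaleR_left outer_scaleR_right power2_eq_square)
    qed
    finally show ?thesis unfolding M_def mVm .
  qed
  have "possemidef M"
    unfolding possemidef_def QQ[symmetric]
    by (auto simp: matrix_transpose_mul matrix_vector_mul_assoc[symmetric] inner_matrix_vector_mul[of _ Q])
  then have RM: "R M ** transpose (R M) = M" using R by (simp add: matrix_square_root_def)
  \<comment> \<open>The projected \<open>k\<close>-dimensional noise may be replaced by the \<open>p\<close>-dimensional one.\<close>
  have swap: "(\<integral>\<^sup>+z. H (b + q *\<^sub>R (Q *v z)) \<partial>std_mvnormal) = (\<integral>\<^sup>+z. H (b + q *\<^sub>R (R M *v z)) \<partial>std_mvnormal)" for b q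
  proof -
    have "(\<integral>\<^sup>+z. H (b + q *\<^sub>R (Q *v z)) \<partial>std_mvnormal) = (\<integral>\<^sup>+y. H (b + q *\<^sub>R y) \<partial>distr std_mvnormal borel ((*v) Q))"
      by (subst nn_integral_distr) simp_all
    also have "distr std_mvnormal borel ((*v) Q) = distr std_mvnormal borel ((*v) (R M))"
      by (rule distr_std_mvnormal_matrix_cong) (simp add: QQ RM)
    also have "(\<integral>\<^sup>+y. H (b + q *\<^sub>R y) \<partial>distr std_mvnormal borel ((*v) (R M))) = (\<integral>\<^sup>+z. H (b + q *\<^sub>R (R M *v z)) \<partial>std_mvnormal)"
      by (subst nn_integral_distr) simp_all
    finally show ?thesis .
  qed
  define H' where "H' v = H ((C * \<rho>) *\<^sub>R (L *v v))" for v
  have [measurable]: "H' \<in> borel_measurable borel" unfolding H'_def by measurable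
  have "(\<integral>\<^sup>+\<Sigma>. ennreal (inverse_wishart_kernel (2 * c) S \<Sigma>) * H (L *v (C *\<^sub>R (matrix_inv \<Sigma> *v m))) \<partial>posdef_lborel)
    = (\<integral>\<^sup>+\<Sigma>. ennreal (inverse_wishart_kernel (2 * c) (A ** transpose A) \<Sigma>) * H' (matrix_inv \<Sigma> *v (A *v axis i 1)) \<partial>posdef_lborel)"
    unfolding H'_def m e_def A(2) by (simp add: matrix_vector_mult_scaleR)
  also have "\<dots> = ennreal (det S powr (- \<nu> / 2)) * (iw_mass TYPE('k) c *
      (\<integral>\<^sup>+\<eta>. \<integral>\<^sup>+z. H' (At *v (\<eta> *\<^sub>R axis i 1 + sqrt \<eta> *\<^sub>R vec_mask (-{i}) z)) \<partial>std_mvnormal \<partial>chi_square \<nu>))"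
    unfolding A(2) At_def by (rule nn_integral_inverse_wishart_factored[OF A(1) c _ \<nu>]) measurable
  also have "(\<integral>\<^sup>+\<eta>. \<integral>\<^sup>+z. H' (At *v (\<eta> *\<^sub>R axis i 1 + sqrt \<eta> *\<^sub>R vec_mask (-{i}) z)) \<partial>std_mvnormal \<partial>chi_square \<nu>)
    = (\<integral>\<^sup>+\<eta>. \<integral>\<^sup>+z. H (weights_rep R C L V m \<eta> z) \<partial>std_mvnormal \<partial>chi_square \<nu>)"
  proof (intro nn_integral_cong)
    fix \<eta> :: real
    have "H' (At *v (\<eta> *\<^sub>R axis i 1 + sqrt \<eta> *\<^sub>R vec_mask (-{i}) z))
      = H ((C * \<eta>) *\<^sub>R (L *v (V *v m)) + (C * sqrt \<eta>) *\<^sub>R (Q *v z))" for z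
    proof -
      have "(C * \<rho>) *\<^sub>R (L *v (At *v (\<eta> *\<^sub>R e + sqrt \<eta> *\<^sub>R (P *v z))))
        = (C * \<eta>) *\<^sub>R (L *v (V *v m)) + (C * sqrt \<eta>) *\<^sub>R (Q *v z)"
        unfolding Vm Q_def
        by (simp add: matrix_vector_right_distrib matrix_vector_mult_scaleR scaleR_add_right
            scaleR_matrix_vector_assoc[symmetric] matrix_vector_mul_assoc[symmetric] mult_ac)
      then show ?thesis by (simp add: H'_def Pz e_def)
    qed
    then show "(\<integral>\<^sup>+z. H' (At *v (\<eta> *\<^sub>R axis i 1 + sqrt \<eta> *\<^sub>R vec_mask (-{i}) z)) \<partial>std_mvnormal)
      = (\<integral>\<^sup>+z. H (weights_rep R C L V m \<eta> z) \<partial>std_mvnormal)"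
      by (simp add: swap weights_rep_def M_def)
  qed
  finally show ?thesis unfolding V_def .
qed


section \<open>The multivariate t-distribution\<close>

lemma nn_integral_lborel_shift:
  fixes F :: "real^'k \<Rightarrow> ennreal"
  assumes [measurable]: "F \<in> borel_measurable borel"
  shows "(\<integral>\<^sup>+x. F x \<partial>lborel) = (\<integral>\<^sup>+x. F (a + x) \<partial>lborel)"
  by (subst lborel_distr_plus[of a, symmetric], subst nn_integral_distr) simp_all

lemma measurable_mvt_density [measurable]: "mvt_density d a A \<in> borel_measurable borel"
  unfolding mvt_density_def[abs_def] by measurable

lemma sets_mvt [simp, measurable_cong]: "sets (mvt d a A) = sets borel"
  and space_mvt [simp]: "space (mvt d a A) = UNIV"
  by (simp_all add: mvt_def)

lemma posdef_quadratic_nonneg: "posdef A \<Longrightarrow> v \<bullet> (A *v v) \<ge> 0"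
  by (cases "v = 0") (auto simp: posdef_def less_imp_le)

text \<open>
  The t-density is a mixture of normal densities: \<open>(1 + q / d) powr (- (d + k) / 2)\<close> is a Gamma integral
  over a rate \<open>t\<close>, and for fixed \<open>t\<close> the integrand is Gaussian in \<open>x\<close>. Integrating \<open>x\<close> out first leaves a
  Gamma integral.
\<close>

lemma prob_space_mvt:
  fixes A :: "real^'k^'k"
  assumes A: "posdef A" and d: "d > 0"
  shows "prob_space (mvt d a A)"
proof
  fix i :: 'k
  let ?k = "real CARD('k)"
  define s where "s = (d + ?k) / 2"
  have s: "s > 0" using d by (simp add: s_def add_pos_nonneg)
  obtain B \<rho> where B: "det B \<noteq> 0" "A = B ** transpose B" "(0::real^'k) = B *v (\<rho> *\<^sub>R axis i 1)"
    using posdef_factor[OF A] .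
  define q where "q x = (x - a) \<bullet> (matrix_inv A *v (x - a))" for x
  have q0: "q x \<ge> 0" for x
    unfolding q_def by (intro posdef_quadratic_nonneg posdef_matrix_inv A)
  have [measurable]: "q \<in> borel_measurable borel" unfolding q_def by measurable
  have qB: "q (a + c *\<^sub>R (B *v z)) = c\<^sup>2 * (z \<bullet> z)" for c z
    using B(1) by (simp add: q_def B(2) matrix_inv_mult det_transpose matrix_inv_transpose
      matrix_vector_mult_scaleR matrix_vector_mul_assoc[symmetric] matrix_inv_cancel inner_matrix_vector_mul
      power2_eq_square)
  have G: "Gamma s > 0" "Gamma (d / 2) > 0" using s d by (simp_all add: Gamma_real_pos)
  define N where "N = Gamma (d / 2) * (d * pi) powr (?k / 2) * sqrt (det A)"
  have dA: "det A > 0" using A by (rule posdef_det_pos)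
  have N: "N > 0" using G d dA by (simp add: N_def)
  have sq: "sqrt (det A) = \<bar>det B\<bar>" by (simp add: B(2) det_mul det_transpose real_sqrt_mult_self)
  define g where "g x t = ennreal (t powr (s - 1) * exp (- ((1 + q x / d) * t))) * indicator {0<..} t" for x t
  have [measurable]: "(\<lambda>(x, t). g x t) \<in> borel_measurable (lborel \<Otimes>\<^sub>M lborel)"
    unfolding g_def by measurable
  have "(\<integral>\<^sup>+x. ennreal (Gamma s * (1 + q x / d) powr (- s)) \<partial>lborel) = (\<integral>\<^sup>+x. \<integral>\<^sup>+t. g x t \<partial>lborel \<partial>lborel)"
    unfolding g_def
    by (intro nn_integral_cong nn_integral_gamma_scaled[symmetric] s) (use q0 d in \<open>simp add: add_pos_nonneg\<close>)
  also have "\<dots> = (\<integral>\<^sup>+t. \<integral>\<^sup>+x. g x t \<partial>lborel \<partial>lborel)"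
    by (rule pair_sigma_finite.Fubini'[symmetric]) (auto intro!: pair_sigma_finite.intro lborel.sigma_finite_measure_axioms)
  also have "\<dots> = (\<integral>\<^sup>+t. ennreal (\<bar>det B\<bar> * (d * pi) powr (?k / 2)) * (ennreal (t powr (d / 2 - 1) * exp (- (1 * t))) * indicator {0<..} t) \<partial>lborel)"
  proof (intro nn_integral_cong)
    fix t :: real
    show "(\<integral>\<^sup>+x. g x t \<partial>lborel) = ennreal (\<bar>det B\<bar> * (d * pi) powr (?k / 2)) * (ennreal (t powr (d / 2 - 1) * exp (- (1 * t))) * indicator {0<..} t)"
    proof (cases "t > 0")
      case False
      then show ?thesis by (simp add: g_def)
    next
      case t: True
      \<comment> \<open>With this scale the exponent \<open>t q / d\<close> becomes \<open>z \<bullet> z / 2\<close>.\<close>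
      define c where "c = sqrt (d / (2 * t))"
      have c: "c > 0" "c\<^sup>2 = d / (2 * t)" using t d by (simp_all add: c_def)
      have detcB: "\<bar>det (c *\<^sub>R B)\<bar> = c ^ CARD('k) * \<bar>det B\<bar>"
        using c by (simp add: det_scaleR abs_mult)
      have [measurable]: "(\<lambda>x. g x t) \<in> borel_measurable borel" unfolding g_def by measurable
      have "(\<integral>\<^sup>+x. g x t \<partial>lborel) = (\<integral>\<^sup>+x. g (a + x) t \<partial>lborel)"
        by (rule nn_integral_lborel_shift) measurable
      also have "\<dots> = ennreal \<bar>det (c *\<^sub>R B)\<bar> * (\<integral>\<^sup>+z. g (a + c *\<^sub>R B *v z) t \<partial>lborel)"
        by (rule nn_integral_lborel_matrix) (use B(1) c in \<open>auto simp: det_scaleR\<close>)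
      also have "(\<integral>\<^sup>+z. g (a + c *\<^sub>R B *v z) t \<partial>lborel)
        = (\<integral>\<^sup>+z. ennreal (t powr (s - 1) * exp (- t) * sqrt (2 * pi) ^ CARD('k)) * ennreal (mvnormal_density 0 (mat 1) (z :: real^'k)) \<partial>lborel)"
      proof (intro nn_integral_cong)
        fix z :: "real^'k"
        have "(1 + q (a + c *\<^sub>R B *v z) / d) * t = t + (z \<bullet> z) / 2"
          using t d by (simp add: qB c scaleR_matrix_vector_assoc[symmetric] field_simps)
        then have "exp (- ((1 + q (a + c *\<^sub>R B *v z) / d) * t)) = exp (- t) * exp (- (z \<bullet> z) / 2)"
          by (simp add: exp_add[symmetric])
        moreover have "exp (- (z \<bullet> z) / 2) = sqrt (2 * pi) ^ CARD('k) * mvnormal_density 0 (mat 1) z"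
          using std_normal_density_prod_compl[where I = UNIV and z = z] by (simp add: vec_mask_def)
        ultimately show "g (a + c *\<^sub>R B *v z) t = ennreal (t powr (s - 1) * exp (- t) * sqrt (2 * pi) ^ CARD('k)) * ennreal (mvnormal_density 0 (mat 1) z)"
          using t by (simp add: g_def ennreal_mult''[symmetric] mvnormal_density_std_nonneg mult.assoc)
      qed
      also have "\<dots> = ennreal (t powr (s - 1) * exp (- t) * sqrt (2 * pi) ^ CARD('k))"
        using nn_integral_std_mvnormal[of "\<lambda>_ :: real^'k. 1"] prob_space.emeasure_space_1[OF prob_space_std_mvnormal[where 'n='k]]
        by (subst nn_integral_cmult) simp_all
      also have "ennreal \<bar>det (c *\<^sub>R B)\<bar> * \<dots> = ennreal (\<bar>det B\<bar> * (d * pi) powr (?k / 2) * (t powr (d / 2 - 1) * exp (- t)))"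
      proof -
        have "c * sqrt (2 * pi) = (d * pi / t) powr (1 / 2)"
          using t d by (simp add: c_def real_sqrt_mult[symmetric] powr_half_sqrt)
        then have "(c * sqrt (2 * pi)) ^ CARD('k) = (d * pi / t) powr (?k / 2)"
          using t d by (simp add: powr_power)
        also have "\<dots> = (d * pi) powr (?k / 2) * t powr (- (?k / 2))"
          using t d by (simp add: powr_divide powr_minus field_simps)
        finally have c': "(c * sqrt (2 * pi)) ^ CARD('k) = (d * pi) powr (?k / 2) * t powr (- (?k / 2))" .
        have "\<bar>det (c *\<^sub>R B)\<bar> * (t powr (s - 1) * exp (- t) * sqrt (2 * pi) ^ CARD('k))
          = \<bar>det B\<bar> * (c * sqrt (2 * pi)) ^ CARD('k) * (t powr (s - 1) * exp (- t))"
          unfolding detcB power_mult_distrib by (simp only: mult_ac)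
        also have "\<dots> = \<bar>det B\<bar> * (d * pi) powr (?k / 2) * ((t powr (- (?k / 2)) * t powr (s - 1)) * exp (- t))"
          unfolding c' by (simp only: mult_ac)
        also have "t powr (- (?k / 2)) * t powr (s - 1) = t powr (d / 2 - 1)"
          unfolding powr_add[symmetric] by (rule arg_cong[where f = "(powr) t"]) (simp add: s_def field_simps)
        finally show ?thesis by (simp add: ennreal_mult''[symmetric])
      qed
      finally show ?thesis using t by (simp add: ennreal_mult''[symmetric])
    qed
  qed
  also have "\<dots> = ennreal (\<bar>det B\<bar> * (d * pi) powr (?k / 2)) * ennreal (Gamma (d / 2) * 1 powr (- (d / 2)))"
    using nn_integral_gamma_scaled[of "d / 2" 1] d by (subst nn_integral_cmult) simp_all
  also have "\<dots> = ennreal N" using G by (simp add: N_def ennreal_mult''[symmetric] sq mult_ac)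
  finally have main: "(\<integral>\<^sup>+x. ennreal (Gamma s * (1 + q x / d) powr (- s)) \<partial>lborel) = ennreal N" .
  have dens: "mvt_density d a A x = (1 / N) * (Gamma s * (1 + q x / d) powr (- s))" for x
  proof -
    have "- (d + ?k) / 2 = - s" by (simp add: s_def field_simps)
    then show ?thesis unfolding mvt_density_def q_def[symmetric] by (simp add: N_def s_def[symmetric])
  qed
  have "emeasure (mvt d a A) (space (mvt d a A)) = (\<integral>\<^sup>+x. ennreal (mvt_density d a A x) \<partial>lborel)"
    by (simp add: mvt_def emeasure_density)
  also have "\<dots> = (\<integral>\<^sup>+x. ennreal (1 / N) * ennreal (Gamma s * (1 + q x / d) powr (- s)) \<partial>lborel)"
    unfolding dens using N by (intro nn_integral_cong ennreal_mult') simp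
  also have "\<dots> = ennreal (1 / N) * ennreal N"
    by (subst nn_integral_cmult) (simp_all add: main)
  also have "\<dots> = 1" using N by (simp add: ennreal_mult''[symmetric])
  finally show "emeasure (mvt d a A) (space (mvt d a A)) = 1" .
qed


section \<open>Posteriors with an inverse Wishart kernel\<close>

lemma sigma_finite_sym_lborel: "sigma_finite_measure (sym_lborel :: (real^'k^'k) measure)"
proof
  let ?A = "\<lambda>n::nat. {\<Sigma> :: real^'k^'k. \<forall>i j. \<bar>\<Sigma> $ i $ j\<bar> \<le> real n}"
  have meas: "?A n \<in> sets borel" for n by measurable
  have fin: "emeasure sym_lborel (?A n) \<noteq> \<infinity>" for n
  proof -
    have "emeasure sym_lborel (?A n) = emeasure (sym_PiM (UNIV :: 'k set)) (sym_of UNIV -` ?A n \<inter> space (sym_PiM UNIV))"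
      unfolding sym_lborel_eq by (rule emeasure_distr) (use meas in auto)
    also have "\<dots> \<le> emeasure (sym_PiM (UNIV :: 'k set)) (\<Pi>\<^sub>E s\<in>index_pairs UNIV. {- real n..real n})"
    proof (rule emeasure_mono)
      show "sym_of UNIV -` ?A n \<inter> space (sym_PiM (UNIV :: 'k set)) \<subseteq> (\<Pi>\<^sub>E s\<in>index_pairs UNIV. {- real n..real n})"
      proof
        fix f assume f: "f \<in> sym_of UNIV -` ?A n \<inter> space (sym_PiM (UNIV :: 'k set))"
        then have "\<bar>f {i, j}\<bar> \<le> real n" for i j by (auto simp: sym_of_def)
        then have "f s \<in> {- real n..real n}" if "s \<in> index_pairs UNIV" for s
          using that by (auto simp: index_pairs_def abs_le_iff) (metis minus_le_iff)
        then show "f \<in> (\<Pi>\<^sub>E s\<in>index_pairs UNIV. {- real n..real n})"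
          using f by (auto simp: space_PiM PiE_def)
      qed
      show "(\<Pi>\<^sub>E s\<in>index_pairs (UNIV :: 'k set). {- real n..real n}) \<in> sets (sym_PiM UNIV)"
        by (rule sets_PiM_I_finite) simp_all
    qed
    also have "\<dots> = (\<Prod>s\<in>index_pairs (UNIV :: 'k set). ennreal (2 * real n))"
      by (subst lborel_prod.emeasure_PiM) simp_all
    also have "\<dots> < \<infinity>" by (simp add: ennreal_power)
    finally show ?thesis by simp
  qed
  have cover: "(\<Union>n. ?A n) = UNIV"
  proof (intro set_eqI iffI UNIV_I UN_iff[THEN iffD2])
    fix \<Sigma> :: "real^'k^'k"
    obtain n where "norm \<Sigma> < real n" using reals_Archimedean2 by blast
    moreover have "\<bar>\<Sigma> $ i $ j\<bar> \<le> norm \<Sigma>" for i j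
      using order_trans[OF component_le_norm_cart[of "\<Sigma> $ i" j] Finite_Cartesian_Product.norm_nth_le[of \<Sigma> i]] .
    ultimately have "\<Sigma> \<in> ?A n" by (auto intro: order_trans[OF _ less_imp_le])
    then show "\<exists>n\<in>UNIV. \<Sigma> \<in> ?A n" by blast
  qed
  show "\<exists>A. countable A \<and> A \<subseteq> sets (sym_lborel :: (real^'k^'k) measure) \<and> \<Union> A = space sym_lborel \<and> (\<forall>a\<in>A. emeasure sym_lborel a \<noteq> \<infinity>)"
    using meas fin cover by (intro exI[of _ "range ?A"]) auto
qed

lemma sigma_finite_posdef_lborel: "sigma_finite_measure (posdef_lborel :: (real^'k^'k) measure)"
proof -
  interpret sigma_finite_measure "sym_lborel :: (real^'k^'k) measure" by (rule sigma_finite_sym_lborel)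
  show ?thesis unfolding posdef_lborel_def
    by (subst sigma_finite_iff_density_finite) (auto simp: indicator_def)
qed

lemma AE_posdef_lborel: "AE \<Sigma> in posdef_lborel. posdef \<Sigma>"
  unfolding posdef_lborel_def by (subst AE_density) (auto simp: indicator_def)

text \<open>
  The constant of proportionality, which involves the unknown mass of the kernel, cancels when the
  posterior is normalized: the unnormalized posterior is \<open>Z\<close> times a law whose components are
  probability measures.
\<close>

lemma posterior_representation:
  fixes L :: "real^'k^'p" and S :: "real^'k^'k" and prior :: "real^'k \<Rightarrow> real^'k^'k \<Rightarrow> real"
    and a :: "real^'k" and \<rho> \<nu> \<kappa> C r :: real and n :: nat and t :: int and x :: "int \<Rightarrow> real^'k"
  defines "Sstar \<mu> \<equiv> S + \<rho> *\<^sub>R outer (\<mu> - a) (\<mu> - a)"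
    and "tdist \<equiv> mvt (\<nu> - real CARD('k)) a ((1 / (\<rho> * (\<nu> - real CARD('k)))) *\<^sub>R S)"
    and "post \<equiv> posterior prior n t x"
  assumes kernel: "\<And>\<mu> \<Sigma>. posdef \<Sigma> \<Longrightarrow>
      likelihood n t x \<mu> \<Sigma> * prior \<mu> \<Sigma> = \<kappa> * inverse_wishart_kernel (\<nu> + real CARD('k) + 1) (Sstar \<mu>) \<Sigma>"
    and meas: "(\<lambda>(\<mu>, \<Sigma>). likelihood n t x \<mu> \<Sigma> * prior \<mu> \<Sigma>) \<in> borel_measurable (borel \<Otimes>\<^sub>M borel)"
    and \<kappa>: "\<kappa> > 0" and S: "posdef S" and \<rho>: "\<rho> > 0" and \<nu>: "\<nu> > real CARD('k)"
    and R: "matrix_square_root R"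
  shows "prob_space post" and "distr post borel fst = tdist"
    and "distr post borel (\<lambda>(\<mu>, \<Sigma>). L *v weights C r \<mu> \<Sigma>) =
      distr (chi_square \<nu> \<Otimes>\<^sub>M mvnormal 0 (mat 1) \<Otimes>\<^sub>M tdist) borel
        (\<lambda>(\<eta>, z, \<mu>). weights_rep R C L (matrix_inv (Sstar \<mu>)) (\<mu> - r *\<^sub>R 1) \<eta> z)"
proof -
  let ?k = "real CARD('k)"
    and ?w = "\<lambda>\<mu>. weights_rep R C L (matrix_inv (Sstar \<mu>)) (\<mu> - r *\<^sub>R 1)"
  define d where "d = \<nu> - ?k"
  have d: "d > 0" using \<nu> by (simp add: d_def)
  have \<nu>0: "\<nu> > 0" using \<nu> by (rule le_less_trans[rotated]) simp
  define U where "U = unnormalized_posterior prior n t x"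
  define c where "c = (\<nu> + ?k + 1) / 2"
  have c: "c > ?k" "\<nu> = 2 * c - ?k - 1" using \<nu> by (simp_all add: c_def field_simps)
  have c2: "2 * c = \<nu> + ?k + 1" by (simp add: c_def)
  define q where "q \<mu> = (\<mu> - a) \<bullet> (matrix_inv S *v (\<mu> - a))" for \<mu>
  have q0: "q \<mu> \<ge> 0" for \<mu> unfolding q_def by (intro posdef_quadratic_nonneg posdef_matrix_inv S)
  have Sstar: "posdef (Sstar \<mu>)" for \<mu>
    unfolding Sstar_def using S \<rho> by (intro posdef_add_outer) auto
  have det_Sstar: "det (Sstar \<mu>) = det S * (1 + \<rho> * q \<mu>)" for \<mu>
    unfolding Sstar_def q_def by (rule det_add_outer[OF S])
  have dS: "det S > 0" using S by (rule posdef_det_pos)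
  let ?A = "(1 / (\<rho> * d)) *\<^sub>R S"
  have A: "posdef ?A" using S \<rho> d by (intro posdef_scaleR) auto
  define N where "N = Gamma (\<nu> / 2) / (Gamma (d / 2) * (d * pi) powr (?k / 2) * sqrt (det ?A))"
  have N: "N > 0" unfolding N_def using \<nu>0 d posdef_det_pos[OF A]
    by (intro divide_pos_pos mult_pos_pos Gamma_real_pos) auto
  have mvt: "mvt_density d a ?A \<mu> = N * (1 + \<rho> * q \<mu>) powr (- \<nu> / 2)" for \<mu>
  proof -
    have "matrix_inv ?A = (\<rho> * d) *\<^sub>R matrix_inv S"
      using matrix_inv_scaleR[of S "1 / (\<rho> * d)"] \<rho> d dS by simp
    then have "(\<mu> - a) \<bullet> (matrix_inv ?A *v (\<mu> - a)) / d = \<rho> * q \<mu>"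
      using d by (simp add: q_def scaleR_matrix_vector_assoc[symmetric])
    moreover have "d + ?k = \<nu>" by (simp add: d_def)
    ultimately show ?thesis by (simp only: mvt_density_def N_def)
  qed
  have tdist: "tdist = mvt d a ?A" by (simp add: tdist_def d_def)
  have [measurable_cong, simp]: "sets tdist = sets borel" and [simp]: "space tdist = UNIV" by (simp_all add: tdist)
  define Z where "Z = ennreal (\<kappa> * det S powr (- \<nu> / 2) / N) * iw_mass TYPE('k) c"
  have Z: "Z \<noteq> 0" "Z \<noteq> \<infinity>"
    using iw_mass_nonzero_finite[OF c(1)] \<kappa> dS N by (auto simp: Z_def ennreal_mult_eq_top_iff)
  interpret P: sigma_finite_measure "posdef_lborel :: (real^'k^'k) measure" by (rule sigma_finite_posdef_lborel)
  interpret T: prob_space tdist unfolding tdist using A d by (rule prob_space_mvt)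
  interpret X: prob_space "chi_square \<nu>" using \<nu>0 by (rule prob_space_chi_square)
  interpret G: prob_space "std_mvnormal :: (real^'p) measure" by (rule prob_space_std_mvnormal)
  have R' [measurable]: "R \<in> borel_measurable borel" using R by (simp add: matrix_square_root_def)
  have lp [measurable]: "(\<lambda>(\<mu>, \<Sigma>). likelihood n t x \<mu> \<Sigma> * prior \<mu> \<Sigma>) \<in> borel_measurable (lborel \<Otimes>\<^sub>M posdef_lborel)"
    using meas by (simp cong: measurable_cong_sets add: sets_pair_measure_cong[of lborel borel posdef_lborel borel])
  have rep [measurable]: "(\<lambda>(\<eta>, z, \<mu>). ?w \<mu> \<eta> z)
      \<in> borel_measurable (borel \<Otimes>\<^sub>M borel \<Otimes>\<^sub>M borel)"
    unfolding weights_rep_def Sstar_def by measurable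
  have rep3 [measurable]: "(\<lambda>w. weights_rep R C L (matrix_inv (Sstar (h w))) (h w - r *\<^sub>R 1) (f w) (g w)) \<in> borel_measurable M"
    if "f \<in> borel_measurable M" "g \<in> borel_measurable M" "h \<in> borel_measurable M" for f g h and M :: "'w measure"
    using measurable_compose[OF measurable_Pair[OF that(1) measurable_Pair[OF that(2,3)]] rep] by simp
  have setsU: "sets U = sets (borel \<Otimes>\<^sub>M borel)"
    by (simp add: U_def unnormalized_posterior_def cong: sets_pair_measure_cong)
  have spaceU: "space U = UNIV"
    by (simp add: U_def unnormalized_posterior_def space_pair_measure)
  have wm [measurable]: "(\<lambda>(\<mu>, \<Sigma>). L *v weights C r \<mu> \<Sigma>) \<in> borel_measurable (borel \<Otimes>\<^sub>M borel)"
    unfolding weights_def by measurable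
  have main: "(\<integral>\<^sup>+p. H (fst p) (L *v weights C r (fst p) (snd p)) \<partial>U) = Z *
      (\<integral>\<^sup>+\<mu>. \<integral>\<^sup>+\<eta>. \<integral>\<^sup>+z. H \<mu> (?w \<mu> \<eta> z)
        \<partial>std_mvnormal \<partial>chi_square \<nu> \<partial>tdist)"
    if H [measurable]: "case_prod H \<in> borel_measurable (borel \<Otimes>\<^sub>M borel)" for H :: "real^'k \<Rightarrow> real^'p \<Rightarrow> ennreal"
  proof -
    have Hm [measurable]: "(\<lambda>w. H (f w) (g w)) \<in> borel_measurable M"
      if "f \<in> borel_measurable M" "g \<in> borel_measurable M" for f g and M :: "'w measure"
      using measurable_compose[OF measurable_Pair[OF that] H] by simp
    have wm' [measurable]: "(\<lambda>p. H (fst p) (L *v weights C r (fst p) (snd p))) \<in> borel_measurable (lborel \<Otimes>\<^sub>M posdef_lborel)"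
      unfolding weights_def by measurable
    have "(\<integral>\<^sup>+p. H (fst p) (L *v weights C r (fst p) (snd p)) \<partial>U)
      = (\<integral>\<^sup>+p. ennreal (likelihood n t x (fst p) (snd p) * prior (fst p) (snd p)) * H (fst p) (L *v weights C r (fst p) (snd p)) \<partial>(lborel \<Otimes>\<^sub>M posdef_lborel))"
      unfolding U_def unnormalized_posterior_def
      using lp by (subst nn_integral_density) (simp_all add: case_prod_beta')
    also have "\<dots> = (\<integral>\<^sup>+\<mu>. \<integral>\<^sup>+\<Sigma>. ennreal (likelihood n t x \<mu> \<Sigma> * prior \<mu> \<Sigma>) * H \<mu> (L *v weights C r \<mu> \<Sigma>) \<partial>posdef_lborel \<partial>lborel)"
      using lp by (subst P.nn_integral_fst[symmetric]) (simp_all add: case_prod_beta')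
    also have "\<dots> = (\<integral>\<^sup>+\<mu>. Z * (ennreal (mvt_density d a ?A \<mu>) *
        (\<integral>\<^sup>+\<eta>. \<integral>\<^sup>+z. H \<mu> (?w \<mu> \<eta> z) \<partial>std_mvnormal \<partial>chi_square \<nu>)) \<partial>lborel)"
    proof (intro nn_integral_cong)
      fix \<mu> :: "real^'k"
      let ?I = "(\<integral>\<^sup>+\<eta>. \<integral>\<^sup>+z. H \<mu> (?w \<mu> \<eta> z) \<partial>std_mvnormal \<partial>chi_square \<nu>)"
      have "(\<integral>\<^sup>+\<Sigma>. ennreal (likelihood n t x \<mu> \<Sigma> * prior \<mu> \<Sigma>) * H \<mu> (L *v weights C r \<mu> \<Sigma>) \<partial>posdef_lborel)
        = (\<integral>\<^sup>+\<Sigma>. ennreal \<kappa> * (ennreal (inverse_wishart_kernel (2 * c) (Sstar \<mu>) \<Sigma>) *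
            H \<mu> (L *v (C *\<^sub>R (matrix_inv \<Sigma> *v (\<mu> - r *\<^sub>R 1))))) \<partial>posdef_lborel)"
      proof (rule nn_integral_cong_AE, rule AE_mp[OF AE_posdef_lborel], intro AE_I2 impI)
        fix \<Sigma> :: "real^'k^'k" assume "posdef \<Sigma>"
        from kernel[OF this, of \<mu>] show "ennreal (likelihood n t x \<mu> \<Sigma> * prior \<mu> \<Sigma>) * H \<mu> (L *v weights C r \<mu> \<Sigma>)
          = ennreal \<kappa> * (ennreal (inverse_wishart_kernel (2 * c) (Sstar \<mu>) \<Sigma>) *
            H \<mu> (L *v (C *\<^sub>R (matrix_inv \<Sigma> *v (\<mu> - r *\<^sub>R 1)))))"
          using \<kappa> unfolding c2 by (simp add: weights_def ennreal_mult' mult.assoc)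
      qed
      also have "\<dots> = ennreal \<kappa> * (\<integral>\<^sup>+\<Sigma>. ennreal (inverse_wishart_kernel (2 * c) (Sstar \<mu>) \<Sigma>) *
            H \<mu> (L *v (C *\<^sub>R (matrix_inv \<Sigma> *v (\<mu> - r *\<^sub>R 1)))) \<partial>posdef_lborel)"
        by (rule nn_integral_cmult) measurable
      also have "\<dots> = ennreal \<kappa> * (ennreal (det (Sstar \<mu>) powr (- \<nu> / 2)) * (iw_mass TYPE('k) c * ?I))"
        by (subst nn_integral_inverse_wishart[OF Sstar c(1) R _ c(2)]) simp_all
      also have "\<dots> = ennreal (\<kappa> * det (Sstar \<mu>) powr (- \<nu> / 2)) * (iw_mass TYPE('k) c * ?I)"
        using \<kappa> by (simp add: ennreal_mult' mult.assoc)
      also have "\<kappa> * det (Sstar \<mu>) powr (- \<nu> / 2) = (\<kappa> * det S powr (- \<nu> / 2) / N) * mvt_density d a ?A \<mu>"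
        unfolding mvt det_Sstar using N dS \<rho> q0[of \<mu>] by (simp add: powr_mult)
      also have "ennreal \<dots> = ennreal (\<kappa> * det S powr (- \<nu> / 2) / N) * ennreal (mvt_density d a ?A \<mu>)"
        using \<kappa> N by (intro ennreal_mult') simp
      finally show "(\<integral>\<^sup>+\<Sigma>. ennreal (likelihood n t x \<mu> \<Sigma> * prior \<mu> \<Sigma>) * H \<mu> (L *v weights C r \<mu> \<Sigma>) \<partial>posdef_lborel)
        = Z * (ennreal (mvt_density d a ?A \<mu>) * ?I)"
        by (simp add: Z_def mult_ac)
    qed
    also have "\<dots> = Z * (\<integral>\<^sup>+\<mu>. \<integral>\<^sup>+\<eta>. \<integral>\<^sup>+z. H \<mu> (?w \<mu> \<eta> z)
        \<partial>std_mvnormal \<partial>chi_square \<nu> \<partial>tdist)"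
      unfolding tdist mvt_def by (subst nn_integral_cmult, measurable, subst nn_integral_density) measurable
    finally show ?thesis .
  qed
  have Umass: "emeasure U (space U) = Z"
    using main[of "\<lambda>_ _. 1"] X.emeasure_space_1 G.emeasure_space_1 T.emeasure_space_1 by simp
  show "prob_space post"
    unfolding post_def posterior_def U_def[symmetric] using Z Umass
    by (intro prob_space_uniform_measure) simp_all
  have cancel: "Z * y / Z = y" for y :: ennreal
    using Z by (subst mult.commute) (simp add: ennreal_mult_divide_eq)
  have law: "emeasure (distr post borel f) B = (\<integral>\<^sup>+p. indicator B (f p) \<partial>U) / Z"
    if f: "f \<in> borel_measurable (borel \<Otimes>\<^sub>M borel)" and B: "B \<in> sets borel" for f :: "_ \<Rightarrow> 'y::topological_space" and B
  proof -
    have fU: "f \<in> borel_measurable U" using f by (simp cong: measurable_cong_sets add: setsU)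
    then have fB: "f -` B \<inter> space U \<in> sets U" using B by (rule measurable_sets)
    have fp: "f \<in> borel_measurable post"
      using fU by (simp add: post_def posterior_def U_def[symmetric] cong: measurable_cong_sets)
    have sp: "space post = space U" by (simp add: post_def posterior_def U_def)
    have "emeasure (distr post borel f) B = emeasure post (f -` B \<inter> space U)"
      using fp B by (simp add: emeasure_distr sp)
    also have "\<dots> = emeasure U (space U \<inter> (f -` B \<inter> space U)) / emeasure U (space U)"
      unfolding post_def posterior_def U_def[symmetric] using fB by (intro emeasure_uniform_measure) auto
    also have "space U \<inter> (f -` B \<inter> space U) = f -` B \<inter> space U" by auto
    also have "emeasure U (f -` B \<inter> space U) = (\<integral>\<^sup>+p. indicator (f -` B \<inter> space U) p \<partial>U)"
      using fB by simp
    also have "\<dots> = (\<integral>\<^sup>+p. indicator B (f p) \<partial>U)"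
      by (intro nn_integral_cong) (simp add: indicator_def)
    finally show ?thesis by (simp add: Umass)
  qed
  show "distr post borel fst = tdist"
  proof (rule measure_eqI)
    fix B :: "(real^'k) set" assume "B \<in> sets (distr post borel fst)"
    then have B [measurable]: "B \<in> sets borel" by simp
    show "emeasure (distr post borel fst) B = emeasure tdist B"
      using main[of "\<lambda>\<mu> _. indicator B \<mu>"] X.emeasure_space_1 G.emeasure_space_1
      by (simp add: law cancel)
  qed simp
  show "distr post borel (\<lambda>(\<mu>, \<Sigma>). L *v weights C r \<mu> \<Sigma>) =
      distr (chi_square \<nu> \<Otimes>\<^sub>M mvnormal 0 (mat 1) \<Otimes>\<^sub>M tdist) borel
        (\<lambda>(\<eta>, z, \<mu>). ?w \<mu> \<eta> z)" (is "_ = distr ?M borel ?f")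
  proof (rule measure_eqI)
    fix B :: "(real^'p) set" assume "B \<in> sets (distr post borel (\<lambda>(\<mu>, \<Sigma>). L *v weights C r \<mu> \<Sigma>))"
    then have B [measurable]: "B \<in> sets borel" by simp
    let ?h = "\<lambda>\<eta> z \<mu>. indicator B (?w \<mu> \<eta> z) :: ennreal"
    interpret TG: pair_sigma_finite "std_mvnormal :: (real^'p) measure" tdist ..
    interpret XT: pair_sigma_finite "chi_square \<nu>" tdist ..
    have GT: "sigma_finite_measure ((std_mvnormal :: (real^'p) measure) \<Otimes>\<^sub>M tdist)"
      by (intro sigma_finite_pair_measure G.sigma_finite_measure_axioms T.sigma_finite_measure_axioms)
    have fM [measurable]: "?f \<in> borel_measurable ?M" by measurable
    have "emeasure (distr post borel (\<lambda>(\<mu>, \<Sigma>). L *v weights C r \<mu> \<Sigma>)) B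
      = (\<integral>\<^sup>+\<mu>. \<integral>\<^sup>+\<eta>. \<integral>\<^sup>+z. ?h \<eta> z \<mu> \<partial>std_mvnormal \<partial>chi_square \<nu> \<partial>tdist)"
      using main[of "\<lambda>_. indicator B"] by (simp add: law cancel case_prod_beta')
    also have "\<dots> = (\<integral>\<^sup>+\<eta>. \<integral>\<^sup>+\<mu>. \<integral>\<^sup>+z. ?h \<eta> z \<mu> \<partial>std_mvnormal \<partial>tdist \<partial>chi_square \<nu>)"
      by (rule XT.Fubini') measurable
    also have "\<dots> = (\<integral>\<^sup>+\<eta>. \<integral>\<^sup>+z. \<integral>\<^sup>+\<mu>. ?h \<eta> z \<mu> \<partial>tdist \<partial>std_mvnormal \<partial>chi_square \<nu>)"
      by (intro nn_integral_cong TG.Fubini') measurable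
    also have "\<dots> = (\<integral>\<^sup>+\<eta>. \<integral>\<^sup>+p. ?h \<eta> (fst p) (snd p) \<partial>(std_mvnormal \<Otimes>\<^sub>M tdist) \<partial>chi_square \<nu>)"
      by (intro nn_integral_cong, subst T.nn_integral_fst[symmetric]) simp_all
    also have "\<dots> = (\<integral>\<^sup>+p. ?h (fst p) (fst (snd p)) (snd (snd p)) \<partial>?M)"
      by (subst sigma_finite_measure.nn_integral_fst[OF GT, symmetric]) simp_all
    also have "\<dots> = emeasure (distr ?M borel ?f) B"
    proof -
      have "emeasure (distr ?M borel ?f) B = (\<integral>\<^sup>+y. indicator B y \<partial>distr ?M borel ?f)" by simp
      also have "\<dots> = (\<integral>\<^sup>+p. indicator B (?f p) \<partial>?M)" by (rule nn_integral_distr) measurable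
      finally show ?thesis by (simp add: case_prod_beta')
    qed
    finally show "emeasure (distr post borel (\<lambda>(\<mu>, \<Sigma>). L *v weights C r \<mu> \<Sigma>)) B = emeasure (distr ?M borel ?f) B" .
  qed simp
qed


section \<open>Likelihood times prior\<close>

lemma obs_times_finite [simp]: "finite (obs_times n t)" and card_obs_times [simp]: "card (obs_times n t) = n"
  by (simp_all add: obs_times_def)

lemma S_d_eq_sum:
  assumes "n > 1"
  shows "S_d n t x = (\<Sum>i\<in>obs_times n t. outer (x i - xbar_d n t x) (x i - xbar_d n t x))"
  using assms by (simp add: S_d_def sample_cov_def xbar_d_def)

lemma sum_centered_eq_0:
  assumes "n > 0"
  shows "(\<Sum>i\<in>obs_times n t. x i - xbar_d n t x) = 0"
proof -
  have "(\<Sum>i\<in>obs_times n t. x i - xbar_d n t x) = (\<Sum>i\<in>obs_times n t. x i) - real n *\<^sub>R xbar_d n t x"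
    by (simp add: sum_subtractf scaleR_conv_of_real sum_constant_scaleR)
  then show ?thesis using assms by (simp add: xbar_d_def sample_mean_def)
qed

lemma trace_rank_one_update:
  "trace ((S + c *\<^sub>R outer v v) ** \<Omega>) = trace (S ** \<Omega>) + c * (v \<bullet> ((\<Omega> :: real^'k^'k) *v v))"
  by (simp add: matrix_add_rdistrib trace_add scalar_matrix_assoc[symmetric] trace_scaleR trace_outer_mult)

text \<open>
  Steiner's identity: the mixed terms vanish because the deviations from the sample mean sum to zero.
\<close>

lemma sum_quadratic_form_eq:
  fixes \<Omega> :: "real^'k^'k"
  assumes n: "n > 1"
  shows "(\<Sum>i\<in>obs_times n t. (x i - \<mu>) \<bullet> (\<Omega> *v (x i - \<mu>)))
    = trace (S_d n t x ** \<Omega>) + real n * ((\<mu> - xbar_d n t x) \<bullet> (\<Omega> *v (\<mu> - xbar_d n t x)))"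
proof -
  let ?O = "obs_times n t"
  define e where "e = \<mu> - xbar_d n t x"
  define y where "y i = x i - xbar_d n t x" for i
  have y0: "(\<Sum>i\<in>?O. y i) = 0" unfolding y_def using n by (intro sum_centered_eq_0) simp
  have "(x i - \<mu>) \<bullet> (\<Omega> *v (x i - \<mu>)) = y i \<bullet> (\<Omega> *v y i) - y i \<bullet> (\<Omega> *v e) - (transpose \<Omega> *v e) \<bullet> y i + e \<bullet> (\<Omega> *v e)" for i
  proof -
    have "x i - \<mu> = y i - e" by (simp add: y_def e_def)
    then show ?thesis
      by (simp add: matrix_vector_mult_diff_distrib inner_diff_left inner_diff_right inner_matrix_vector_mul[of e])
  qed
  then have "(\<Sum>i\<in>?O. (x i - \<mu>) \<bullet> (\<Omega> *v (x i - \<mu>)))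
    = (\<Sum>i\<in>?O. y i \<bullet> (\<Omega> *v y i)) - (\<Sum>i\<in>?O. y i) \<bullet> (\<Omega> *v e) - (transpose \<Omega> *v e) \<bullet> (\<Sum>i\<in>?O. y i) + real n * (e \<bullet> (\<Omega> *v e))"
    by (simp add: sum.distrib sum_subtractf inner_sum_left inner_sum_right)
  moreover have "trace (S_d n t x ** \<Omega>) = (\<Sum>i\<in>?O. y i \<bullet> (\<Omega> *v y i))"
    unfolding S_d_eq_sum[OF n] matrix_mult_sum_left trace_sum trace_outer_mult y_def ..
  ultimately show ?thesis by (simp add: y0 e_def)
qed

lemma likelihood_eq:
  fixes \<Sigma> :: "real^'k^'k"
  assumes n: "n > 1" and \<Sigma>: "posdef \<Sigma>"
  shows "likelihood n t x \<mu> \<Sigma> = ((2 * pi) ^ CARD('k)) powr (- real n / 2) * det \<Sigma> powr (- real n / 2) *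
    exp (- (trace (S_d n t x ** matrix_inv \<Sigma>) + real n * ((\<mu> - xbar_d n t x) \<bullet> (matrix_inv \<Sigma> *v (\<mu> - xbar_d n t x)))) / 2)"
proof -
  let ?q = "\<lambda>i. (x i - \<mu>) \<bullet> (matrix_inv \<Sigma> *v (x i - \<mu>))"
  let ?D = "(2 * pi) ^ CARD('k) * det \<Sigma>"
  have d: "det \<Sigma> > 0" using \<Sigma> by (rule posdef_det_pos)
  then have D: "?D > 0" by simp
  have "likelihood n t x \<mu> \<Sigma> = (\<Prod>i\<in>obs_times n t. exp (- ?q i / 2)) / sqrt ?D ^ n"
    by (simp add: likelihood_def mvnormal_density_def prod_dividef)
  also have "sqrt ?D ^ n = ?D powr (real n / 2)"
  proof -
    have "sqrt z ^ n = z powr (real n / 2)" if "z > 0" for z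
      using that by (simp add: powr_half_sqrt[symmetric] powr_power)
    then show ?thesis using D .
  qed
  also have "(\<Prod>i\<in>obs_times n t. exp (- ?q i / 2)) = exp (- (\<Sum>i\<in>obs_times n t. ?q i) / 2)"
    by (simp add: exp_sum[symmetric] sum_negf sum_divide_distrib)
  also have "exp (- (\<Sum>i\<in>obs_times n t. ?q i) / 2) / ?D powr (real n / 2)
    = ?D powr (- real n / 2) * exp (- (\<Sum>i\<in>obs_times n t. ?q i) / 2)"
  proof -
    have "- real n / 2 = - (real n / 2)" by simp
    then have "?D powr (- real n / 2) = inverse (?D powr (real n / 2))" by (simp only: powr_minus)
    then show ?thesis by (simp only: divide_inverse mult.commute)
  qed
  also have "?D powr (- real n / 2) = ((2 * pi) ^ CARD('k)) powr (- real n / 2) * det \<Sigma> powr (- real n / 2)"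
    using d by (intro powr_mult)
  finally show ?thesis unfolding sum_quadratic_form_eq[OF n] .
qed

lemma likelihood_diffuse_prior:
  fixes \<Sigma> :: "real^'k^'k"
  assumes n: "n > 1" and \<Sigma>: "posdef \<Sigma>"
  shows "likelihood n t x \<mu> \<Sigma> * diffuse_prior \<mu> \<Sigma> = ((2 * pi) ^ CARD('k)) powr (- real n / 2) *
    inverse_wishart_kernel (real n + real CARD('k) + 1)
      (S_d n t x + real n *\<^sub>R outer (\<mu> - xbar_d n t x) (\<mu> - xbar_d n t x)) \<Sigma>"
proof -
  have "det \<Sigma> powr (- real n / 2) * det \<Sigma> powr (- (real CARD('k) + 1) / 2) = det \<Sigma> powr (- (real n + real CARD('k) + 1) / 2)"
    unfolding powr_add[symmetric] by (rule arg_cong[where f = "(powr) (det \<Sigma>)"]) (simp add: field_simps)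
  then show ?thesis
    unfolding likelihood_eq[OF n \<Sigma>] diffuse_prior_def inverse_wishart_kernel_def trace_rank_one_update
    by (simp add: mult_ac)
qed

lemma quadratic_form_combine:
  fixes \<Omega> :: "real^'k^'k" and u v :: "real^'k" and a b :: real
  assumes a: "a > 0" and b: "b > 0"
  defines "c \<equiv> (1 / (a + b)) *\<^sub>R (a *\<^sub>R u + b *\<^sub>R v)"
  shows "a * ((\<mu> - u) \<bullet> (\<Omega> *v (\<mu> - u))) + b * ((\<mu> - v) \<bullet> (\<Omega> *v (\<mu> - v)))
    = (a + b) * ((\<mu> - c) \<bullet> (\<Omega> *v (\<mu> - c))) + (a * b / (a + b)) * ((v - u) \<bullet> (\<Omega> *v (v - u)))"
proof -
  define y where "y = \<mu> - u"
  define w where "w = v - u"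
  define \<theta> where "\<theta> = b / (a + b)"
  have ab: "a + b > 0" using a b by simp
  have "\<mu> - c = y - \<theta> *\<^sub>R w"
  proof -
    have "(a + b) *\<^sub>R c = a *\<^sub>R u + b *\<^sub>R v" "(a + b) * \<theta> = b" using ab by (simp_all add: c_def \<theta>_def)
    then have "(a + b) *\<^sub>R (\<mu> - c) = (a + b) *\<^sub>R \<mu> - (a *\<^sub>R u + b *\<^sub>R v)"
      "(a + b) *\<^sub>R (y - \<theta> *\<^sub>R w) = (a + b) *\<^sub>R (\<mu> - u) - b *\<^sub>R (v - u)"
      by (simp_all only: scaleR_diff_right scaleR_scaleR y_def w_def)
    moreover have "(a + b) *\<^sub>R \<mu> - (a *\<^sub>R u + b *\<^sub>R v) = (a + b) *\<^sub>R (\<mu> - u) - b *\<^sub>R (v - u)"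
      by (simp add: algebra_simps)
    ultimately have "(a + b) *\<^sub>R (\<mu> - c) = (a + b) *\<^sub>R (y - \<theta> *\<^sub>R w)" by simp
    then show ?thesis using ab by simp
  qed
  moreover have "\<mu> - v = y - w" by (simp add: y_def w_def)
  moreover have q: "(y - s *\<^sub>R w) \<bullet> (\<Omega> *v (y - s *\<^sub>R w)) =
      y \<bullet> (\<Omega> *v y) - s * (y \<bullet> (\<Omega> *v w) + w \<bullet> (\<Omega> *v y)) + s\<^sup>2 * (w \<bullet> (\<Omega> *v w))" for s
    by (simp add: matrix_vector_mult_diff_distrib matrix_vector_mult_scaleR inner_diff_left inner_diff_right
        power2_eq_square algebra_simps)
  moreover have "a * Y + b * (Y - 1 * X + 1\<^sup>2 * Wq) = (a + b) * (Y - \<theta> * X + \<theta>\<^sup>2 * Wq) + (a * b / (a + b)) * Wq" for X Y Wq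
  proof -
    have t: "(a + b) * \<theta> = b" using ab by (simp add: \<theta>_def)
    have t2: "(a + b) * \<theta>\<^sup>2 + a * b / (a + b) = b"
    proof -
      have "(a + b) * \<theta>\<^sup>2 = b * \<theta>" using t by (simp add: power2_eq_square mult.assoc[symmetric])
      moreover have "b * \<theta> + a * b / (a + b) = b * (a + b) / (a + b)"
        by (simp add: \<theta>_def distrib_left add_divide_distrib mult.commute)
      moreover have "b * (a + b) / (a + b) = b" using ab by simp
      ultimately show ?thesis by simp
    qed
    have "(a + b) * (Y - \<theta> * X + \<theta>\<^sup>2 * Wq) + (a * b / (a + b)) * Wq
      = (a + b) * Y - ((a + b) * \<theta>) * X + ((a + b) * \<theta>\<^sup>2 + a * b / (a + b)) * Wq"
      by (simp only: distrib_left distrib_right right_diff_distrib left_diff_distrib mult.assoc)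
    also have "\<dots> = (a + b) * Y - b * X + b * Wq" unfolding t t2 ..
    finally show ?thesis by (simp add: algebra_simps)
  qed
  ultimately show ?thesis
    using q[of 1] unfolding y_def[symmetric] w_def[symmetric] by simp
qed

text \<open>
  The exponents \<open>n\<close> of the likelihood, one of the normal prior and \<open>d\<^sub>0\<close> of the inverse Wishart prior add up,
  and completing the square in \<open>\<mu>\<close> merges the two quadratic forms.
\<close>

lemma likelihood_conjugate_prior:
  fixes \<Sigma> S\<^sub>0 :: "real^'k^'k" and r\<^sub>0 d\<^sub>0 :: real
  assumes n: "n > 1" and r0: "r\<^sub>0 > 0" and \<Sigma>: "posdef \<Sigma>"
  defines "I0 \<equiv> (\<integral>\<Omega>. inverse_wishart_kernel d\<^sub>0 S\<^sub>0 \<Omega> \<partial>posdef_lborel)"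
  shows "likelihood n t x \<mu> \<Sigma> * conjugate_prior m\<^sub>0 r\<^sub>0 d\<^sub>0 S\<^sub>0 \<mu> \<Sigma> =
    (((2 * pi) ^ CARD('k)) powr (- real n / 2) * ((2 * pi) ^ CARD('k) * (1 / r\<^sub>0) ^ CARD('k)) powr (- 1 / 2) / I0) *
    inverse_wishart_kernel (real n + d\<^sub>0 + 1)
      (S_c m\<^sub>0 r\<^sub>0 S\<^sub>0 n t x + (real n + r\<^sub>0) *\<^sub>R outer (\<mu> - xbar_c m\<^sub>0 r\<^sub>0 n t x) (\<mu> - xbar_c m\<^sub>0 r\<^sub>0 n t x)) \<Sigma>"
proof -
  let ?\<Omega> = "matrix_inv \<Sigma>" and ?xb = "xbar_d n t x" and ?xc = "xbar_c m\<^sub>0 r\<^sub>0 n t x"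
  let ?k = "CARD('k)"
  have d: "det \<Sigma> > 0" using \<Sigma> by (rule posdef_det_pos)
  define Q where "Q v = v \<bullet> (?\<Omega> *v v)" for v
  have N: "mvnormal_density m\<^sub>0 ((1 / r\<^sub>0) *\<^sub>R \<Sigma>) \<mu> =
     ((2 * pi) ^ ?k * (1 / r\<^sub>0) ^ ?k) powr (- 1 / 2) * det \<Sigma> powr (- 1 / 2) * exp (- (r\<^sub>0 * Q (\<mu> - m\<^sub>0)) / 2)"
  proof -
    have "matrix_inv ((1 / r\<^sub>0) *\<^sub>R \<Sigma>) = r\<^sub>0 *\<^sub>R ?\<Omega>"
      using matrix_inv_scaleR[of \<Sigma> "1 / r\<^sub>0"] d r0 by simp
    then have "mvnormal_density m\<^sub>0 ((1 / r\<^sub>0) *\<^sub>R \<Sigma>) \<mu>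
       = exp (- (r\<^sub>0 * Q (\<mu> - m\<^sub>0)) / 2) / sqrt (((2 * pi) ^ ?k * (1 / r\<^sub>0) ^ ?k) * det \<Sigma>)"
      by (simp only: mvnormal_density_def det_scaleR Q_def scaleR_matrix_vector_assoc[symmetric] inner_scaleR_right mult.assoc)
    also have "sqrt (((2 * pi) ^ ?k * (1 / r\<^sub>0) ^ ?k) * det \<Sigma>) = (((2 * pi) ^ ?k * (1 / r\<^sub>0) ^ ?k) * det \<Sigma>) powr (1 / 2)"
      using d r0 by (intro powr_half_sqrt[symmetric]) simp
    also have "\<dots> = ((2 * pi) ^ ?k * (1 / r\<^sub>0) ^ ?k) powr (1 / 2) * det \<Sigma> powr (1 / 2)"
      using d r0 by (intro powr_mult)
    finally have eq: "mvnormal_density m\<^sub>0 ((1 / r\<^sub>0) *\<^sub>R \<Sigma>) \<mu> = exp (- (r\<^sub>0 * Q (\<mu> - m\<^sub>0)) / 2) /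
      (((2 * pi) ^ ?k * (1 / r\<^sub>0) ^ ?k) powr (1 / 2) * det \<Sigma> powr (1 / 2))" .
    have "(- 1 :: real) / 2 = - (1 / 2)" by simp
    then have "z powr (- 1 / 2) = inverse (z powr (1 / 2))" for z :: real by (simp only: powr_minus)
    then show ?thesis unfolding eq by (simp only: divide_inverse inverse_mult_distrib mult_ac)
  qed
  have pw: "det \<Sigma> powr (- real n / 2) * det \<Sigma> powr (- 1 / 2) * det \<Sigma> powr (- d\<^sub>0 / 2) = det \<Sigma> powr (- (real n + d\<^sub>0 + 1) / 2)"
    unfolding powr_add[symmetric] by (rule arg_cong[where f = "(powr) (det \<Sigma>)"]) (simp add: field_simps)
  have q: "real n * Q (\<mu> - ?xb) + r\<^sub>0 * Q (\<mu> - m\<^sub>0) = (real n + r\<^sub>0) * Q (\<mu> - ?xc) + (real n * r\<^sub>0 / (real n + r\<^sub>0)) * Q (m\<^sub>0 - ?xb)"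
    unfolding Q_def xbar_c_def xbar_d_def[symmetric] using n r0 by (intro quadratic_form_combine) auto
  have tr: "trace (S_c m\<^sub>0 r\<^sub>0 S\<^sub>0 n t x ** ?\<Omega>) = trace (S_d n t x ** ?\<Omega>) + trace (S\<^sub>0 ** ?\<Omega>) + (real n * r\<^sub>0 / (real n + r\<^sub>0)) * Q (m\<^sub>0 - ?xb)"
    unfolding S_c_def trace_rank_one_update Q_def by (simp add: matrix_add_rdistrib trace_add)
  have ex: "exp (- (trace (S_d n t x ** ?\<Omega>) + real n * Q (\<mu> - ?xb)) / 2) * exp (- (r\<^sub>0 * Q (\<mu> - m\<^sub>0)) / 2) * exp (- trace (S\<^sub>0 ** ?\<Omega>) / 2)
    = exp (- (trace (S_c m\<^sub>0 r\<^sub>0 S\<^sub>0 n t x ** ?\<Omega>) + (real n + r\<^sub>0) * Q (\<mu> - ?xc)) / 2)"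
  proof -
    have "- (A + B) / 2 + - D / 2 + - E / 2 = - (A + E + G + F) / 2" if "B + D = F + G" for A B D E F G :: real
      using that by (simp add: field_simps)
    from this[OF q] show ?thesis unfolding exp_add[symmetric] tr by (rule arg_cong[where f = exp])
  qed
  have "likelihood n t x \<mu> \<Sigma> * conjugate_prior m\<^sub>0 r\<^sub>0 d\<^sub>0 S\<^sub>0 \<mu> \<Sigma> =
    (((2 * pi) ^ ?k) powr (- real n / 2) * ((2 * pi) ^ ?k * (1 / r\<^sub>0) ^ ?k) powr (- 1 / 2) / I0) *
    ((det \<Sigma> powr (- real n / 2) * det \<Sigma> powr (- 1 / 2) * det \<Sigma> powr (- d\<^sub>0 / 2)) *
     (exp (- (trace (S_d n t x ** ?\<Omega>) + real n * Q (\<mu> - ?xb)) / 2) * exp (- (r\<^sub>0 * Q (\<mu> - m\<^sub>0)) / 2) * exp (- trace (S\<^sub>0 ** ?\<Omega>) / 2)))"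
    unfolding likelihood_eq[OF n \<Sigma>] conjugate_prior_def N inverse_wishart_density_def I0_def[symmetric]
      inverse_wishart_kernel_def[of d\<^sub>0 S\<^sub>0 \<Sigma>] Q_def[symmetric] times_divide_eq_right times_divide_eq_left
    by (simp only: mult_ac)
  then show ?thesis
    unfolding pw ex unfolding inverse_wishart_kernel_def trace_rank_one_update Q_def .
qed

lemma integral_inverse_wishart_kernel_pos:
  fixes S :: "real^'k^'k"
  assumes S: "posdef S" and d: "d > 2 * real CARD('k)" and R: "matrix_square_root (R :: real^'p^'p \<Rightarrow> real^'p^'p)"
  shows "(\<integral>\<Omega>. inverse_wishart_kernel d S \<Omega> \<partial>posdef_lborel) > 0"
proof -
  define c where "c = d / 2"
  have c: "c > real CARD('k)" "2 * c = d" using d by (simp_all add: c_def)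
  define \<nu> where "\<nu> = 2 * c - real CARD('k) - 1"
  have "real CARD('k) \<ge> 1" using one_le_card_finite[where 'a = 'k] by linarith
  then have \<nu>: "\<nu> > 0" using c(1) unfolding \<nu>_def by linarith
  have nn: "(\<integral>\<^sup>+\<Omega>. ennreal (inverse_wishart_kernel d S \<Omega>) \<partial>posdef_lborel) = ennreal (det S powr (- \<nu> / 2)) * iw_mass TYPE('k) c"
    using nn_integral_inverse_wishart[OF S c(1) R, where H = "\<lambda>_. 1" and L = "0 :: real^'k^'p", OF _ \<nu>_def]
      prob_space.emeasure_space_1[OF prob_space_chi_square[OF \<nu>]]
      prob_space.emeasure_space_1[OF prob_space_std_mvnormal[where 'n='p]]
    by (simp add: c(2))
  then have fin: "(\<integral>\<^sup>+\<Omega>. ennreal (inverse_wishart_kernel d S \<Omega>) \<partial>posdef_lborel) \<noteq> 0"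
    "(\<integral>\<^sup>+\<Omega>. ennreal (inverse_wishart_kernel d S \<Omega>) \<partial>posdef_lborel) \<noteq> \<infinity>"
    using iw_mass_nonzero_finite[OF c(1)] posdef_det_pos[OF S] by (auto simp: ennreal_mult_eq_top_iff)
  have "(\<integral>\<Omega>. inverse_wishart_kernel d S \<Omega> \<partial>posdef_lborel) = enn2real (\<integral>\<^sup>+\<Omega>. ennreal (inverse_wishart_kernel d S \<Omega>) \<partial>posdef_lborel)"
    by (rule integral_eq_nn_integral) (auto simp: inverse_wishart_kernel_def)
  then show ?thesis using fin by (simp add: enn2real_positive_iff less_top zero_less_iff_neq_zero)
qed

section \<open>The scatter matrix is almost surely positive definite\<close>

lemma S_d_symmetric_nonneg:
  assumes n: "n > 1"
  shows "transpose (S_d n t x) = S_d n t x" "v \<bullet> (S_d n t x *v v) = (\<Sum>i\<in>obs_times n t. ((x i - xbar_d n t x) \<bullet> v)\<^sup>2)"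
proof -
  have ts: "transpose (\<Sum>i\<in>I. f i) = (\<Sum>i\<in>I. transpose (f i))" for I and f :: "int \<Rightarrow> real^'a^'a"
    by (simp add: vec_eq_iff transpose_def)
  show "transpose (S_d n t x) = S_d n t x" unfolding S_d_eq_sum[OF n] ts transpose_outer ..
  have ms: "(\<Sum>i\<in>I. f i) *v v = (\<Sum>i\<in>I. f i *v v)" for I and f :: "int \<Rightarrow> real^'a^'a"
    by (induction I rule: infinite_finite_induct) (simp_all add: matrix_vector_mult_add_rdistrib)
  show "v \<bullet> (S_d n t x *v v) = (\<Sum>i\<in>obs_times n t. ((x i - xbar_d n t x) \<bullet> v)\<^sup>2)"
    unfolding S_d_eq_sum[OF n] ms inner_sum_right quadratic_form_outer_self ..
qed

lemma posdef_S_c: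
  assumes n: "n > 1" and r0: "r\<^sub>0 > 0" and S0: "posdef S\<^sub>0"
  shows "posdef (S_c m\<^sub>0 r\<^sub>0 S\<^sub>0 n t x)"
proof -
  have "posdef (S\<^sub>0 + S_d n t x)"
  proof (rule posdef_add[OF S0])
    show "transpose (S_d n t x) = S_d n t x" by (rule S_d_symmetric_nonneg[OF n])
    show "v \<bullet> (S_d n t x *v v) \<ge> 0" for v
      unfolding S_d_symmetric_nonneg[OF n] by (intro sum_nonneg) simp
  qed
  then show ?thesis unfolding S_c_def using r0 by (intro posdef_add_outer) (simp_all add: add.commute)
qed

lemma posdef_S_d:
  fixes x :: "int \<Rightarrow> real^'k"
  assumes n: "n > 1" and \<tau>: "\<tau> \<in> obs_times n t" and \<sigma>: "\<And>p. \<sigma> p \<in> obs_times n t"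
    and det: "det (\<chi> p. x (\<sigma> p) - x \<tau>) \<noteq> 0"
  shows "posdef (S_d n t x)"
  unfolding posdef_def
proof (intro conjI allI impI)
  show "transpose (S_d n t x) = S_d n t x" by (rule S_d_symmetric_nonneg[OF n])
  fix v :: "real^'k" assume v: "v \<noteq> 0"
  have nonneg: "v \<bullet> (S_d n t x *v v) \<ge> 0" unfolding S_d_symmetric_nonneg[OF n] by (intro sum_nonneg) simp
  have "v \<bullet> (S_d n t x *v v) \<noteq> 0"
  proof
    assume "v \<bullet> (S_d n t x *v v) = 0"
    then have z: "(x i - xbar_d n t x) \<bullet> v = 0" if "i \<in> obs_times n t" for i
      using that unfolding S_d_symmetric_nonneg[OF n] by (subst (asm) sum_nonneg_eq_0_iff) auto
    have "(x (\<sigma> p) - x \<tau>) \<bullet> v = 0" for p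
      using z[OF \<sigma>[of p]] z[OF \<tau>] by (simp add: inner_diff_left)
    then have "(\<chi> p. x (\<sigma> p) - x \<tau>) *v v = 0"
      by (simp add: vec_eq_iff matrix_vector_mul_component)
    then show False using matrix_inv_cancel(2)[OF det, of v] v by simp
  qed
  with nonneg show "v \<bullet> (S_d n t x *v v) > 0" by simp
qed

text \<open>
  As a function of one row the determinant is linear, and it is not identically zero by assumption.
  Hence it vanishes on a hyperplane at most.
\<close>

lemma AE_det_replace_row_nonzero:
  fixes R :: "'k::finite \<Rightarrow> real^'k" and b :: "real^'k"
  assumes "det (\<chi> p. if p = j then v else R p) \<noteq> 0"
  shows "AE y in lborel. det (\<chi> p. if p = j then y - b else R p) \<noteq> 0"
proof -
  define g where "g y = det (\<chi> p. if p = j then y else R p)" for y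
  have lin: "linear g"
  proof (rule linearI)
    show "g (u + w) = g u + g w" for u w
      unfolding g_def using det_row_add[of j "\<lambda>_. u" "\<lambda>_. w" R] by simp
    show "g (c *\<^sub>R u) = c *\<^sub>R g u" for c u
    proof -
      have "c *s u = c *\<^sub>R u" by (simp add: vec_eq_iff)
      then show ?thesis unfolding g_def using det_row_mul[of j c "\<lambda>_. u" R] by (simp only: real_scaleR_def)
    qed
  qed
  define \<alpha> :: "real^'k" where "\<alpha> = (\<chi> q. g (axis q 1))"
  have g: "g y = \<alpha> \<bullet> y" for y
  proof -
    have "g y = g (\<Sum>q\<in>UNIV. y $ q *\<^sub>R axis q 1)"
      using basis_expansion[of y] by (simp add: scalar_mult_eq_scaleR)
    also have "\<dots> = (\<Sum>q\<in>UNIV. y $ q * g (axis q 1))"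
      using lin by (simp add: linear_sum linear_scale)
    finally show ?thesis by (simp add: \<alpha>_def inner_vec_def mult.commute)
  qed
  have "\<alpha> \<noteq> 0" using assms g[of v] by (auto simp: g_def)
  then have "negligible {y. \<alpha> \<bullet> y = \<alpha> \<bullet> b}" by (intro negligible_hyperplane) auto
  then have "{y. \<alpha> \<bullet> y = \<alpha> \<bullet> b} \<in> null_sets lborel"
    by (subst (asm) negligible_iff_null_sets, subst (asm) null_sets_completion_iff) simp_all
  then have "AE y in lborel. y \<notin> {y. \<alpha> \<bullet> y = \<alpha> \<bullet> b}" by (rule AE_not_in)
  then show ?thesis by eventually_elim (auto simp: g_def[symmetric] g inner_diff_right)
qed

text \<open>
  The differences of \<open>k + 1\<close> sample points are almost surely linearly independent. The rows of the identity
  are replaced by differences one at a time; each new sample point avoids a null set that depends on the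
  points used before.
\<close>

lemma AE_sample_differences_independent:
  fixes N :: "(real^'k) measure" and \<sigma> :: "'k \<Rightarrow> 'i"
  assumes N: "sigma_finite_measure N" "sets N = sets borel"
    and ac: "\<And>P. (AE y in lborel. P y) \<Longrightarrow> (AE y in N. P y)"
    and \<sigma>: "inj \<sigma>" "\<tau> \<notin> range \<sigma>"
    and T: "finite T" "insert \<tau> (range \<sigma>) \<subseteq> T"
  shows "AE x in (\<Pi>\<^sub>M i\<in>T. N). det (\<chi> p. x (\<sigma> p) - x \<tau>) \<noteq> 0"
proof -
  interpret product_sigma_finite "\<lambda>_. N" using N(1) by (simp add: product_sigma_finite_def)
  define D where "D J x = det (\<chi> p. if p \<in> J then x (\<sigma> p) - x \<tau> else axis p 1)" for J and x :: "'i \<Rightarrow> real^'k"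
  have comp: "(\<lambda>x. x i) \<in> borel_measurable (\<Pi>\<^sub>M i\<in>T. N)" if "i \<in> T" for i T
    using measurable_component_singleton[OF that, of "\<lambda>_. N"] N(2) by (simp cong: measurable_cong_sets)
  have D [measurable]: "D J \<in> borel_measurable (\<Pi>\<^sub>M i\<in>T. N)" if "insert \<tau> (\<sigma> ` J) \<subseteq> T" for J T
    unfolding D_def[abs_def]
  proof (intro borel_measurable_det borel_measurable_vec_lambda)
    show "(\<lambda>x. if p \<in> J then x (\<sigma> p) - x \<tau> else axis p 1) \<in> borel_measurable (\<Pi>\<^sub>M i\<in>T. N)" for p
      using that comp by (cases "p \<in> J") (auto intro!: borel_measurable_diff comp)
  qed
  have "\<forall>T. finite T \<longrightarrow> insert \<tau> (\<sigma> ` J) \<subseteq> T \<longrightarrow> (AE x in (\<Pi>\<^sub>M i\<in>T. N). D J x \<noteq> 0)" for J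
  proof (induction J rule: finite_induct[OF finite])
    case 1
    have "(\<chi> p. axis p 1) = (mat 1 :: real^'k^'k)" by (auto simp: vec_eq_iff mat_def axis_def)
    then show ?case by (simp add: D_def)
  next
    case (2 j J)
    show ?case
    proof (intro allI impI)
      fix T assume T: "finite T" "insert \<tau> (\<sigma> ` insert j J) \<subseteq> T"
      define T0 where "T0 = T - {\<sigma> j}"
      have T0: "T = insert (\<sigma> j) T0" "finite T0" "\<sigma> j \<notin> T0" using T by (auto simp: T0_def)
      have "insert \<tau> (\<sigma> ` J) \<subseteq> T0"
        using T(2) 2(2) \<sigma> by (auto simp: T0_def dest: injD)
      then have IH: "AE x in (\<Pi>\<^sub>M i\<in>T0. N). D J x \<noteq> 0" using 2(3) T0(2) by blast
      have [measurable]: "D (insert j J) \<in> borel_measurable (\<Pi>\<^sub>M i\<in>T. N)" using T(2) by (rule D)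
      let ?b = "\<lambda>x. if D (insert j J) x = 0 then 1 else 0 :: ennreal"
      have "(\<integral>\<^sup>+x. ?b x \<partial>(\<Pi>\<^sub>M i\<in>T. N)) = (\<integral>\<^sup>+x. \<integral>\<^sup>+y. ?b (x(\<sigma> j := y)) \<partial>N \<partial>(\<Pi>\<^sub>M i\<in>T0. N))"
        unfolding T0(1) by (rule product_nn_integral_insert) (use T0 in \<open>simp_all flip: T0(1)\<close>)
      also have "\<dots> = (\<integral>\<^sup>+x. 0 \<partial>(\<Pi>\<^sub>M i\<in>T0. N))"
      proof (rule nn_integral_cong_AE, use IH in eventually_elim)
        fix x assume x: "D J x \<noteq> 0"
        define Q where "Q p = (if p \<in> J then x (\<sigma> p) - x \<tau> else axis p 1)" for p
        have "det (\<chi> p. if p = j then axis j 1 else Q p) \<noteq> 0"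
        proof -
          have "(\<chi> p. if p = j then axis j 1 else Q p) = (\<chi> p. Q p)" using 2(2) by (auto simp: vec_eq_iff Q_def)
          then show ?thesis using x by (simp add: D_def Q_def)
        qed
        then have "AE y in lborel. det (\<chi> p. if p = j then y - x \<tau> else Q p) \<noteq> 0"
          by (rule AE_det_replace_row_nonzero)
        then have "AE y in N. det (\<chi> p. if p = j then y - x \<tau> else Q p) \<noteq> 0" by (rule ac)
        moreover have "D (insert j J) (x(\<sigma> j := y)) = det (\<chi> p. if p = j then y - x \<tau> else Q p)" for y
        proof -
          have "\<sigma> j \<noteq> \<tau>" using \<sigma>(2) by auto
          moreover have "\<sigma> p \<noteq> \<sigma> j" if "p \<noteq> j" for p using \<sigma>(1) that by (auto dest: injD)
          ultimately show ?thesis unfolding D_def Q_def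
            by (intro arg_cong[where f = det]) (auto simp: vec_eq_iff)
        qed
        ultimately have "AE y in N. ?b (x(\<sigma> j := y)) = 0" by simp
        then show "(\<integral>\<^sup>+y. ?b (x(\<sigma> j := y)) \<partial>N) = 0" by (subst nn_integral_cong_AE[where v = "\<lambda>_. 0"]) auto
      qed
      finally have "(\<integral>\<^sup>+x. ?b x \<partial>(\<Pi>\<^sub>M i\<in>T. N)) = 0" by simp
      then have "AE x in (\<Pi>\<^sub>M i\<in>T. N). ?b x = 0" by (subst (asm) nn_integral_0_iff_AE) simp_all
      then show "AE x in (\<Pi>\<^sub>M i\<in>T. N). D (insert j J) x \<noteq> 0" by eventually_elim (auto split: if_splits)
    qed
  qed
  from this[of UNIV] T show ?thesis by (simp add: D_def)
qed

lemma AE_posdef_S_d: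
  fixes \<mu>\<^sub>0 :: "real^'k"
  assumes n: "n > CARD('k)"
  shows "AE x in sampling_law n t \<mu>\<^sub>0 \<Sigma>\<^sub>0. posdef (S_d n t x)"
proof -
  have n1: "n > 1" using n one_le_card_finite[where 'a = 'k] by linarith
  have "obs_times n t \<noteq> {}" using n1 card_obs_times[of n t] by (metis card.empty not_less_zero)
  then obtain \<tau> where \<tau>: "\<tau> \<in> obs_times n t" by blast
  have "card (UNIV :: 'k set) \<le> card (obs_times n t - {\<tau>})" using n \<tau> by simp
  then obtain \<sigma> :: "'k \<Rightarrow> int" where \<sigma>: "inj \<sigma>" "range \<sigma> \<subseteq> obs_times n t - {\<tau>}"
    using card_le_inj[of "UNIV :: 'k set" "obs_times n t - {\<tau>}"] by auto
  have "AE x in (\<Pi>\<^sub>M i\<in>obs_times n t. mvnormal \<mu>\<^sub>0 \<Sigma>\<^sub>0). det (\<chi> p. x (\<sigma> p) - x \<tau>) \<noteq> 0"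
  proof (rule AE_sample_differences_independent)
    show "sigma_finite_measure (mvnormal \<mu>\<^sub>0 \<Sigma>\<^sub>0)"
      unfolding mvnormal_def by (subst sigma_finite_measure.sigma_finite_iff_density_finite[OF lborel.sigma_finite_measure_axioms]) simp_all
    show "AE y in mvnormal \<mu>\<^sub>0 \<Sigma>\<^sub>0. P y" if "AE y in lborel. P y" for P
      unfolding mvnormal_def using that by (subst AE_density) auto
  qed (use \<sigma> \<tau> in auto)
  then show ?thesis unfolding sampling_law_def
  proof eventually_elim
    case (elim x)
    then show ?case using \<sigma>(2) by (intro posdef_S_d[OF n1 \<tau>, of \<sigma>]) auto
  qed
qed

theorem theorem1:
  fixes L :: "real ^ 'k ^ 'p"
    and n :: nat
    and t T :: int
    and \<gamma> :: real
    and W rf :: "int \<Rightarrow> real"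
    and R :: "real ^ 'p ^ 'p \<Rightarrow> real ^ 'p ^ 'p"
  defines "C \<equiv> wealth_const \<gamma> W rf T t"
    and "r \<equiv> rf (t + 1)"
    and "k \<equiv> real CARD('k)"
  assumes "n > CARD('k)"
    and "0 \<le> t" and "t < T"
    and "\<gamma> > 0"
    and "matrix_square_root R"
  shows
    "(\<forall>(\<mu>\<^sub>0 :: real ^ 'k) \<Sigma>\<^sub>0. posdef \<Sigma>\<^sub>0 \<longrightarrow>
        (AE x in sampling_law n t \<mu>\<^sub>0 \<Sigma>\<^sub>0.
          let post = posterior diffuse_prior n t x;
              tdist = mvt (real n - k) (xbar_d n t x)
                        ((1 / (real n * (real n - k))) *\<^sub>R S_d n t x)
          in prob_space post \<and>
             distr post borel fst = tdist \<and>
             distr post borel (\<lambda>(\<mu>, \<Sigma>). L *v weights C r \<mu> \<Sigma>) =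
               distr (chi_square (real n) \<Otimes>\<^sub>M mvnormal 0 (mat 1) \<Otimes>\<^sub>M tdist) borel
                 (\<lambda>(\<eta>, z, \<mu>). weights_rep R C L (matrix_inv (Sstar_d n t x \<mu>)) (\<mu> - r *\<^sub>R 1) \<eta> z)))
     \<and>
     (\<forall>(m\<^sub>0 :: real ^ 'k) r\<^sub>0 d\<^sub>0 S\<^sub>0 x. r\<^sub>0 > 0 \<longrightarrow> d\<^sub>0 > 2 * k \<longrightarrow> posdef S\<^sub>0 \<longrightarrow>
        (let post = posterior (conjugate_prior m\<^sub>0 r\<^sub>0 d\<^sub>0 S\<^sub>0) n t x;
             tdist = mvt (real n + d\<^sub>0 - 2 * k) (xbar_c m\<^sub>0 r\<^sub>0 n t x)
                       ((1 / ((real n + r\<^sub>0) * (real n + d\<^sub>0 - 2 * k))) *\<^sub>R S_c m\<^sub>0 r\<^sub>0 S\<^sub>0 n t x)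
         in prob_space post \<and>
            distr post borel fst = tdist \<and>
            distr post borel (\<lambda>(\<mu>, \<Sigma>). L *v weights C r \<mu> \<Sigma>) =
              distr (chi_square (real n + d\<^sub>0 - k) \<Otimes>\<^sub>M mvnormal 0 (mat 1) \<Otimes>\<^sub>M tdist) borel
                (\<lambda>(\<eta>, z, \<mu>). weights_rep R C L (matrix_inv (Sstar_c m\<^sub>0 r\<^sub>0 S\<^sub>0 n t x \<mu>))
                                 (\<mu> - r *\<^sub>R 1) \<eta> z)))"
proof (intro conjI allI impI, goal_cases)
  note R = \<open>matrix_square_root R\<close>
  have n1: "n > 1" using \<open>n > CARD('k)\<close> one_le_card_finite[where 'a = 'k] by linarith
  {
    case 1
    from AE_posdef_S_d[OF \<open>n > CARD('k)\<close>] show ?case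
    proof eventually_elim
      case (elim x)
      have meas: "(\<lambda>(\<mu>, \<Sigma>). likelihood n t x \<mu> \<Sigma> * diffuse_prior \<mu> \<Sigma>) \<in> borel_measurable (borel \<Otimes>\<^sub>M borel)"
        unfolding likelihood_def diffuse_prior_def by measurable
      have pos: "((2 * pi) ^ CARD('k)) powr (- real n / 2) > 0" "real n > 0" "real n > real CARD('k)"
        using n1 \<open>n > CARD('k)\<close> by simp_all
      note rep = posterior_representation[OF likelihood_diffuse_prior[OF n1] meas pos(1) elim pos(2,3) R]
      show ?case
        using rep(1,2) rep(3)[where C = C and r = r and L = L]
        unfolding Let_def k_def Sstar_d_def by blast
    qed
  next
    case (2 m\<^sub>0 r\<^sub>0 d\<^sub>0 S\<^sub>0 x)
    define \<nu> where "\<nu> = real n + d\<^sub>0 - real CARD('k)"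
    define \<kappa> where "\<kappa> = ((2 * pi) ^ CARD('k)) powr (- real n / 2) * ((2 * pi) ^ CARD('k) * (1 / r\<^sub>0) ^ CARD('k)) powr (- 1 / 2) /
      (\<integral>\<Omega>. inverse_wishart_kernel d\<^sub>0 S\<^sub>0 \<Omega> \<partial>posdef_lborel)"
    have \<kappa>: "\<kappa> > 0"
      using integral_inverse_wishart_kernel_pos[OF 2(3) _ R, of d\<^sub>0] 2 by (simp add: \<kappa>_def k_def)
    have \<nu>: "\<nu> + real CARD('k) + 1 = real n + d\<^sub>0 + 1" "\<nu> - real CARD('k) = real n + d\<^sub>0 - 2 * k"
      "\<nu> = real n + d\<^sub>0 - k" "\<nu> > real CARD('k)"
      using 2(2) n1 by (simp_all add: \<nu>_def k_def)
    have meas: "(\<lambda>(\<mu>, \<Sigma>). likelihood n t x \<mu> \<Sigma> * conjugate_prior m\<^sub>0 r\<^sub>0 d\<^sub>0 S\<^sub>0 \<mu> \<Sigma>) \<in> borel_measurable (borel \<Otimes>\<^sub>M borel)"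
      unfolding likelihood_def conjugate_prior_def inverse_wishart_density_def by measurable
    have kernel: "likelihood n t x \<mu> \<Sigma> * conjugate_prior m\<^sub>0 r\<^sub>0 d\<^sub>0 S\<^sub>0 \<mu> \<Sigma> = \<kappa> * inverse_wishart_kernel (\<nu> + real CARD('k) + 1)
      (S_c m\<^sub>0 r\<^sub>0 S\<^sub>0 n t x + (real n + r\<^sub>0) *\<^sub>R outer (\<mu> - xbar_c m\<^sub>0 r\<^sub>0 n t x) (\<mu> - xbar_c m\<^sub>0 r\<^sub>0 n t x)) \<Sigma>"
      if "posdef \<Sigma>" for \<mu> \<Sigma>
      unfolding likelihood_conjugate_prior[OF n1 2(1) that] \<kappa>_def \<nu>(1) ..
    have "real n + r\<^sub>0 > 0" using 2(1) by simp
    note rep = posterior_representation[OF kernel meas \<kappa> posdef_S_c[OF n1 2(1,3)] this \<nu>(4) R]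
    from rep(1,2) rep(3)[where C = C and r = r and L = L]
    show ?case unfolding Let_def Sstar_c_def \<nu>(2) \<nu>(3)[symmetric] by blast
  }
qed

end
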